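(* Assume that there exists an interpolation basis $\{S^\phi(x-k)\}_{k\in\mathbb{Z}}$ relative to the samples of $f_s(x)$ at $x=k\in\mathbb{Z}$ in the approximation space $V_0$. If $W_j$ has an interpolation basis $\{S^\psi(2^jx-k)\}_{k\in\mathbb{Z}}$ relative to the samples of $f_s(x)$ at $x=1/2^{j+1}+k/2^j$, $k\in\mathbb{Z}$, then $$\begin{cases}P_s(-z)+P_s(z)=1,\\ Q_s(z)/z-Q_s(-z)/z=1,\end{cases}$$ and $$Q_s(-1)=-1 .$$ Furthermore, there exist two constants $A_s,B_s$ with $0<A_s\le B_s<+\infty$ such that $$A_s\le\left|\overline{P_s(-z)}\,E_s(-z)+\overline{P_s(z)}\,E_s(z)\right|^2\le B_s ,$$ and $$Q_s(z)=\frac{z\,E_s(-z)\,\overline{P_s(-z)}}{\overline{P_s(-z)}\,E_s(-z)+\overline{P_s(z)}\,E_s(z)} .$$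
   Context: Fourier transform: $\hat f(w)=\int_{-\infty}^{+\infty}f(x)e^{-iwx}\,dx$. Throughout $z=e^{-iw/2}$, so replacing $w$ by $w+2\pi$ replaces $z$ by $-z$. $\{V_j\}_{j\in\mathbb{Z}}$ is a multiresolution analysis of $L^2(\mathbb{R})$ (nested closed subspaces $V_j\subset V_{j+1}$, $f(x)\in V_j\iff f(2x)\in V_{j+1}$, $\overline{\bigcup_j V_j}=L^2(\mathbb{R})$, $\bigcap_j V_j=\{0\}$) with a real scaling function $\phi$, i.e. $\{\phi(x-k)\}_{k\in\mathbb{Z}}$ is a Riesz basis of $V_0$. The wavelet space $W_j$ is the orthogonal complement of $V_j$ in $V_{j+1}$, so $V_{j+1}=V_j\oplus W_j$. The spaces $V_j$ and $W_j$ are regarded as reproducing kernel Hilbert spaces of functions, so that point values make sense. Standing assumptions: the series $\sum_{k}\phi(k/2)e^{-iwk/2}$ and $\sum_k\hat\phi(w+4k\pi)$ converge pointwise everywhere, and the Poisson summation identity $\frac12\sum_k\phi(k/2)e^{-iwk/2}=\sum_k\hat\phi(w+4k\pi)$ holds. For a wavelet $\psi$ of $W_0$ (i.e. $\{\psi(x-k)\}_k$ a Riesz basis of $W_0$), written $\psi(x)=\sum_k q_k\phi(2x-k)$, the series $Q_\psi(z)=\frac12\sum_k q_kz^k$ converges pointwise everywhere; consequently the Poisson identity $\frac12\sum_kS^\psi(k/2)e^{-iwk/2}=\sum_k\hat S^\psi(w+4k\pi)$ is used for $S^\psi$, with both series converging pointwise everywhere. Interpolation basis of $V_0$ relative to the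 samples at $x=k$: a Riesz basis $\{S^\phi(x-k)\}_{k}$ of $V_0$ such that $f_s(x)=\sum_{k}f_s(k)S^\phi(x-k)$ for every $f_s\in V_0$; then $\hat S^\phi(w)=\hat\phi(w)/\sum_k\phi(k)e^{-iwk}=\hat\phi(w)/\sum_k\hat\phi(w+2k\pi)$, where $1/\sum_k\hat\phi(w+2k\pi)\in L^2[0,2\pi]$. Interpolation basis of $W_j$ relative to the samples at $x=1/2^{j+1}+k/2^j$: a Riesz basis $\{S^\psi(2^jx-k)\}_{k}$ of $W_j$ such that $f_s(x)=\sum_{k}f_s(k/2^j+1/2^{j+1})S^\psi(2^jx-k)$ for every $f_s\in W_j$. Definitions: $P_s(z)=\frac12\sum_{k}S^\phi(k/2)z^k=\sum_{k}\hat S^\phi(w+4k\pi)$; $Q_s(z)=\frac12\sum_kS^\psi(k/2)e^{-iwk/2}=\sum_k\hat S^\psi(w+4k\pi)$; $E_s(z)=E_s(e^{-iw/2})=\sum_{k}\left|\hat S^\phi\left(\frac w2+2k\pi\right)\right|^2$.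
   Formalization: The bounds on |conj(P_s(-z))E_s(-z)+conj(P_s(z))E_s(z)|² and the formula for Q_s(z) are stated for almost every w, and at every w where E_s, P_s (at ±z) and Q_s are continuous, because the Fourier transform of S^φ, hence E_s, is only determined almost everywhere. *)

theory Defs
  imports "HOL-Analysis.Analysis"
begin

section \<open>Square-integrable functions on the real line\<close>

text \<open>
  Elements of the spaces are genuine functions, not classes modulo null sets, because point
  values are used.  The seminorm below is meaningful for square-integrable arguments only.
\<close>

definition L2 :: "(real \<Rightarrow> complex) set" where
  "L2 = {f. f \<in> borel_measurable lebesgue \<and> integrable lebesgue (\<lambda>x. (cmod (f x))\<^sup>2)}"

definition norm_L2 :: "(real \<Rightarrow> complex) \<Rightarrow> real" where
  "norm_L2 f = sqrt (LINT x|lebesgue. (cmod (f x))\<^sup>2)"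

definition inner_L2 :: "(real \<Rightarrow> complex) \<Rightarrow> (real \<Rightarrow> complex) \<Rightarrow> complex" where
  "inner_L2 f g = (LINT x|lebesgue. f x * cnj (g x))"

text \<open>
  Fourier--Plancherel transform: \<open>F\<close> is a representative of the \<open>L\<^sup>2\<close> limit of the integrals
  of \<open>f x * exp (- i w x)\<close> over \<open>[-R, R]\<close>.  If \<open>f\<close> is also integrable, then \<open>F\<close> is almost
  everywhere equal to the integral over the whole line.  The extended nonnegative integral is
  used so that non-integrability of the difference cannot be mistaken for the value 0.
\<close>

definition fourier_transform :: "(real \<Rightarrow> complex) \<Rightarrow> (real \<Rightarrow> complex) \<Rightarrow> bool" where
  "fourier_transform f F \<longleftrightarrow> f \<in> L2 \<and> F \<in> L2 \<and>
     ((\<lambda>R. \<integral>\<^sup>+ w. ennreal ((cmod (F w - (LINT x:{-R..R}|lebesgue. f x * cis (- (w * x)))))\<^sup>2) \<partial>lebesgue)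
        \<longlongrightarrow> 0) at_top"


section \<open>Bilateral series\<close>

text \<open>
  A series over the integers is the limit of its symmetric partial sums.  Absolute convergence
  would be too much to ask for: already for the sinc function the series
  \<open>\<Sum>k. \<phi> (k/2) * exp (- i w k / 2)\<close> converges only conditionally, and at the jumps of its sum
  only symmetrically.
\<close>

definition bi_sums :: "(int \<Rightarrow> complex) \<Rightarrow> complex \<Rightarrow> bool" where
  "bi_sums a s \<longleftrightarrow> (\<lambda>n. \<Sum>k = - int n..int n. a k) \<longlonglongrightarrow> s"

definition bi_summable :: "(int \<Rightarrow> complex) \<Rightarrow> bool" where
  "bi_summable a \<longleftrightarrow> (\<exists>s. bi_sums a s)"

definition bi_suminf :: "(int \<Rightarrow> complex) \<Rightarrow> complex" where
  "bi_suminf a = lim (\<lambda>n. \<Sum>k = - int n..int n. a k)"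

definition L2_expansion ::
  "(int \<Rightarrow> real \<Rightarrow> complex) \<Rightarrow> (int \<Rightarrow> complex) \<Rightarrow> (real \<Rightarrow> complex) \<Rightarrow> bool" where
  "L2_expansion e c f \<longleftrightarrow>
     (\<lambda>n. norm_L2 (\<lambda>x. f x - (\<Sum>k = - int n..int n. c k * e k x))) \<longlonglongrightarrow> 0"


section \<open>Reproducing kernel spaces and Riesz bases\<close>

text \<open>
  A closed subspace of \<open>L\<^sup>2\<close>, realised by functions with bounded point evaluations.  The last
  condition makes the representative of each class unique, and it turns convergence in norm
  within the space into pointwise convergence.
\<close>

definition rkhs_L2 :: "(real \<Rightarrow> complex) set \<Rightarrow> bool" where
  "rkhs_L2 V \<longleftrightarrow> V \<subseteq> L2 \<and> (\<lambda>x. 0) \<in> V \<and>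
     (\<forall>f\<in>V. \<forall>g\<in>V. (\<lambda>x. f x + g x) \<in> V) \<and>
     (\<forall>c. \<forall>f\<in>V. (\<lambda>x. c * f x) \<in> V) \<and>
     (\<forall>u f. (\<forall>n::nat. u n \<in> V) \<and> f \<in> L2 \<and> (\<lambda>n. norm_L2 (\<lambda>x. u n x - f x)) \<longlonglongrightarrow> 0
        \<longrightarrow> (\<exists>g\<in>V. AE x in lebesgue. g x = f x)) \<and>
     (\<forall>x. \<exists>C. \<forall>f\<in>V. cmod (f x) \<le> C * norm_L2 f)"

definition riesz_basis :: "(int \<Rightarrow> real \<Rightarrow> complex) \<Rightarrow> (real \<Rightarrow> complex) set \<Rightarrow> bool" where
  "riesz_basis e V \<longleftrightarrow> (\<forall>k. e k \<in> V) \<and>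
     (\<forall>f\<in>V. \<forall>\<epsilon>>0. \<exists>F c. finite F \<and> norm_L2 (\<lambda>x. f x - (\<Sum>k\<in>F. c k * e k x)) < \<epsilon>) \<and>
     (\<exists>A B. 0 < A \<and> A \<le> B \<and>
        (\<forall>F c. finite F \<longrightarrow>
           A * (\<Sum>k\<in>F. (cmod (c k))\<^sup>2) \<le> (norm_L2 (\<lambda>x. \<Sum>k\<in>F. c k * e k x))\<^sup>2 \<and>
           (norm_L2 (\<lambda>x. \<Sum>k\<in>F. c k * e k x))\<^sup>2 \<le> B * (\<Sum>k\<in>F. (cmod (c k))\<^sup>2)))"

definition interpolation_basis ::
  "(int \<Rightarrow> real \<Rightarrow> complex) \<Rightarrow> (int \<Rightarrow> real) \<Rightarrow> (real \<Rightarrow> complex) set \<Rightarrow> bool" where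
  "interpolation_basis e t V \<longleftrightarrow> riesz_basis e V \<and> (\<forall>f\<in>V. L2_expansion e (\<lambda>k. f (t k)) f)"


section \<open>Multiresolution analyses\<close>

definition multiresolution_analysis ::
  "(int \<Rightarrow> (real \<Rightarrow> complex) set) \<Rightarrow> (real \<Rightarrow> real) \<Rightarrow> bool" where
  "multiresolution_analysis V \<phi> \<longleftrightarrow>
     (\<forall>j. rkhs_L2 (V j)) \<and>
     (\<forall>j. V j \<subseteq> V (j + 1)) \<and>
     (\<forall>j f. f \<in> V j \<longleftrightarrow> (\<lambda>x. f (2 * x)) \<in> V (j + 1)) \<and>
     (\<forall>g\<in>L2. \<forall>\<epsilon>>0. \<exists>j. \<exists>f\<in>V j. norm_L2 (\<lambda>x. g x - f x) < \<epsilon>) \<and>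
     (\<Inter>j. V j) = {\<lambda>x. 0} \<and>
     riesz_basis (\<lambda>k x. complex_of_real (\<phi> (x - of_int k))) (V 0)"

definition wavelet_space :: "(int \<Rightarrow> (real \<Rightarrow> complex) set) \<Rightarrow> int \<Rightarrow> (real \<Rightarrow> complex) set" where
  "wavelet_space V j = {f \<in> V (j + 1). \<forall>g\<in>V j. inner_L2 f g = 0}"


section \<open>Symbols\<close>

definition half_symbol :: "(int \<Rightarrow> complex) \<Rightarrow> complex \<Rightarrow> complex" where
  "half_symbol a z = bi_suminf (\<lambda>k. a k * z powi k) / 2"

text \<open>
  Pointwise convergence everywhere of both sides of the Poisson summation formula on the
  half-integers, together with the formula itself.
\<close>

definition half_poisson :: "(real \<Rightarrow> complex) \<Rightarrow> (real \<Rightarrow> complex) \<Rightarrow> bool" where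
  "half_poisson f F \<longleftrightarrow> (\<forall>w.
     bi_summable (\<lambda>k. f (of_int k / 2) * cis (- (w / 2)) powi k) \<and>
     bi_summable (\<lambda>k. F (w + 4 * of_int k * pi)) \<and>
     half_symbol (\<lambda>k. f (of_int k / 2)) (cis (- (w / 2))) = bi_suminf (\<lambda>k. F (w + 4 * of_int k * pi)))"

text \<open>
  As a function of \<open>w\<close> this has period \<open>4\<pi>\<close>, hence it is a function of \<open>z = exp (- i w / 2)\<close>;
  its value at \<open>-z\<close> is the value at \<open>w + 2\<pi>\<close>.
\<close>

definition energy_symbol :: "(real \<Rightarrow> complex) \<Rightarrow> real \<Rightarrow> real" where
  "energy_symbol F w = (\<Sum>\<^sub>\<infinity>k\<in>(UNIV :: int set). (cmod (F (w / 2 + 2 * of_int k * pi)))\<^sup>2)"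

end

theory Submission
  imports Defs "HOL-Probability.Sinc_Integral"
begin

text \<open>
  Write \<open>p(w) = P(exp(-iw/2))\<close> and \<open>q(w) = Q(exp(-iw/2))\<close>, let \<open>Sh\<close> and \<open>Wh\<close> be the Fourier transforms of the two
  interpolating functions, and let \<open>G(w)\<close> be the sum of \<open>|Sh(w + 2 pi k)|\<^sup>2\<close> over all \<open>k\<close>, so
  that \<open>E(w) = G(w/2)\<close>.  The interpolation formula in \<open>V\<^sub>0\<close>, applied to the two functions
  dilated by 2, gives \<open>Sh(w) = p(w) Sh(w/2)\<close> and \<open>Wh(w) = q(w) Sh(w/2)\<close> almost everywhere.
  The Riesz bounds turn into \<open>A \<le> G \<le> B\<close> and into a bound for \<open>q\<close>; the orthogonality of
  \<open>W\<^sub>0\<close> and \<open>V\<^sub>0\<close> turns into \<open>Q(z) cnj(P(z)) E(z) + Q(-z) cnj(P(-z)) E(-z) = 0\<close>.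
  Since \<open>Q(-z) = Q(z) - z\<close>, this says \<open>Q(z) D = z E(-z) cnj(P(-z))\<close> and
  \<open>(Q(z) - z) D = - z E(z) cnj(P(z))\<close>; adding moduli and using \<open>P(z) + P(-z) = 1\<close>,
  \<open>(|Q(z)| + |Q(z) - z|) |D| \<ge> A\<close>, so \<open>D\<close> is bounded away from 0.

  The value \<open>Q(1) = 0\<close> cannot be read off from identities that hold almost everywhere.  As the
  series converges at \<open>z = 1\<close>, its sum is the limit of the Fejer means of order \<open>2\<^sup>n\<close>, which only
  depends on the limits of \<open>q(w / 2\<^sup>n)\<close>.  The quotient \<open>r = |Sh|\<^sup>2 / G\<close> satisfies
  \<open>r(2w) \<le> r(w) \<le> 1\<close>, and the density of the union of the \<open>V\<^sub>j\<close>, tested on the indicator of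
  \<open>[0,1]\<close>, whose transform vanishes almost nowhere, forces \<open>r(w / 2\<^sup>n)\<close> to tend to 1.  Hence
  \<open>p(w / 2\<^sup>n + 2 pi)\<close> and with it \<open>q(w / 2\<^sup>n)\<close> tend to 0.
\<close>

section \<open>The space of square-integrable functions\<close>

text \<open>Two kinds of limit have to be kept apart. The symbols are symmetric sums that converge
  at every point and may be discontinuous, whereas the interpolation formula converges in
  \<open>L2\<close>. Fatou's lemma identifies the two limits, but only almost everywhere; hence the
  null set in the formula for \<open>Q\<close>, and the separate argument for \<open>Q 1\<close>.
  Translates enter through a single quantity, the periodized squared modulus \<open>bracket\<close>.
  By Plancherel the norm of a finite combination of translates is the integral of |T|^2 against it,
  T being a trigonometric polynomial, so testing with all T turns norm inequalities into pointwise
  ones. At the origin only limits along \<open>w / 2 ^ n\<close> for almost every \<open>w\<close>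
  are available. The Fejer kernel of order \<open>2 ^ n\<close>, rescaled by \<open>2 ^ n\<close>,
  sees exactly these points, and Cesaro means do not change the sum of a convergent series. The test
  function must have a transform that vanishes almost nowhere because density only yields that the
  product of that transform with the square root of 1 - lim r is zero.\<close>

lemma measurable_affine_lebesgue:
  fixes c t :: real
  assumes "c \<noteq> 0"
  shows "(\<lambda>x. t + c * x) \<in> lebesgue \<rightarrow>\<^sub>M lebesgue"
  using lebesgue_affine_measurable[of "\<lambda>_. c" t] assms by simp

lemma borel_measurable_lebesgue_affine:
  fixes c t :: real
  assumes "f \<in> borel_measurable lebesgue" "c \<noteq> 0"
  shows "(\<lambda>x. f (t + c * x)) \<in> borel_measurable lebesgue"
  using measurable_compose[OF measurable_affine_lebesgue[OF assms(2)] assms(1)] by simp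

text \<open>Lebesgue measure is a nonzero constant multiple of its image under the affine map, so
  the preimage of a null set is null.\<close>

lemma AE_lebesgue_affine:
  fixes c t :: real
  assumes "AE x in lebesgue. P x" "c \<noteq> 0"
  shows "AE x in lebesgue. P (t + c * x)"
proof -
  have "AE x in density (distr lebesgue lebesgue (\<lambda>x. t + c * x)) (\<lambda>_. ennreal \<bar>c\<bar>). P x"
    by (rule subst[OF lebesgue_real_affine[OF assms(2), of t], of "\<lambda>M. AE x in M. P x"]) (rule assms(1))
  then have "AE x in distr lebesgue lebesgue (\<lambda>x. t + c * x). P x"
    using assms(2) by (subst (asm) AE_density) auto
  then show ?thesis
    by (rule AE_distrD[OF measurable_affine_lebesgue[OF assms(2)]])
qed

lemma borel_measurable_continuous_lebesgue:
  fixes f :: "real \<Rightarrow> 'a::euclidean_space"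
  assumes "continuous_on UNIV f"
  shows "f \<in> borel_measurable lebesgue"
  using borel_measurable_continuous_onI[OF assms] by (intro measurable_completion) simp

text \<open>\<open>norm_L2\<close> falls back to 0 when the square is not integrable. The extended
  value does not, so its finiteness can certify membership in \<open>L2\<close>.\<close>

definition energy :: "(real \<Rightarrow> complex) \<Rightarrow> ennreal" where
  "energy f = (\<integral>\<^sup>+x. ennreal ((cmod (f x))\<^sup>2) \<partial>lebesgue)"

lemma L2_measurable: "f \<in> L2 \<Longrightarrow> f \<in> borel_measurable lebesgue"
  by (simp add: L2_def)

lemma L2_integrable: "f \<in> L2 \<Longrightarrow> integrable lebesgue (\<lambda>x. (cmod (f x))\<^sup>2)"
  by (simp add: L2_def)

lemma L2_iff_energy: "f \<in> L2 \<longleftrightarrow> f \<in> borel_measurable lebesgue \<and> energy f < \<infinity>"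
  unfolding L2_def energy_def by (auto simp: integrable_iff_bounded)

lemma energy_eq_norm: "f \<in> L2 \<Longrightarrow> energy f = ennreal ((norm_L2 f)\<^sup>2)"
  unfolding energy_def norm_L2_def
  by (subst nn_integral_eq_integral) (auto simp: L2_def)

lemma norm_L2_nonneg [simp]: "0 \<le> norm_L2 f"
  by (simp add: norm_L2_def)

lemma norm_L2_power2: "(norm_L2 f)\<^sup>2 = (LINT x|lebesgue. (cmod (f x))\<^sup>2)"
  by (simp add: norm_L2_def)

lemma norm_L2_eqI:
  assumes "energy f = ennreal (r\<^sup>2)" "0 \<le> r" "f \<in> borel_measurable lebesgue"
  shows "f \<in> L2" "norm_L2 f = r"
proof -
  show *: "f \<in> L2" using assms by (simp add: L2_iff_energy)
  show "norm_L2 f = r" using energy_eq_norm[OF *] assms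
    by (simp add: ennreal_inj)
qed

lemma L2_cmult:
  assumes "f \<in> L2" shows "(\<lambda>x. c * f x) \<in> L2"
  using assms by (auto simp: L2_def norm_mult power_mult_distrib)

lemma norm_L2_cmult: "norm_L2 (\<lambda>x. c * f x) = cmod c * norm_L2 f"
  by (simp add: norm_L2_def norm_mult power_mult_distrib real_sqrt_mult)

lemma L2_uminus: "f \<in> L2 \<Longrightarrow> (\<lambda>x. - f x) \<in> L2"
  using L2_cmult[of f "-1"] by simp

lemma norm_L2_uminus: "norm_L2 (\<lambda>x. - f x) = norm_L2 f"
  using norm_L2_cmult[of "-1" f] by simp

lemma L2_zero [simp]: "(\<lambda>x. 0) \<in> L2"
  by (simp add: L2_def)

text \<open>Young's inequality with a free weight: weight 1 gives the factor 2 used for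
  integrability, and the ratio of the two norms gives the triangle inequality for
  \<open>norm_L2\<close>.\<close>

lemma cmod_add_square_le:
  fixes a b :: complex
  assumes "0 < \<delta>"
  shows "(cmod (a + b))\<^sup>2 \<le> (1 + \<delta>) * (cmod a)\<^sup>2 + (1 + 1 / \<delta>) * (cmod b)\<^sup>2"
proof -
  have "0 \<le> (\<delta> * cmod a - cmod b)\<^sup>2 / \<delta>" using assms by simp
  also have "\<dots> = \<delta> * (cmod a)\<^sup>2 + (1 / \<delta>) * (cmod b)\<^sup>2 - 2 * cmod a * cmod b"
    using assms by (simp add: field_simps power2_eq_square)
  finally have "2 * cmod a * cmod b \<le> \<delta> * (cmod a)\<^sup>2 + (1 / \<delta>) * (cmod b)\<^sup>2" by simp
  moreover have "(cmod (a + b))\<^sup>2 \<le> (cmod a + cmod b)\<^sup>2"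
    by (simp add: norm_triangle_ineq power_mono)
  ultimately show ?thesis by (simp add: power2_sum algebra_simps)
qed

lemma cmod_diff_square: "(cmod (a - b))\<^sup>2 = (cmod a)\<^sup>2 + (cmod b)\<^sup>2 - 2 * Re (a * cnj b)"
  unfolding cmod_power2 by (simp add: power2_eq_square algebra_simps)

lemma le_one_plus_square: "(x::real) \<le> 1 + x\<^sup>2"
proof -
  have "0 \<le> (x - 1 / 2)\<^sup>2" by simp
  then show ?thesis by (simp add: power2_eq_square algebra_simps)
qed

lemma L2_add:
  assumes "f \<in> L2" "g \<in> L2" shows "(\<lambda>x. f x + g x) \<in> L2"
proof -
  have "integrable lebesgue (\<lambda>x. 2 * (cmod (f x))\<^sup>2 + 2 * (cmod (g x))\<^sup>2)"
    using assms by (auto simp: L2_def)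
  then have "integrable lebesgue (\<lambda>x. (cmod (f x + g x))\<^sup>2)"
    by (rule Bochner_Integration.integrable_bound)
       (use assms cmod_add_square_le[of 1] in \<open>auto simp: L2_def\<close>)
  then show ?thesis using assms by (auto simp: L2_def)
qed

lemma L2_diff:
  assumes "f \<in> L2" "g \<in> L2" shows "(\<lambda>x. f x - g x) \<in> L2"
  using L2_add[OF assms(1) L2_uminus[OF assms(2)]] by simp

lemma L2_sum:
  assumes "\<And>k. k \<in> F \<Longrightarrow> f k \<in> L2" shows "(\<lambda>x. \<Sum>k\<in>F. f k x) \<in> L2"
  using assms by (induction F rule: infinite_finite_induct) (auto intro: L2_add)

lemma norm_L2_triangle:
  assumes "f \<in> L2" "g \<in> L2"
  shows "norm_L2 (\<lambda>x. f x + g x) \<le> norm_L2 f + norm_L2 g"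
proof (rule field_le_epsilon)
  fix e :: real assume "0 < e"
  \<comment> \<open>The extra \<open>e / 2\<close> makes both numbers positive, so the weight
    \<open>b / a\<close> is legitimate; with it the bound collapses to
    \<open>(a + b)^2\<close>.\<close>
  define a b where "a = norm_L2 f + e / 2" and "b = norm_L2 g + e / 2"
  have ab: "0 < a" "0 < b" "norm_L2 f \<le> a" "norm_L2 g \<le> b"
    using \<open>0 < e\<close> norm_L2_nonneg[of f] norm_L2_nonneg[of g] by (auto simp: a_def b_def simp del: norm_L2_nonneg)
  have "(norm_L2 (\<lambda>x. f x + g x))\<^sup>2 \<le>
     (LINT x|lebesgue. (1 + b / a) * (cmod (f x))\<^sup>2 + (1 + 1 / (b / a)) * (cmod (g x))\<^sup>2)"
    unfolding norm_L2_power2 using ab assms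
    by (intro integral_mono Bochner_Integration.integrable_add integrable_mult_right L2_integrable
        cmod_add_square_le L2_add) auto
  also have "\<dots> = (1 + b / a) * (norm_L2 f)\<^sup>2 + (1 + 1 / (b / a)) * (norm_L2 g)\<^sup>2"
    using assms by (subst Bochner_Integration.integral_add) (auto simp: norm_L2_power2 L2_integrable)
  also have "\<dots> \<le> (1 + b / a) * a\<^sup>2 + (1 + 1 / (b / a)) * b\<^sup>2"
    using ab by (intro add_mono mult_left_mono power_mono) auto
  also have "\<dots> = (a + b)\<^sup>2"
    using ab by (simp add: field_simps power2_eq_square)
  finally show "norm_L2 (\<lambda>x. f x + g x) \<le> norm_L2 f + norm_L2 g + e"
    using ab by (simp add: abs_le_square_iff[symmetric] a_def b_def)
qed

lemma norm_L2_triangle_diff: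
  assumes "f \<in> L2" "g \<in> L2"
  shows "norm_L2 (\<lambda>x. f x - g x) \<le> norm_L2 f + norm_L2 g"
  using norm_L2_triangle[OF assms(1) L2_uminus[OF assms(2)]] by (simp add: norm_L2_uminus)

lemma norm_L2_minus_commute: "norm_L2 (\<lambda>x. f x - g x) = norm_L2 (\<lambda>x. g x - f x)"
  by (simp add: norm_L2_def norm_minus_commute)

lemma norm_L2_diff_le:
  assumes "f \<in> L2" "g \<in> L2"
  shows "\<bar>norm_L2 f - norm_L2 g\<bar> \<le> norm_L2 (\<lambda>x. f x - g x)"
  using norm_L2_triangle[OF L2_diff[OF assms] assms(2)]
    norm_L2_triangle[OF L2_diff[OF assms(2,1)] assms(1)]
  by (simp add: norm_L2_minus_commute[of g f])

lemma L2_affine: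
  assumes "f \<in> L2" "c \<noteq> 0"
  shows "(\<lambda>x. f (t + c * x)) \<in> L2"
  using assms lebesgue_integrable_real_affine_iff[of c "\<lambda>x. (cmod (f x))\<^sup>2" t]
  by (auto simp: L2_def borel_measurable_lebesgue_affine)

lemma norm_L2_affine:
  assumes "c \<noteq> 0"
  shows "norm_L2 f = sqrt \<bar>c\<bar> * norm_L2 (\<lambda>x. f (t + c * x))"
  unfolding norm_L2_def using lebesgue_integral_real_affine[OF assms, of "\<lambda>x. (cmod (f x))\<^sup>2" t]
  by (simp add: real_sqrt_mult)

lemma L2_shift: "f \<in> L2 \<Longrightarrow> (\<lambda>x. f (x - t)) \<in> L2"
  using L2_affine[of f 1 "-t"] by simp

lemma norm_L2_shift: "norm_L2 (\<lambda>x. f (x - t)) = norm_L2 f"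
  using norm_L2_affine[of 1 f "-t"] by simp

lemma L2_bounded_mult:
  assumes "f \<in> L2" "m \<in> borel_measurable lebesgue" "\<And>x. cmod (m x) \<le> K"
  shows "(\<lambda>x. m x * f x) \<in> L2" "norm_L2 (\<lambda>x. m x * f x) \<le> K * norm_L2 f"
proof -
  have K: "0 \<le> K" using assms(3)[of 0] norm_ge_zero order_trans by blast
  have bd: "(cmod (m x * f x))\<^sup>2 \<le> K\<^sup>2 * (cmod (f x))\<^sup>2" for x
    using assms(3)[of x] by (auto simp: norm_mult power_mult_distrib intro!: mult_right_mono power_mono)
  have i: "integrable lebesgue (\<lambda>x. (cmod (m x * f x))\<^sup>2)"
    by (rule Bochner_Integration.integrable_bound[of _ "\<lambda>x. K\<^sup>2 * (cmod (f x))\<^sup>2"])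
       (use assms(1,2) bd in \<open>auto simp: L2_def\<close>)
  then show L: "(\<lambda>x. m x * f x) \<in> L2" using assms(1,2) by (auto simp: L2_def)
  have "(norm_L2 (\<lambda>x. m x * f x))\<^sup>2 \<le> (LINT x|lebesgue. K\<^sup>2 * (cmod (f x))\<^sup>2)"
    unfolding norm_L2_power2 by (rule integral_mono[OF i]) (use assms(1) bd in \<open>auto simp: L2_def\<close>)
  also have "\<dots> = (K * norm_L2 f)\<^sup>2" by (simp add: norm_L2_power2 power_mult_distrib)
  finally show "norm_L2 (\<lambda>x. m x * f x) \<le> K * norm_L2 f"
    using K by (simp add: abs_le_square_iff[symmetric])
qed

lemma L2_indicator:
  assumes "f \<in> L2" "A \<in> sets lebesgue" shows "(\<lambda>x. indicator A x * f x) \<in> L2"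
  by (rule L2_bounded_mult[of f "indicator A" 1]) (use assms in \<open>auto simp: indicator_def\<close>)

text \<open>Fatou's lemma bounds the energy of the pointwise limit by the lower limit of the
  energies, which is 0. This is how an \<open>L2\<close> limit and a pointwise limit of the same
  sequence are identified.\<close>

lemma AE_zero_if_pointwise_limit:
  assumes L2: "\<And>n. u n \<in> L2" and to0: "(\<lambda>n. norm_L2 (u n)) \<longlonglongrightarrow> 0"
    and lim: "AE x in lebesgue. (\<lambda>n. u n x) \<longlonglongrightarrow> f x"
  shows "AE x in lebesgue. f x = 0"
proof -
  have [measurable]: "u n \<in> borel_measurable lebesgue" for n using L2 by (simp add: L2_def)
  have eq: "AE x in lebesgue. ennreal ((cmod (f x))\<^sup>2) = liminf (\<lambda>n. ennreal ((cmod (u n x))\<^sup>2))"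
    using lim
  proof eventually_elim
    case (elim x)
    have "(\<lambda>n. ennreal ((cmod (u n x))\<^sup>2)) \<longlonglongrightarrow> ennreal ((cmod (f x))\<^sup>2)"
      using elim by (intro tendsto_ennrealI tendsto_power tendsto_norm)
    then show ?case by (intro lim_imp_Liminf[symmetric]) auto
  qed
  have "(\<lambda>n. ennreal ((norm_L2 (u n))\<^sup>2)) \<longlonglongrightarrow> ennreal (0\<^sup>2)"
    using to0 by (intro tendsto_ennrealI tendsto_power)
  then have "(\<lambda>n. energy (u n)) \<longlonglongrightarrow> 0" by (simp add: energy_eq_norm[OF L2])
  then have *: "liminf (\<lambda>n. energy (u n)) = 0" by (intro lim_imp_Liminf) auto
  have "(\<integral>\<^sup>+x. liminf (\<lambda>n. ennreal ((cmod (u n x))\<^sup>2)) \<partial>lebesgue) \<le> liminf (\<lambda>n. energy (u n))"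
    unfolding energy_def by (rule nn_integral_liminf) auto
  then have "(\<integral>\<^sup>+x. liminf (\<lambda>n. ennreal ((cmod (u n x))\<^sup>2)) \<partial>lebesgue) = 0" using * by simp
  then have "AE x in lebesgue. liminf (\<lambda>n. ennreal ((cmod (u n x))\<^sup>2)) = 0"
    by (subst (asm) nn_integral_0_iff_AE) auto
  with eq show ?thesis by eventually_elim (auto simp: ennreal_eq_0_iff)
qed

section \<open>Trigonometric polynomials\<close>

text \<open>The sign is that of the multiplier by which translation through \<open>k\<close> acts on
  a Fourier transform.\<close>

definition trig_sum :: "int set \<Rightarrow> (int \<Rightarrow> complex) \<Rightarrow> real \<Rightarrow> complex" where
  "trig_sum F c w = (\<Sum>k\<in>F. c k * cis (- (of_int k * w)))"

definition trig_poly :: "(real \<Rightarrow> complex) \<Rightarrow> bool" where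
  "trig_poly T \<longleftrightarrow> (\<exists>F c. finite F \<and> T = trig_sum F c)"

lemma trig_poly_trig_sum: "finite F \<Longrightarrow> trig_poly (trig_sum F c)"
  by (auto simp: trig_poly_def)

lemma trig_poly_monomial: "trig_poly (\<lambda>w. a * cis (- (of_int k * w)))"
  unfolding trig_poly_def
  by (rule exI[of _ "{k}"], rule exI[of _ "\<lambda>_. a"]) (auto simp: trig_sum_def)

lemma trig_poly_const: "trig_poly (\<lambda>w. a)"
  using trig_poly_monomial[of a 0] by simp

lemma trig_poly_add:
  assumes "trig_poly S" "trig_poly T" shows "trig_poly (\<lambda>w. S w + T w)"
proof -
  obtain F c G d where *: "finite F" "S = trig_sum F c" "finite G" "T = trig_sum G d"
    using assms by (auto simp: trig_poly_def)
  have "(\<lambda>w. S w + T w) =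
    trig_sum (F \<union> G) (\<lambda>k. (if k \<in> F then c k else 0) + (if k \<in> G then d k else 0))"
  proof
    fix w
    have "S w = (\<Sum>k\<in>F \<union> G. (if k \<in> F then c k else 0) * cis (- (of_int k * w)))"
      unfolding * trig_sum_def by (rule sum.mono_neutral_cong_left) (use * in auto)
    moreover have "T w = (\<Sum>k\<in>F \<union> G. (if k \<in> G then d k else 0) * cis (- (of_int k * w)))"
      unfolding * trig_sum_def by (rule sum.mono_neutral_cong_left) (use * in auto)
    ultimately show "S w + T w = trig_sum (F \<union> G) (\<lambda>k. (if k \<in> F then c k else 0) + (if k \<in> G then d k else 0)) w"
      unfolding trig_sum_def by (simp only: sum.distrib[symmetric] distrib_right)
  qed
  then show ?thesis using * by (auto simp: trig_poly_def)
qed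

lemma trig_poly_sum:
  assumes "\<And>i. i \<in> I \<Longrightarrow> trig_poly (T i)" shows "trig_poly (\<lambda>w. \<Sum>i\<in>I. T i w)"
  using assms
  by (induction I rule: infinite_finite_induct) (auto intro: trig_poly_add trig_poly_const)

lemma trig_poly_mult:
  assumes "trig_poly S" "trig_poly T" shows "trig_poly (\<lambda>w. S w * T w)"
proof -
  obtain F c G d where *: "finite F" "S = trig_sum F c" "finite G" "T = trig_sum G d"
    using assms by (auto simp: trig_poly_def)
  have eq: "(\<lambda>w. S w * T w) = (\<lambda>w. \<Sum>k\<in>F. \<Sum>l\<in>G. (c k * d l) * cis (- (of_int (k + l) * w)))"
    unfolding * trig_sum_def sum_product
    by (intro ext sum.cong refl) (simp add: cis_mult algebra_simps)
  show ?thesis unfolding eq by (intro trig_poly_sum trig_poly_monomial)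
qed

lemma continuous_on_trig_sum: "continuous_on A (trig_sum F c)"
  unfolding trig_sum_def by (intro continuous_intros)

lemma continuous_on_trig_poly: "trig_poly T \<Longrightarrow> continuous_on A T"
  by (auto simp: trig_poly_def continuous_on_trig_sum)

lemma borel_measurable_trig_poly: "trig_poly T \<Longrightarrow> T \<in> borel_measurable lebesgue"
  by (rule borel_measurable_continuous_lebesgue) (rule continuous_on_trig_poly)

lemma trig_sum_bound: "cmod (trig_sum F c w) \<le> (\<Sum>k\<in>F. cmod (c k))"
  unfolding trig_sum_def by (rule sum_norm_le) (simp add: norm_mult)

lemma trig_sum_periodic: "trig_sum F c (w + 2 * pi * of_int n) = trig_sum F c w"
proof -
  have "cis (- (of_int k * (w + 2 * pi * of_int n))) = cis (- (of_int k * w))" for k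
  proof -
    have "cis (- (of_int k * (w + 2 * pi * of_int n))) =
      cis (- (of_int k * w)) * cis (2 * pi * of_int (- k * n))"
      by (simp add: cis_mult algebra_simps)
    also have "cis (2 * pi * of_int (- k * n)) = 1" by (rule cis_multiple_2pi) auto
    finally show ?thesis by simp
  qed
  then show ?thesis by (simp add: trig_sum_def)
qed

text \<open>A real-linear functional of \<open>cis w\<close> is a combination of
  \<open>cos w\<close> and \<open>sin w\<close>, hence of the two exponentials of frequency 1; sums
  and products stay trigonometric polynomials. This makes Stone-Weierstrass on the circle
  usable.\<close>

lemma trig_poly_of_real_polynomial:
  assumes "real_polynomial_function p"
  shows "trig_poly (\<lambda>w. of_real (p (cis w)))"
  using assms
proof induction
  case (linear f)
  have fz: "f z = Re z * f 1 + Im z * f \<i>" for z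
  proof -
    have "z = Re z *\<^sub>R 1 + Im z *\<^sub>R \<i>" by (simp add: complex_eq_iff)
    then have "f z = f (Re z *\<^sub>R 1 + Im z *\<^sub>R \<i>)" by (rule arg_cong)
    also have "\<dots> = Re z * f 1 + Im z * f \<i>"
      using linear bounded_linear.linear[OF linear] by (simp add: linear_add linear_scale)
    finally show ?thesis .
  qed
  have f_cis: "f (cis w) = cos w * f 1 + sin w * f \<i>" for w by (subst fz) simp
  have eq: "(\<lambda>w. of_real (f (cis w))) =
    (\<lambda>w. ((of_real (f 1) + of_real (f \<i>) * \<i>) / 2) * cis (- (of_int 1 * w)) +
         ((of_real (f 1) - of_real (f \<i>) * \<i>) / 2) * cis (- (of_int (-1) * w)))"
    by (rule ext) (simp add: complex_eq_iff f_cis field_simps)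
  show ?case unfolding eq by (intro trig_poly_add trig_poly_monomial)
qed (auto intro: trig_poly_const trig_poly_add trig_poly_mult)

text \<open>Equal endpoint values let \<open>g\<close> descend to a continuous function on the unit
  circle, where Stone-Weierstrass applies to the real and imaginary parts separately.\<close>

lemma trig_poly_dense_uniform:
  fixes g :: "real \<Rightarrow> complex"
  assumes g: "continuous_on {-pi..pi} g" "g (-pi) = g pi" and "0 < e"
  obtains T where "trig_poly T" "\<And>w. w \<in> {-pi..pi} \<Longrightarrow> cmod (g w - T w) < e"
proof -
  let ?C = "sphere (0::complex) 1"
  define h where "h z = g (Arg z)" for z
  have h_cis: "h (cis w) = g w" if "w \<in> {-pi..pi}" for w
  proof (cases "w = -pi")
    case True
    then have "cis w = -1" by (simp add: complex_eq_iff)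
    then have "Arg (cis w) = pi" by (intro cis_Arg_unique) (auto simp: sgn_div_norm)
    then show ?thesis using True g by (simp add: h_def)
  next
    case False
    then have "Arg (cis w) = w" using that by (intro cis_Arg_unique) auto
    then show ?thesis by (simp add: h_def)
  qed
  have img: "cis ` {-pi..pi} = ?C"
  proof
    show "cis ` {-pi..pi} \<subseteq> ?C" by auto
    show "?C \<subseteq> cis ` {-pi..pi}"
    proof
      fix z :: complex assume "z \<in> ?C"
      then have "z = cis (Arg z)" using cis_Arg[of z] by (cases "z = 0") (auto simp: sgn_div_norm)
      then show "z \<in> cis ` {-pi..pi}" using Arg_bounded[of z] by (intro image_eqI[of z cis "Arg z"]) auto
    qed
  qed
  \<comment> \<open>A continuous surjection from a compact space onto a Hausdorff space is a
    quotient map. Continuity of \<open>h\<close> can therefore be tested on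
    \<open>h \<circ> cis\<close>, although \<open>Arg\<close> itself jumps at -1.\<close>
  have q: "quotient_map (top_of_set {-pi..pi}) (top_of_set ?C) cis"
  proof (rule continuous_imp_quotient_map)
    show "continuous_map (top_of_set {-pi..pi}) (top_of_set ?C) cis"
      using img by (auto simp: continuous_on_cis continuous_map_in_subtopology intro!: continuous_intros)
  qed (use img in \<open>auto simp: compact_space_subtopology Hausdorff_space_subtopology\<close>)
  have "continuous_on {-pi..pi} (h \<circ> cis)"
    using continuous_on_cong[of "{-pi..pi}" "{-pi..pi}" "h \<circ> cis" g] g(1) h_cis by simp
  then have "continuous_map (top_of_set {-pi..pi}) euclidean (h \<circ> cis)"
    by (simp add: continuous_map_iff_continuous)
  then have "continuous_map (top_of_set ?C) euclidean h"
    using continuous_compose_quotient_map[OF q] by blast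
  then have ch: "continuous_on ?C h" by simp
  obtain p where p: "real_polynomial_function p" "\<And>z. z \<in> ?C \<Longrightarrow> \<bar>Re (h z) - p z\<bar> < e / 2"
    by (rule Stone_Weierstrass_real_polynomial_function[of ?C "\<lambda>z. Re (h z)" "e / 2"])
       (use ch \<open>0 < e\<close> in \<open>auto intro!: continuous_intros\<close>)
  obtain q where q: "real_polynomial_function q" "\<And>z. z \<in> ?C \<Longrightarrow> \<bar>Im (h z) - q z\<bar> < e / 2"
    by (rule Stone_Weierstrass_real_polynomial_function[of ?C "\<lambda>z. Im (h z)" "e / 2"])
       (use ch \<open>0 < e\<close> in \<open>auto intro!: continuous_intros\<close>)
  define T where "T w = of_real (p (cis w)) + \<i> * of_real (q (cis w))" for w
  show thesis
  proof
    show "trig_poly T" unfolding T_def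
      by (intro trig_poly_add trig_poly_mult trig_poly_const trig_poly_of_real_polynomial p q)
    fix w assume w: "w \<in> {-pi..pi}"
    have "cmod (g w - T w) \<le> \<bar>Re (g w - T w)\<bar> + \<bar>Im (g w - T w)\<bar>" by (rule cmod_le)
    also have "\<dots> < e / 2 + e / 2"
      using p(2)[of "cis w"] q(2)[of "cis w"] by (intro add_strict_mono) (simp_all add: T_def h_cis[OF w])
    finally show "cmod (g w - T w) < e" by simp
  qed
qed

section \<open>Approximation and testing on the circle\<close>

abbreviation circle :: "real measure" where "circle \<equiv> lebesgue_on {-pi..pi}"

lemma finite_measure_circle: "finite_measure circle"
  by (simp add: finite_measure_lebesgue_on bounded_set_imp_lmeasurable)

lemma measurable_circle: "f \<in> borel_measurable lebesgue \<Longrightarrow> f \<in> borel_measurable circle"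
  by (rule measurable_restrict_space1)

lemma AE_circle_iff: "(AE x in circle. P x) \<longleftrightarrow> (AE x in lebesgue. x \<in> {-pi..pi} \<longrightarrow> P x)"
  by (rule AE_restrict_space_iff) simp

lemma integrable_circle_bounded:
  fixes f :: "real \<Rightarrow> 'a::{banach, second_countable_topology}"
  assumes "f \<in> borel_measurable circle" "\<And>x. x \<in> {-pi..pi} \<Longrightarrow> norm (f x) \<le> B"
  shows "integrable circle f"
  by (rule finite_measure.integrable_const_bound[OF finite_measure_circle _ assms(1), of B])
     (auto simp: AE_circle_iff assms(2))

text \<open>A measurable function is an almost everywhere limit of continuous ones. Projecting their
  values to the disc of radius \<open>M\<close> keeps the bound, and multiplying by plateau
  functions makes them vanish at both endpoints, as periodic approximation requires; the endpoints
  are a null set.\<close>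

lemma continuous_approximation:
  fixes f :: "real \<Rightarrow> complex"
  assumes f: "f \<in> borel_measurable lebesgue" "\<And>x. cmod (f x) \<le> M"
  obtains g where "\<And>n. continuous_on UNIV (g n)" "\<And>n x. cmod (g n x) \<le> M"
    "\<And>n. g n (-pi) = (0::complex)" "\<And>n. g n pi = 0" "AE x in circle. (\<lambda>n. g (n::nat) x) \<longlonglongrightarrow> f x"
proof -
  have M: "0 \<le> M" using f(2)[of 0] norm_ge_zero order_trans by blast
  have "f measurable_on UNIV" using f(1) by (rule lebesgue_measurable_imp_measurable_on) simp
  then obtain N h where N: "negligible N" and h: "\<And>n. continuous_on UNIV (h n)"
    and lim: "\<And>x. x \<notin> N \<Longrightarrow> (\<lambda>n. h (n::nat) x) \<longlonglongrightarrow> f x"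
    unfolding measurable_on_def by auto
  define clip where "clip z = closest_point (cball 0 M) z" for z :: complex
  have clip: "continuous_on UNIV clip" "cmod (clip z) \<le> M" "cmod z \<le> M \<Longrightarrow> clip z = z" for z
  proof -
    show "continuous_on UNIV clip" unfolding clip_def using M by (intro continuous_on_closest_point) auto
    have "clip z \<in> cball 0 M" unfolding clip_def using M by (intro closest_point_in_set) auto
    then show "cmod (clip z) \<le> M" by simp
    show "cmod z \<le> M \<Longrightarrow> clip z = z" unfolding clip_def by (intro closest_point_self) auto
  qed
  define cut where "cut n x = max 0 (min 1 (real n * (pi - \<bar>x\<bar>)))" for n x
  have cut: "continuous_on UNIV (cut n)" "0 \<le> cut n x" "cut n x \<le> 1" for n x
    by (auto simp: cut_def intro!: continuous_intros)
  have cut_lim: "(\<lambda>n. cut n x) \<longlonglongrightarrow> 1" if "x \<in> {-pi<..<pi}" for x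
  proof (rule tendsto_eventually, rule eventually_sequentiallyI)
    fix n :: nat assume n: "nat \<lceil>1 / (pi - \<bar>x\<bar>)\<rceil> \<le> n"
    have "0 < pi - \<bar>x\<bar>" using that by auto
    moreover have "1 / (pi - \<bar>x\<bar>) \<le> real n" using n by linarith
    ultimately have "1 \<le> real n * (pi - \<bar>x\<bar>)" by (simp add: field_simps)
    then show "cut n x = 1" by (simp add: cut_def)
  qed
  show thesis
  proof (rule that[of "\<lambda>n x. of_real (cut n x) * clip (h n x)"])
    show "continuous_on UNIV (\<lambda>x. complex_of_real (cut n x) * clip (h n x))" for n
      by (intro continuous_intros cut continuous_on_compose2[OF clip(1)] h) auto
    show "cmod (complex_of_real (cut n x) * clip (h n x)) \<le> M" for n x
      using mult_mono[OF cut(3)[of n x] clip(2)[of "h n x"]] cut(2)[of n x] M by (simp add: norm_mult)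
    have "AE x in lebesgue. x \<notin> N"
      using N by (auto simp: negligible_iff_null_sets intro: AE_not_in)
    moreover have "AE x in lebesgue. x \<notin> {-pi, pi}"
      by (rule AE_not_in) (auto simp: negligible_iff_null_sets[symmetric])
    ultimately show "AE x in circle. (\<lambda>n. complex_of_real (cut n x) * clip (h n x)) \<longlonglongrightarrow> f x"
      unfolding AE_circle_iff
    proof (eventually_elim, intro impI)
      fix x assume elim: "x \<notin> N" "x \<notin> {-pi, pi}" "x \<in> {-pi..pi}"
      have "(\<lambda>n. clip (h n x)) \<longlonglongrightarrow> clip (f x)"
        using clip(1) lim[OF elim(1)]
        by (intro isCont_tendsto_compose[of "f x" clip]) (auto simp: continuous_on_eq_continuous_at)
      moreover have "x \<in> {-pi<..<pi}" using elim by auto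
      ultimately have "(\<lambda>n. complex_of_real (cut n x) * clip (h n x)) \<longlonglongrightarrow> of_real 1 * clip (f x)"
        using elim by (intro tendsto_mult tendsto_of_real cut_lim)
      then show "(\<lambda>n. complex_of_real (cut n x) * clip (h n x)) \<longlonglongrightarrow> f x"
        using clip(3)[OF f(2)[of x]] by simp
    qed
  qed (auto simp: cut_def)
qed

text \<open>The n-th continuous approximant is replaced by a polynomial within
  \<open>1 / (n + 1)\<close>. The bound grows to \<open>M + 1\<close>, which is still uniform in
  \<open>n\<close> and suffices for dominated convergence.\<close>

lemma trig_poly_approximation:
  fixes f :: "real \<Rightarrow> complex"
  assumes f: "f \<in> borel_measurable lebesgue" "\<And>x. cmod (f x) \<le> M"
  obtains T where "\<And>n. trig_poly (T n)" "\<And>n x. x \<in> {-pi..pi} \<Longrightarrow> cmod (T n x) \<le> M + 1"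
    "AE x in circle. (\<lambda>n. T (n::nat) x) \<longlonglongrightarrow> f x"
proof -
  obtain g where g: "\<And>n. continuous_on UNIV (g n)" "\<And>n x. cmod (g n x) \<le> M"
    "\<And>n. g n (-pi) = (0::complex)" "\<And>n. g n pi = 0" "AE x in circle. (\<lambda>n. g (n::nat) x) \<longlonglongrightarrow> f x"
    using continuous_approximation[OF assms] by blast
  have "\<exists>T. trig_poly T \<and> (\<forall>w\<in>{-pi..pi}. cmod (g n w - T w) < 1 / (real n + 1))" for n
  proof -
    have "continuous_on {-pi..pi} (g n)" using g(1) continuous_on_subset by blast
    then show ?thesis
      using trig_poly_dense_uniform[of "g n" "1 / (real n + 1)"] g by (metis add.commute divide_pos_pos of_nat_0_less_iff of_nat_Suc zero_less_Suc zero_less_one)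
  qed
  then obtain T where T: "\<And>n. trig_poly (T n)"
    "\<And>n w. w \<in> {-pi..pi} \<Longrightarrow> cmod (g n w - T n w) < 1 / (real n + 1)"
    by metis
  show thesis
  proof (rule that[OF T(1)])
    fix n x assume "x \<in> {-pi..pi}"
    then have "cmod (T n x) \<le> cmod (g n x) + cmod (g n x - T n x)" "cmod (g n x - T n x) \<le> 1 / (real n + 1)"
      using T(2)[of x n] norm_triangle_ineq4[of "g n x" "g n x - T n x"] by auto
    moreover have "1 / (real n + 1) \<le> 1" by simp
    ultimately show "cmod (T n x) \<le> M + 1" using g(2)[of n x] by linarith
  next
    show "AE x in circle. (\<lambda>n. T n x) \<longlonglongrightarrow> f x"
      using g(5) unfolding AE_circle_iff
    proof (eventually_elim, intro impI)
      fix x assume elim: "x \<in> {-pi..pi} \<longrightarrow> (\<lambda>n. g n x) \<longlonglongrightarrow> f x" "x \<in> {-pi..pi}"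
      have "(\<lambda>n. 1 / (real n + 1)) \<longlonglongrightarrow> 0"
        using LIMSEQ_inverse_real_of_nat by (simp add: inverse_eq_divide add.commute)
      moreover have "eventually (\<lambda>n. norm (g n x - T n x) \<le> 1 / (real n + 1)) sequentially"
        using T(2)[OF elim(2)] by (intro always_eventually allI less_imp_le)
      ultimately have "(\<lambda>n. g n x - T n x) \<longlonglongrightarrow> 0"
        by (rule Lim_null_comparison[rotated])
      from tendsto_diff[OF elim(1)[rule_format, OF elim(2)] this] show "(\<lambda>n. T n x) \<longlonglongrightarrow> f x" by simp
    qed
  qed
qed

lemma trig_poly_integrable_mult:
  fixes h :: "real \<Rightarrow> 'a::{banach, second_countable_topology}"
  assumes "trig_poly T" "integrable circle h"
  shows "integrable circle (\<lambda>w. (cmod (T w))\<^sup>2 *\<^sub>R h w)"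
proof -
  obtain F c where "T = trig_sum F c" using assms(1) by (auto simp: trig_poly_def)
  then have bd: "(cmod (T w))\<^sup>2 \<le> (\<Sum>k\<in>F. cmod (c k))\<^sup>2" for w
    using trig_sum_bound[of F c w] by (auto intro: power_mono)
  have [measurable]: "T \<in> borel_measurable circle"
    by (intro measurable_circle borel_measurable_trig_poly assms)
  show ?thesis
    by (rule Bochner_Integration.integrable_bound[of _ "\<lambda>w. (\<Sum>k\<in>F. cmod (c k))\<^sup>2 *\<^sub>R h w"])
       (use assms bd in \<open>auto intro!: mult_right_mono AE_I2\<close>)
qed

text \<open>Polynomials converging boundedly to the indicator of the set where \<open>h\<close> is
  negative show that the negative part of \<open>h\<close> has integral 0.\<close>

lemma AE_nonneg_if_trig_poly_tests:
  fixes h :: "real \<Rightarrow> real"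
  assumes h: "integrable circle h"
    and test: "\<And>T. trig_poly T \<Longrightarrow> 0 \<le> (LINT w|circle. (cmod (T w))\<^sup>2 * h w)"
  shows "AE w in circle. 0 \<le> h w"
proof -
  \<comment> \<open>Extension by zero, since the approximation is stated for functions measurable on
    the whole line.\<close>
  define h0 where "h0 w = (if w \<in> {-pi..pi} then h w else 0)" for w
  have h0 [measurable]: "h0 \<in> borel_measurable lebesgue"
    unfolding h0_def using borel_measurable_integrable[OF h] by (intro borel_measurable_if_I) auto
  define f where "f w = (indicator {w. h0 w < 0} w :: complex)" for w
  have f: "f \<in> borel_measurable lebesgue" "\<And>x. cmod (f x) \<le> 1"
  proof -
    have "{w \<in> space lebesgue. h0 w < 0} \<in> sets lebesgue" by measurable
    then have "{w. h0 w < 0} \<in> sets lebesgue" by simp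
    then show "f \<in> borel_measurable lebesgue" unfolding f_def by (intro borel_measurable_indicator)
    show "\<And>x. cmod (f x) \<le> 1" by (auto simp: f_def indicator_def)
  qed
  obtain T where T: "\<And>n. trig_poly (T n)" "\<And>n x. x \<in> {-pi..pi} \<Longrightarrow> cmod (T n x) \<le> 1 + 1"
    "AE x in circle. (\<lambda>n. T (n::nat) x) \<longlonglongrightarrow> f x"
    using trig_poly_approximation[OF f] by blast
  have [measurable]: "T n \<in> borel_measurable circle" for n
    by (intro measurable_circle borel_measurable_trig_poly T)
  have [measurable]: "h \<in> borel_measurable circle" "f \<in> borel_measurable circle"
    using h f measurable_circle by auto
  have neg: "(cmod (f w))\<^sup>2 * h w = min (h w) 0" if "w \<in> {-pi..pi}" for w
    using that by (auto simp: f_def h0_def indicator_def)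
  have "(\<lambda>n. LINT w|circle. (cmod (T n w))\<^sup>2 * h w) \<longlonglongrightarrow> (LINT w|circle. (cmod (f w))\<^sup>2 * h w)"
  proof (rule integral_dominated_convergence)
    show "integrable circle (\<lambda>w. 4 * \<bar>h w\<bar>)" using h by simp
    show "AE w in circle. (\<lambda>n. (cmod (T n w))\<^sup>2 * h w) \<longlonglongrightarrow> (cmod (f w))\<^sup>2 * h w"
      using T(3) by eventually_elim (intro tendsto_intros)
    show "AE w in circle. norm ((cmod (T n w))\<^sup>2 * h w) \<le> 4 * \<bar>h w\<bar>" for n
    proof (rule AE_I2)
      fix w assume "w \<in> space circle"
      then have "(cmod (T n w))\<^sup>2 \<le> 2\<^sup>2" using T(2)[of w n] by (intro power_mono) auto
      then show "norm ((cmod (T n w))\<^sup>2 * h w) \<le> 4 * \<bar>h w\<bar>"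
        by (auto simp: abs_mult intro: mult_right_mono)
    qed
  qed simp_all
  then have "0 \<le> (LINT w|circle. (cmod (f w))\<^sup>2 * h w)"
    by (rule LIMSEQ_le_const) (use test T in auto)
  also have "\<dots> = (LINT w|circle. min (h w) 0)"
    by (rule Bochner_Integration.integral_cong) (auto simp: neg)
  finally have "0 \<le> - (LINT w|circle. - min (h w) 0)" by simp
  moreover have i: "integrable circle (\<lambda>w. - min (h w) 0)" using h by auto
  moreover have "0 \<le> (LINT w|circle. - min (h w) 0)" by (rule integral_nonneg_AE) auto
  ultimately have "(LINT w|circle. - min (h w) 0) = 0" by linarith
  then have "AE w in circle. - min (h w) 0 = 0"
    by (subst (asm) integral_nonneg_eq_0_iff_AE[OF i]) auto
  then show ?thesis by eventually_elim (auto simp: min_def split: if_splits)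
qed

text \<open>This is the passage from norm inequalities for combinations of translates to pointwise
  inequalities for brackets. Finiteness of both integrals allows subtraction in the reals.\<close>

lemma AE_le_if_trig_poly_tests:
  fixes u v :: "real \<Rightarrow> ennreal"
  assumes [measurable]: "u \<in> borel_measurable circle" "v \<in> borel_measurable circle"
    and fin: "(\<integral>\<^sup>+w. u w \<partial>circle) < \<infinity>" "(\<integral>\<^sup>+w. v w \<partial>circle) < \<infinity>"
    and test: "\<And>T. trig_poly T \<Longrightarrow>
      (\<integral>\<^sup>+w. ennreal ((cmod (T w))\<^sup>2) * u w \<partial>circle) \<le> (\<integral>\<^sup>+w. ennreal ((cmod (T w))\<^sup>2) * v w \<partial>circle)"
  shows "AE w in circle. u w \<le> v w"
proof -
  have finu: "AE w in circle. u w \<noteq> \<infinity>" "AE w in circle. v w \<noteq> \<infinity>"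
    using fin by (intro nn_integral_PInf_AE; simp add: less_top)+
  define u' v' where "u' w = enn2real (u w)" and "v' w = enn2real (v w)" for w
  have [measurable]: "u' \<in> borel_measurable circle" "v' \<in> borel_measurable circle"
    unfolding u'_def v'_def by auto
  have eu: "(\<integral>\<^sup>+w. ennreal ((cmod (T w))\<^sup>2) * u w \<partial>circle) = (\<integral>\<^sup>+w. ennreal ((cmod (T w))\<^sup>2 * u' w) \<partial>circle)"
    "(\<integral>\<^sup>+w. ennreal ((cmod (T w))\<^sup>2) * v w \<partial>circle) = (\<integral>\<^sup>+w. ennreal ((cmod (T w))\<^sup>2 * v' w) \<partial>circle)" for T
    by (rule nn_integral_cong_AE, use finu in eventually_elim,
        simp add: u'_def v'_def ennreal_mult less_top)+
  have i: "integrable circle u'" "integrable circle v'"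
    unfolding integrable_iff_bounded using fin eu[of "\<lambda>_. 1"] by (auto simp: u'_def v'_def)
  have "AE w in circle. 0 \<le> v' w - u' w"
  proof (rule AE_nonneg_if_trig_poly_tests)
    show "integrable circle (\<lambda>w. v' w - u' w)" using i by simp
    fix T assume T: "trig_poly T"
    have iT: "integrable circle (\<lambda>w. (cmod (T w))\<^sup>2 * u' w)" "integrable circle (\<lambda>w. (cmod (T w))\<^sup>2 * v' w)"
      using trig_poly_integrable_mult[OF T i(1)] trig_poly_integrable_mult[OF T i(2)] by auto
    have "ennreal (LINT w|circle. (cmod (T w))\<^sup>2 * u' w) \<le> ennreal (LINT w|circle. (cmod (T w))\<^sup>2 * v' w)"
      using test[OF T] unfolding eu
      by (subst (asm) (1 2) nn_integral_eq_integral) (auto simp: u'_def v'_def iT[unfolded u'_def v'_def])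
    then have "(LINT w|circle. (cmod (T w))\<^sup>2 * u' w) \<le> (LINT w|circle. (cmod (T w))\<^sup>2 * v' w)"
      by (subst (asm) ennreal_le_iff) (auto intro!: integral_nonneg_AE simp: v'_def)
    then show "0 \<le> (LINT w|circle. (cmod (T w))\<^sup>2 * (v' w - u' w))"
      using iT by (simp add: right_diff_distrib)
  qed
  with finu show ?thesis
  proof eventually_elim
    case (elim w)
    then have "ennreal (u' w) \<le> ennreal (v' w)" by (intro ennreal_leI) simp
    moreover have "ennreal (u' w) = u w" "ennreal (v' w) = v w"
      using elim by (simp_all add: u'_def v'_def less_top)
    ultimately show ?case by simp
  qed
qed

section \<open>Parseval's identity\<close>

lemma integral_circle_cis:
  "(LINT w|circle. cis (of_int k * w)) = (if k = 0 then of_real (2 * pi) else 0)"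
proof (cases "k = 0")
  case True
  then show ?thesis by (simp add: lebesgue_integral_const measure_restrict_space cis_zero scaleR_conv_of_real)
next
  case False
  have "((\<lambda>w. cis (of_int k * w)) has_integral
      (- \<i> / of_int k * cis (of_int k * pi) - - \<i> / of_int k * cis (of_int k * (-pi)))) {-pi..pi}"
  proof (rule fundamental_theorem_of_calculus)
    fix x assume "x \<in> {-pi..pi}"
    have "((\<lambda>w. - \<i> / of_int k * exp (\<i> * of_real (of_int k * w))) has_vector_derivative
       exp (\<i> * of_real (of_int k * x))) (at x within {-pi..pi})"
      using False
      by (auto intro!: derivative_eq_intros has_vector_derivative_real_field simp: field_simps)
    then show "((\<lambda>w. - \<i> / of_int k * cis (of_int k * w)) has_vector_derivative cis (of_int k * x)) (at x within {-pi..pi})"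
      by (simp add: cis_conv_exp)
  qed simp
  moreover have "cis (of_int k * (-pi)) = cis (of_int k * pi)"
  proof -
    have "cis (of_int k * pi) = cis (of_int k * (-pi)) * cis (2 * pi * of_int k)"
      by (simp add: cis_mult algebra_simps)
    also have "cis (2 * pi * of_int k) = 1" by (rule cis_multiple_2pi) auto
    finally show ?thesis by simp
  qed
  ultimately have "((\<lambda>w. cis (of_int k * w)) has_integral 0) {-pi..pi}" by simp
  moreover have "integrable circle (\<lambda>w. cis (of_int k * w))"
    by (rule integrable_circle_bounded[of _ 1])
       (auto intro!: measurable_circle borel_measurable_continuous_lebesgue continuous_intros)
  ultimately show ?thesis
    using False lebesgue_integral_eq_integral[of "{-pi..pi}" "\<lambda>w. cis (of_int k * w)"]
    by (simp add: integral_unique)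
qed

lemma integral_trig_sum_square:
  assumes "finite F"
  shows "(LINT w|circle. (cmod (trig_sum F c w))\<^sup>2) = 2 * pi * (\<Sum>k\<in>F. (cmod (c k))\<^sup>2)"
proof -
  have i: "integrable circle (\<lambda>w. a * cis (of_int m * w))" for a m
    by (rule integrable_circle_bounded[of _ "cmod a"])
       (auto intro!: measurable_circle borel_measurable_continuous_lebesgue continuous_intros simp: norm_mult)
  have "complex_of_real ((cmod (trig_sum F c w))\<^sup>2) =
      (\<Sum>k\<in>F. \<Sum>l\<in>F. (c k * cnj (c l)) * cis (of_int (l - k) * w))" for w
    unfolding complex_norm_square trig_sum_def cnj_sum sum_product
    by (intro sum.cong refl) (simp add: cis_cnj cis_mult algebra_simps)
  then have "complex_of_real (LINT w|circle. (cmod (trig_sum F c w))\<^sup>2) =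
      (LINT w|circle. (\<Sum>k\<in>F. \<Sum>l\<in>F. (c k * cnj (c l)) * cis (of_int (l - k) * w)))"
    by (simp only: integral_complex_of_real[symmetric])
  also have "\<dots> = (\<Sum>k\<in>F. \<Sum>l\<in>F. (c k * cnj (c l)) * (LINT w|circle. cis (of_int (l - k) * w)))"
    by (simp add: Bochner_Integration.integral_sum i del: of_int_diff)
  also have "\<dots> = (\<Sum>k\<in>F. \<Sum>l\<in>F. if k = l then c k * cnj (c l) * of_real (2 * pi) else 0)"
    unfolding integral_circle_cis by (intro sum.cong refl) auto
  also have "\<dots> = complex_of_real (2 * pi * (\<Sum>k\<in>F. (cmod (c k))\<^sup>2))"
    unfolding of_real_mult of_real_sum complex_norm_square
    using assms by (simp add: sum_distrib_left mult_ac)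
  finally show ?thesis by (simp only: of_real_eq_iff)
qed

text \<open>Unnormalised and with the sign opposite to \<open>trig_sum\<close>: for
  \<open>trig_sum F c\<close> with finite \<open>F\<close> and \<open>k\<close> in \<open>F\<close>
  the value is \<open>2 * pi * c k\<close>.\<close>

definition fourier_coeff :: "(real \<Rightarrow> complex) \<Rightarrow> int \<Rightarrow> complex" where
  "fourier_coeff f k = (LINT w|circle. f w * cis (of_int k * w))"

lemma integrable_circle_of_square:
  assumes "f \<in> borel_measurable circle" "integrable circle (\<lambda>w. (cmod (f w))\<^sup>2)"
  shows "integrable circle (f :: real \<Rightarrow> complex)"
proof -
  have "norm (f w) \<le> norm (1 + (cmod (f w))\<^sup>2)" for w
    using le_one_plus_square[of "cmod (f w)"] by simp
  then show ?thesis
    by (intro Bochner_Integration.integrable_bound[of circle "\<lambda>w. 1 + (cmod (f w))\<^sup>2" f])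
       (use assms in auto)
qed

text \<open>One expansion serves both halves of Parseval: the optimal coefficients give Bessel's
  inequality, the coefficients of a good approximant give the converse.\<close>

lemma integral_minus_trig_sum_square:
  assumes f: "f \<in> borel_measurable circle" "integrable circle (\<lambda>w. (cmod (f w))\<^sup>2)" and F: "finite F"
  shows "integrable circle (\<lambda>w. (cmod (f w - trig_sum F c w))\<^sup>2)" (is ?int)
    and "(LINT w|circle. (cmod (f w - trig_sum F c w))\<^sup>2) =
      (LINT w|circle. (cmod (f w))\<^sup>2) + (\<Sum>k\<in>F. 2 * pi * (cmod (c k))\<^sup>2 - 2 * Re (fourier_coeff f k * cnj (c k)))"
proof -
  have fi: "integrable circle f" by (rule integrable_circle_of_square[OF f])
  have cis_meas: "(\<lambda>w. cis (of_int k * w)) \<in> borel_measurable circle" for k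
    by (intro measurable_circle borel_measurable_continuous_lebesgue continuous_intros)
  have if1: "integrable circle (\<lambda>w. f w * cis (of_int k * w))" for k
    by (rule Bochner_Integration.integrable_bound[OF fi])
       (use f borel_measurable_times[OF f(1) cis_meas] in \<open>auto simp: norm_mult\<close>)
  have if2: "integrable circle (\<lambda>w. f w * cis (of_int k * w) * cnj (c k))" for k
    using if1 by (rule integrable_mult_left)
  have it: "integrable circle (\<lambda>w. (cmod (trig_sum F c w))\<^sup>2)"
    using trig_poly_integrable_mult[OF trig_poly_trig_sum[OF F], of "\<lambda>_. 1::real"] by simp
  have eq: "(cmod (f w - trig_sum F c w))\<^sup>2 = (cmod (f w))\<^sup>2 + (cmod (trig_sum F c w))\<^sup>2
      - 2 * Re (\<Sum>k\<in>F. f w * cis (of_int k * w) * cnj (c k))" for w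
  proof -
    have prod_eq: "f w * cnj (trig_sum F c w) = (\<Sum>k\<in>F. f w * cis (of_int k * w) * cnj (c k))"
      by (simp add: trig_sum_def sum_distrib_left cis_cnj mult_ac)
    show ?thesis by (simp only: cmod_diff_square prod_eq)
  qed
  have isum: "integrable circle (\<lambda>w. \<Sum>k\<in>F. f w * cis (of_int k * w) * cnj (c k))"
    using if2 by (rule Bochner_Integration.integrable_sum)
  then have ir: "integrable circle (\<lambda>w. Re (\<Sum>k\<in>F. f w * cis (of_int k * w) * cnj (c k)))"
    by (rule integrable_Re)
  show ?int unfolding eq using f it ir by auto
  have "(LINT w|circle. (\<Sum>k\<in>F. f w * cis (of_int k * w) * cnj (c k))) = (\<Sum>k\<in>F. fourier_coeff f k * cnj (c k))"
    using if2 by (simp add: fourier_coeff_def)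
  then have "(LINT w|circle. Re (\<Sum>k\<in>F. f w * cis (of_int k * w) * cnj (c k))) = (\<Sum>k\<in>F. Re (fourier_coeff f k * cnj (c k)))"
    using integral_Re[OF isum] by (simp add: Re_sum)
  then have "(LINT w|circle. (cmod (f w - trig_sum F c w))\<^sup>2) =
      (LINT w|circle. (cmod (f w))\<^sup>2) + (LINT w|circle. (cmod (trig_sum F c w))\<^sup>2) - 2 * (\<Sum>k\<in>F. Re (fourier_coeff f k * cnj (c k)))"
    unfolding eq using f it ir by simp
  then show "(LINT w|circle. (cmod (f w - trig_sum F c w))\<^sup>2) =
      (LINT w|circle. (cmod (f w))\<^sup>2) + (\<Sum>k\<in>F. 2 * pi * (cmod (c k))\<^sup>2 - 2 * Re (fourier_coeff f k * cnj (c k)))"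
    unfolding integral_trig_sum_square[OF F] by (simp add: sum_subtractf sum_distrib_left)
qed

text \<open>Truncation makes \<open>f\<close> bounded, and bounded functions are approximated by
  polynomials; both errors vanish by dominated convergence. Each gets \<open>e / 4\<close> because
  the squared triangle inequality costs a factor 2.\<close>

lemma trig_poly_dense_L2:
  assumes f: "f \<in> borel_measurable lebesgue" "integrable circle (\<lambda>w. (cmod (f w))\<^sup>2)" and "0 < e"
  obtains T where "trig_poly T" "(LINT w|circle. (cmod (f w - T w))\<^sup>2) < e"
proof -
  have [measurable]: "f \<in> borel_measurable lebesgue" "f \<in> borel_measurable circle" using f measurable_circle by auto
  define u where "u n w = (if cmod (f w) \<le> real n then f w else 0)" for n w
  have [measurable]: "u n \<in> borel_measurable lebesgue" for n unfolding u_def by measurable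
  have [measurable]: "u n \<in> borel_measurable circle" for n by (rule measurable_circle) simp
  have "(\<lambda>n. LINT w|circle. (cmod (f w - u n w))\<^sup>2) \<longlonglongrightarrow> (LINT w|circle. 0)"
  proof (rule integral_dominated_convergence)
    show "AE w in circle. (\<lambda>n. (cmod (f w - u n w))\<^sup>2) \<longlonglongrightarrow> 0"
    proof (rule AE_I2, rule tendsto_eventually, rule eventually_sequentiallyI)
      fix w n assume "nat \<lceil>cmod (f w)\<rceil> \<le> n"
      then show "(cmod (f w - u n w))\<^sup>2 = 0" by (auto simp: u_def le_nat_iff)
    qed
  qed (use f in \<open>auto simp: u_def\<close>)
  then have "eventually (\<lambda>n. (LINT w|circle. (cmod (f w - u n w))\<^sup>2) < e / 4) sequentially"
    using \<open>0 < e\<close> by (intro order_tendstoD(2)) auto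
  then obtain n where n: "(LINT w|circle. (cmod (f w - u n w))\<^sup>2) < e / 4"
    by (auto simp: eventually_sequentially)
  have un: "cmod (u n w) \<le> real n" for w by (simp add: u_def)
  obtain T where T: "\<And>m. trig_poly (T m)" "\<And>m x. x \<in> {-pi..pi} \<Longrightarrow> cmod (T m x) \<le> real n + 1"
    "AE x in circle. (\<lambda>m. T (m::nat) x) \<longlonglongrightarrow> u n x"
    using trig_poly_approximation[of "u n" "real n"] un by auto
  have [measurable]: "T m \<in> borel_measurable circle" for m
    by (intro measurable_circle borel_measurable_trig_poly T)
  have bd: "(cmod (u n w - T m w))\<^sup>2 \<le> (2 * real n + 1)\<^sup>2" if "w \<in> {-pi..pi}" for w m
    using norm_triangle_ineq4[of "u n w" "T m w"] T(2)[OF that, of m] un[of w] by (intro power_mono) auto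
  have i2: "integrable circle (\<lambda>w. (cmod (u n w - T m w))\<^sup>2)" for m
    by (rule integrable_circle_bounded[of _ "(2 * real n + 1)\<^sup>2"]) (use bd in auto)
  have "(\<lambda>m. LINT w|circle. (cmod (u n w - T m w))\<^sup>2) \<longlonglongrightarrow> (LINT w|circle. 0)"
  proof (rule integral_dominated_convergence)
    show "AE w in circle. (\<lambda>m. (cmod (u n w - T m w))\<^sup>2) \<longlonglongrightarrow> 0"
      using T(3)
    proof eventually_elim
      case (elim w)
      have "(\<lambda>m. (cmod (u n w - T m w))\<^sup>2) \<longlonglongrightarrow> (cmod (u n w - u n w))\<^sup>2"
        by (intro tendsto_intros elim)
      then show ?case by simp
    qed
    show "AE w in circle. norm ((cmod (u n w - T m w))\<^sup>2) \<le> (2 * real n + 1)\<^sup>2" for m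
      by (rule AE_I2) (use bd in auto)
  qed auto
  then have "eventually (\<lambda>m. (LINT w|circle. (cmod (u n w - T m w))\<^sup>2) < e / 4) sequentially"
    using \<open>0 < e\<close> by (intro order_tendstoD(2)) auto
  then obtain m where m: "(LINT w|circle. (cmod (u n w - T m w))\<^sup>2) < e / 4"
    by (auto simp: eventually_sequentially)
  have i1: "integrable circle (\<lambda>w. (cmod (f w - u n w))\<^sup>2)"
    by (rule Bochner_Integration.integrable_bound[OF f(2)]) (auto simp: u_def)
  have "(LINT w|circle. (cmod (f w - T m w))\<^sup>2) \<le>
      (LINT w|circle. 2 * (cmod (f w - u n w))\<^sup>2 + 2 * (cmod (u n w - T m w))\<^sup>2)"
  proof (rule integral_mono)
    fix w
    show "(cmod (f w - T m w))\<^sup>2 \<le> 2 * (cmod (f w - u n w))\<^sup>2 + 2 * (cmod (u n w - T m w))\<^sup>2"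
      using cmod_add_square_le[of 1 "f w - u n w" "u n w - T m w"] by simp
    obtain F c where "finite F" "T m = trig_sum F c" using T(1)[of m] by (auto simp: trig_poly_def)
    then show "integrable circle (\<lambda>w. (cmod (f w - T m w))\<^sup>2)"
      using integral_minus_trig_sum_square(1)[of f F c] f by auto
  qed (use i1 i2 in auto)
  also have "\<dots> < e" using m n i1 i2 by simp
  finally show thesis using that T(1) by blast
qed

lemma nn_integral_count_space_int_le:
  fixes f :: "int \<Rightarrow> ennreal"
  assumes "\<And>F. finite F \<Longrightarrow> (\<Sum>k\<in>F. f k) \<le> B"
  shows "(\<integral>\<^sup>+k. f k \<partial>count_space UNIV) \<le> B"
proof -
  have "(\<integral>\<^sup>+k. f k \<partial>count_space UNIV) = (\<integral>\<^sup>+n. f (int_decode n) \<partial>count_space UNIV)"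
    by (rule nn_integral_bij_count_space[symmetric]) (rule bij_int_decode)
  also have "\<dots> = (\<Sum>n. f (int_decode n))" by (rule nn_integral_count_space_nat)
  also have "\<dots> \<le> B"
  proof (rule suminf_le_const)
    fix n
    have "(\<Sum>i<n. f (int_decode i)) = (\<Sum>k\<in>int_decode ` {..<n}. f k)"
      by (subst sum.reindex) (auto intro: inj_on_subset[OF inj_int_decode])
    then show "(\<Sum>i<n. f (int_decode i)) \<le> B" using assms by simp
  qed auto
  finally show ?thesis .
qed

lemma sum_le_nn_integral_count_space:
  fixes f :: "int \<Rightarrow> ennreal"
  assumes "finite F"
  shows "(\<Sum>k\<in>F. f k) \<le> (\<integral>\<^sup>+k. f k \<partial>count_space UNIV)"
proof -
  have "(\<Sum>k\<in>F. f k) = (\<integral>\<^sup>+k. f k \<partial>count_space F)"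
    by (rule nn_integral_count_space_finite[symmetric, OF assms])
  also have "\<dots> = (\<integral>\<^sup>+k. f k * indicator F k \<partial>count_space UNIV)"
    by (rule nn_integral_count_space_indicator) simp
  also have "\<dots> \<le> (\<integral>\<^sup>+k. f k \<partial>count_space UNIV)"
    by (rule nn_integral_mono) (auto simp: indicator_def)
  finally show ?thesis .
qed

text \<open>Bessel's inequality follows from nonnegativity of the error at the optimal coefficients,
  the converse from density of trigonometric polynomials.\<close>

theorem parseval:
  assumes f: "f \<in> borel_measurable lebesgue" "integrable circle (\<lambda>w. (cmod (f w))\<^sup>2)"
  shows "(\<integral>\<^sup>+k. ennreal ((cmod (fourier_coeff f k))\<^sup>2) \<partial>count_space UNIV) =
    ennreal (2 * pi * (LINT w|circle. (cmod (f w))\<^sup>2))"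
proof (rule antisym)
  define I where "I = (LINT w|circle. (cmod (f w))\<^sup>2)"
  have fc: "f \<in> borel_measurable circle" using f by (intro measurable_circle)
  note exp = integral_minus_trig_sum_square(2)[OF fc f(2), folded I_def]
  have I0: "0 \<le> I" by (simp add: I_def)
  show "(\<integral>\<^sup>+k. ennreal ((cmod (fourier_coeff f k))\<^sup>2) \<partial>count_space UNIV) \<le>
    ennreal (2 * pi * (LINT w|circle. (cmod (f w))\<^sup>2))"
  proof (rule nn_integral_count_space_int_le)
    fix F :: "int set" assume F: "finite F"
    define c where "c k = fourier_coeff f k / (2 * pi)" for k
    have "2 * pi * (cmod (c k))\<^sup>2 - 2 * Re (fourier_coeff f k * cnj (c k)) = - (cmod (fourier_coeff f k))\<^sup>2 / (2 * pi)" for k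
    proof -
      have "fourier_coeff f k * cnj (c k) = of_real ((cmod (fourier_coeff f k))\<^sup>2 / (2 * pi))"
        unfolding of_real_divide complex_norm_square by (simp add: c_def)
      then have "Re (fourier_coeff f k * cnj (c k)) = (cmod (fourier_coeff f k))\<^sup>2 / (2 * pi)" by simp
      then show ?thesis by (simp add: c_def norm_divide power_divide field_simps power2_eq_square)
    qed
    then have "(LINT w|circle. (cmod (f w - trig_sum F c w))\<^sup>2) = I - (\<Sum>k\<in>F. (cmod (fourier_coeff f k))\<^sup>2) / (2 * pi)"
      by (simp add: exp[OF F] sum_negf sum_divide_distrib)
    moreover have "0 \<le> (LINT w|circle. (cmod (f w - trig_sum F c w))\<^sup>2)" by simp
    ultimately have "(\<Sum>k\<in>F. (cmod (fourier_coeff f k))\<^sup>2) / (2 * pi) \<le> I" by linarith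
    then have "(\<Sum>k\<in>F. (cmod (fourier_coeff f k))\<^sup>2) \<le> 2 * pi * I"
      by (simp add: pos_divide_le_eq mult.commute)
    then show "(\<Sum>k\<in>F. ennreal ((cmod (fourier_coeff f k))\<^sup>2)) \<le> ennreal (2 * pi * (LINT w|circle. (cmod (f w))\<^sup>2))"
      by (simp add: sum_ennreal I_def ennreal_leI)
  qed
  show "ennreal (2 * pi * (LINT w|circle. (cmod (f w))\<^sup>2)) \<le>
    (\<integral>\<^sup>+k. ennreal ((cmod (fourier_coeff f k))\<^sup>2) \<partial>count_space UNIV)"
  proof (rule ennreal_le_epsilon)
    fix e :: real assume "0 < e"
    then have "0 < e / (2 * pi)" by simp
    then obtain T where T: "trig_poly T" "(LINT w|circle. (cmod (f w - T w))\<^sup>2) < e / (2 * pi)"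
      using trig_poly_dense_L2[OF f] by blast
    then obtain F c where F: "finite F" "T = trig_sum F c" by (auto simp: trig_poly_def)
    \<comment> \<open>Completing the square: no choice of \<open>c k\<close> does better than the
      normalised coefficient, so a close approximant forces the finite coefficient sum to be
      large.\<close>
    have "- (cmod (fourier_coeff f k))\<^sup>2 / (2 * pi) \<le> 2 * pi * (cmod (c k))\<^sup>2 - 2 * Re (fourier_coeff f k * cnj (c k))" for k
    proof -
      have "Re (fourier_coeff f k * cnj (c k)) \<le> cmod (fourier_coeff f k) * cmod (c k)"
        by (metis complex_Re_le_cmod complex_mod_cnj norm_mult)
      moreover have "0 \<le> (2 * pi * cmod (c k) - cmod (fourier_coeff f k))\<^sup>2 / (2 * pi)" by simp
      moreover have "(2 * pi * cmod (c k) - cmod (fourier_coeff f k))\<^sup>2 / (2 * pi) =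
        2 * pi * (cmod (c k))\<^sup>2 - 2 * (cmod (fourier_coeff f k) * cmod (c k)) + (cmod (fourier_coeff f k))\<^sup>2 / (2 * pi)"
        by (simp add: field_simps power2_eq_square)
      ultimately show ?thesis by linarith
    qed
    then have "(\<Sum>k\<in>F. - (cmod (fourier_coeff f k))\<^sup>2 / (2 * pi)) \<le>
      (\<Sum>k\<in>F. 2 * pi * (cmod (c k))\<^sup>2 - 2 * Re (fourier_coeff f k * cnj (c k)))" by (rule sum_mono)
    then have "I - (\<Sum>k\<in>F. (cmod (fourier_coeff f k))\<^sup>2) / (2 * pi) \<le> (LINT w|circle. (cmod (f w - T w))\<^sup>2)"
      unfolding F(2) exp[OF F(1)] by (simp add: sum_negf sum_divide_distrib)
    then have "2 * pi * I \<le> (\<Sum>k\<in>F. (cmod (fourier_coeff f k))\<^sup>2) + e"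
      using T(2) by (simp add: field_simps)
    then have "ennreal (2 * pi * I) \<le> ennreal (\<Sum>k\<in>F. (cmod (fourier_coeff f k))\<^sup>2) + ennreal e"
      using \<open>0 < e\<close> by (subst ennreal_plus[symmetric]) (auto intro!: ennreal_leI sum_nonneg)
    also have "ennreal (\<Sum>k\<in>F. (cmod (fourier_coeff f k))\<^sup>2) \<le> (\<integral>\<^sup>+k. ennreal ((cmod (fourier_coeff f k))\<^sup>2) \<partial>count_space UNIV)"
      using sum_le_nn_integral_count_space[OF F(1), of "\<lambda>k. ennreal ((cmod (fourier_coeff f k))\<^sup>2)"]
      by (simp add: sum_ennreal)
    finally show "ennreal (2 * pi * (LINT w|circle. (cmod (f w))\<^sup>2)) \<le>
      (\<integral>\<^sup>+k. ennreal ((cmod (fourier_coeff f k))\<^sup>2) \<partial>count_space UNIV) + ennreal e"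
      by (simp add: I_def add_right_mono)
  qed
qed

section \<open>Plancherel's theorem\<close>

text \<open>The translates of a half-open interval of length \<open>T\<close> cover every point
  exactly once; Tonelli and translation invariance then move each piece back to the
  interval.\<close>

lemma nn_integral_periodization:
  fixes f :: "real \<Rightarrow> ennreal"
  assumes f: "f \<in> borel_measurable lebesgue" and T: "0 < T"
  shows "(\<integral>\<^sup>+x. f x \<partial>lebesgue) =
    (\<integral>\<^sup>+x. (\<integral>\<^sup>+k. f (x + T * of_int k) \<partial>count_space (UNIV::int set)) * indicator {a..<a + T} x \<partial>lebesgue)"
proof -
  let ?I = "indicator {a..<a + T} :: real \<Rightarrow> ennreal"
  have Im: "?I \<in> borel_measurable lebesgue" by (intro borel_measurable_indicator) auto
  have one: "(\<integral>\<^sup>+k. ?I (x - T * of_int k) \<partial>count_space (UNIV::int set)) = 1" for x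
  proof -
    define k0 where "k0 = \<lfloor>(x - a) / T\<rfloor>"
    have "x - T * of_int k \<in> {a..<a + T} \<longleftrightarrow> k = k0" for k
    proof -
      have "x - T * of_int k \<in> {a..<a + T} \<longleftrightarrow> of_int k \<le> (x - a) / T \<and> (x - a) / T < of_int k + 1"
        using T by (auto simp: field_simps)
      then show ?thesis unfolding k0_def using floor_unique[of k "(x - a) / T"] by (auto simp: floor_correct)
    qed
    then have "?I (x - T * of_int k) = indicator {k0} k" for k by (auto simp: indicator_def)
    then show ?thesis by simp
  qed
  have meas: "(\<lambda>x. f (x + t)) \<in> borel_measurable lebesgue" for t
    using borel_measurable_lebesgue_affine[OF f, of 1 t] by (simp add: add.commute)
  have "(\<integral>\<^sup>+x. f x \<partial>lebesgue) = (\<integral>\<^sup>+x. (\<integral>\<^sup>+k. f x * ?I (x - T * of_int k) \<partial>count_space (UNIV::int set)) \<partial>lebesgue)"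
    by (simp add: nn_integral_cmult one)
  also have "\<dots> = (\<integral>\<^sup>+k. (\<integral>\<^sup>+x. f x * ?I (x - T * of_int k) \<partial>lebesgue) \<partial>count_space (UNIV::int set))"
  proof (rule nn_integral_count_space_nn_integral)
    fix k
    have "(\<lambda>x. ?I (x - T * of_int k)) \<in> borel_measurable lebesgue"
      using borel_measurable_lebesgue_affine[OF Im, of 1 "- T * of_int k"] by simp
    then show "(\<lambda>x. f x * ?I (x - T * of_int k)) \<in> borel_measurable lebesgue" using f by simp
  qed simp
  also have "\<dots> = (\<integral>\<^sup>+k. (\<integral>\<^sup>+x. f (x + T * of_int k) * ?I x \<partial>lebesgue) \<partial>count_space (UNIV::int set))"
  proof (rule nn_integral_cong)
    fix k :: int
    have "(\<lambda>x. ?I (x - T * of_int k)) \<in> borel_measurable lebesgue"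
      using borel_measurable_lebesgue_affine[OF Im, of 1 "- T * of_int k"] by simp
    then show "(\<integral>\<^sup>+x. f x * ?I (x - T * of_int k) \<partial>lebesgue) = (\<integral>\<^sup>+x. f (x + T * of_int k) * ?I x \<partial>lebesgue)"
      using f by (subst nn_integral_real_affine_lebesgue[of _ 1 "T * of_int k"]) (auto simp: add.commute)
  qed
  also have "\<dots> = (\<integral>\<^sup>+x. (\<integral>\<^sup>+k. f (x + T * of_int k) * ?I x \<partial>count_space (UNIV::int set)) \<partial>lebesgue)"
    using meas Im by (intro nn_integral_count_space_nn_integral[symmetric]) (auto intro!: borel_measurable_times)
  also have "\<dots> = (\<integral>\<^sup>+x. (\<integral>\<^sup>+k. f (x + T * of_int k) \<partial>count_space (UNIV::int set)) * ?I x \<partial>lebesgue)"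
    by (simp add: nn_integral_multc)
  finally show ?thesis .
qed

lemma nn_integral_periodization_circle:
  fixes f :: "real \<Rightarrow> ennreal"
  assumes f: "f \<in> borel_measurable lebesgue"
  shows "(\<integral>\<^sup>+x. f x \<partial>lebesgue) =
    (\<integral>\<^sup>+x. (\<integral>\<^sup>+k. f (x + 2 * pi * of_int k) \<partial>count_space (UNIV::int set)) \<partial>circle)"
proof -
  have "AE x in lebesgue. x \<notin> {pi}"
    by (rule AE_not_in) (auto simp: negligible_iff_null_sets[symmetric])
  then have "AE x in lebesgue. (indicator {-pi..<-pi + 2 * pi} x :: ennreal) = indicator {-pi..pi} x"
    by eventually_elim (auto simp: indicator_def)
  then have "(\<integral>\<^sup>+x. (\<integral>\<^sup>+k. f (x + 2 * pi * of_int k) \<partial>count_space (UNIV::int set)) * indicator {-pi..<-pi + 2 * pi} x \<partial>lebesgue)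
    = (\<integral>\<^sup>+x. (\<integral>\<^sup>+k. f (x + 2 * pi * of_int k) \<partial>count_space (UNIV::int set)) * indicator {-pi..pi} x \<partial>lebesgue)"
    by (intro nn_integral_cong_AE) (auto elim: eventually_mono)
  then show ?thesis
    using nn_integral_periodization[OF f, of "2 * pi" "- pi"] by (simp add: nn_integral_restrict_space)
qed

section \<open>Fourier integrals of compactly supported functions\<close>

definition fourier_integral :: "(real \<Rightarrow> complex) \<Rightarrow> real \<Rightarrow> complex" where
  "fourier_integral g w = (LINT x|lebesgue. g x * cis (- (w * x)))"

definition supported :: "real \<Rightarrow> (real \<Rightarrow> complex) \<Rightarrow> bool" where
  "supported R g \<longleftrightarrow> (\<forall>x. R < \<bar>x\<bar> \<longrightarrow> g x = 0)"

lemma borel_measurable_cis_linear: "(\<lambda>x. cis (- (w * x))) \<in> borel_measurable lebesgue"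
  by (intro borel_measurable_continuous_lebesgue continuous_intros)

lemma integrable_of_supported:
  assumes "g \<in> L2" "supported R g"
  shows "integrable lebesgue g"
proof (rule Bochner_Integration.integrable_bound[of _ "\<lambda>x. indicator {-R..R} x + (cmod (g x))\<^sup>2"])
  have "integrable lebesgue (indicator {-R..R} :: real \<Rightarrow> real)"
    by (rule integrable_real_indicator) (auto simp: emeasure_lborel_Icc_eq)
  then show "integrable lebesgue (\<lambda>x. indicator {-R..R} x + (cmod (g x))\<^sup>2)"
    using assms(1) by (auto simp: L2_def)
  show "AE x in lebesgue. norm (g x) \<le> norm (indicator {-R..R} x + (cmod (g x))\<^sup>2)"
  proof (rule AE_I2)
    fix x
    show "norm (g x) \<le> norm (indicator {-R..R} x + (cmod (g x))\<^sup>2)"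
    proof (cases "R < \<bar>x\<bar>")
      case True
      then show ?thesis using assms(2) by (simp add: supported_def)
    next
      case False
      then have "x \<in> {-R..R}" by auto
      then show ?thesis using le_one_plus_square[of "cmod (g x)"] by simp
    qed
  qed
qed (use assms in \<open>simp add: L2_def\<close>)

lemma integrable_mult_cis:
  assumes "integrable lebesgue g" shows "integrable lebesgue (\<lambda>x. g x * cis (- (w * x)))"
  by (rule Bochner_Integration.integrable_bound[OF assms])
     (use assms borel_measurable_cis_linear in \<open>auto simp: norm_mult\<close>)

lemma continuous_on_fourier_integral:
  assumes "integrable lebesgue g"
  shows "continuous_on UNIV (fourier_integral g)"
proof (rule continuous_at_imp_continuous_on, rule ballI)
  fix w :: real
  show "isCont (fourier_integral g) w"
    unfolding continuous_at_sequentially comp_def fourier_integral_def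
  proof (intro allI impI)
    fix u :: "nat \<Rightarrow> real" assume u: "u \<longlonglongrightarrow> w"
    show "(\<lambda>n. LINT x|lebesgue. g x * cis (- (u n * x))) \<longlonglongrightarrow> (LINT x|lebesgue. g x * cis (- (w * x)))"
    proof (rule integral_dominated_convergence)
      show "integrable lebesgue (\<lambda>x. cmod (g x))" using assms by simp
      show "AE x in lebesgue. (\<lambda>n. g x * cis (- (u n * x))) \<longlonglongrightarrow> g x * cis (- (w * x))"
        using u by (intro AE_I2 tendsto_intros)
    qed (use assms borel_measurable_cis_linear in \<open>auto simp: norm_mult\<close>)
  qed
qed

lemma borel_measurable_fourier_integral:
  "integrable lebesgue g \<Longrightarrow> fourier_integral g \<in> borel_measurable lebesgue"
  by (intro borel_measurable_continuous_lebesgue continuous_on_fourier_integral)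

text \<open>
  For fixed \<open>\<theta>\<close> the numbers \<open>fourier_integral g (\<theta> - k)\<close> are the Fourier coefficients of
  \<open>g x * cis (- \<theta> x)\<close>, so Plancherel's identity is Parseval's identity integrated over \<open>\<theta>\<close>.
\<close>

lemma plancherel_supported_pi:
  assumes g: "g \<in> L2" "supported pi g"
  shows "fourier_integral g \<in> L2" "norm_L2 (fourier_integral g) = sqrt (2 * pi) * norm_L2 g"
proof -
  have [measurable]: "g \<in> borel_measurable lebesgue" using g by (simp add: L2_def)
  have ind: "indicator {-pi..pi} x *\<^sub>R h (g x) = h (g x)" if "h 0 = 0" for x and h :: "complex \<Rightarrow> 'b::real_normed_vector"
    using g(2) that unfolding supported_def by (cases "x \<in> {-pi..pi}") (auto simp: indicator_def)
  have ind2: "(\<lambda>x. indicator {-pi..pi} x *\<^sub>R (cmod (g x))\<^sup>2) = (\<lambda>x. (cmod (g x))\<^sup>2)"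
    by (rule ext) (rule ind, simp)
  have per: "(\<integral>\<^sup>+k. ennreal ((cmod (fourier_integral g (\<theta> + 1 * of_int k)))\<^sup>2) \<partial>count_space (UNIV::int set))
    = ennreal (2 * pi * (norm_L2 g)\<^sup>2)" for \<theta>
  proof -
    define f where "f x = g x * cis (- (\<theta> * x))" for x
    have fm: "f \<in> borel_measurable lebesgue"
      unfolding f_def using borel_measurable_cis_linear by simp
    have cf: "cmod (f x) = cmod (g x)" for x by (simp add: f_def norm_mult)
    have fi: "integrable circle (\<lambda>w. (cmod (f w))\<^sup>2)"
      unfolding cf using g(1) by (subst integrable_restrict_space) (simp_all only: ind2 L2_def, auto)
    have nf: "(LINT w|circle. (cmod (f w))\<^sup>2) = (norm_L2 g)\<^sup>2"
      unfolding cf by (subst integral_restrict_space) (simp_all only: ind2 norm_L2_power2, auto)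
    \<comment> \<open>The sign conventions of the two transforms differ; the reflected index is
      harmless in a sum over all integers.\<close>
    have "fourier_coeff f (- k) = fourier_integral g (\<theta> + 1 * of_int k)" for k
    proof -
      have "indicator {-pi..pi} x *\<^sub>R (f x * cis (of_int (- k) * x)) = g x * cis (- ((\<theta> + 1 * of_int k) * x))" for x
        using ind[of "\<lambda>z. z * cis (- ((\<theta> + 1 * of_int k) * x))" x]
        by (simp add: f_def mult.assoc cis_mult algebra_simps)
      then show ?thesis
        by (simp only: fourier_coeff_def fourier_integral_def integral_restrict_space[of "{-pi..pi}" lebesgue] sets.Int_space_eq2) (simp add: integral_restrict_space)
    qed
    then have "(\<integral>\<^sup>+k. ennreal ((cmod (fourier_integral g (\<theta> + 1 * of_int k)))\<^sup>2) \<partial>count_space (UNIV::int set))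
      = (\<integral>\<^sup>+k. ennreal ((cmod (fourier_coeff f (- k)))\<^sup>2) \<partial>count_space (UNIV::int set))" by simp
    also have "\<dots> = (\<integral>\<^sup>+k. ennreal ((cmod (fourier_coeff f k))\<^sup>2) \<partial>count_space (UNIV::int set))"
      by (rule nn_integral_bij_count_space) (rule bij_uminus)
    finally show ?thesis using parseval[OF fm fi] nf by simp
  qed
  have gi: "integrable lebesgue g" by (rule integrable_of_supported[OF g])
  note gm = borel_measurable_fourier_integral[OF gi]
  have "energy (fourier_integral g) = (\<integral>\<^sup>+x. ennreal (2 * pi * (norm_L2 g)\<^sup>2) * indicator {0..<0 + 1::real} x \<partial>lebesgue)"
    unfolding energy_def using gm
    by (subst nn_integral_periodization[of _ 1 0]) (simp_all only: per, auto)
  also have "\<dots> = ennreal (2 * pi * (norm_L2 g)\<^sup>2)"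
    by (subst nn_integral_cmult_indicator) auto
  also have "\<dots> = ennreal ((sqrt (2 * pi) * norm_L2 g)\<^sup>2)"
    by (simp add: power_mult_distrib)
  finally have *: "energy (fourier_integral g) = ennreal ((sqrt (2 * pi) * norm_L2 g)\<^sup>2)" .
  show "fourier_integral g \<in> L2" "norm_L2 (fourier_integral g) = sqrt (2 * pi) * norm_L2 g"
    using norm_L2_eqI[OF * _ gm] by auto
qed

lemma fourier_integral_dilate:
  assumes "0 < a"
  shows "fourier_integral (\<lambda>x. g (a * x)) w = fourier_integral g (w / a) / of_real a"
proof -
  have "fourier_integral g (w / a) = a *\<^sub>R (LINT x|lebesgue. g (0 + a * x) * cis (- (w / a * (0 + a * x))))"
    unfolding fourier_integral_def
    using assms lebesgue_integral_real_affine[of a "\<lambda>x. g x * cis (- (w / a * x))" 0] by simp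
  then show ?thesis using assms by (simp add: fourier_integral_def scaleR_conv_of_real)
qed

lemma plancherel_supported:
  assumes g: "g \<in> L2" "supported R g"
  shows "fourier_integral g \<in> L2" "norm_L2 (fourier_integral g) = sqrt (2 * pi) * norm_L2 g"
proof -
  \<comment> \<open>Here \<open>a * pi = \<bar>R\<bar> + 1\<close>, so the dilated function lives in
    \<open>[-pi, pi]\<close>; the 1 keeps \<open>a\<close> positive.\<close>
  define a where "a = (\<bar>R\<bar> + 1) / pi"
  have a: "0 < a" unfolding a_def by (auto intro!: divide_pos_pos)
  define h where "h x = g (a * x)" for x
  have hL: "h \<in> L2" using L2_affine[OF g(1), of a 0] a by (simp add: h_def[abs_def])
  have hs: "supported pi h" unfolding supported_def h_def
  proof (intro allI impI)
    fix x assume "pi < \<bar>x\<bar>"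
    then have "a * pi < \<bar>a * x\<bar>" using a by (simp add: abs_mult)
    moreover have "a * pi = \<bar>R\<bar> + 1" by (simp add: a_def)
    ultimately show "g (a * x) = 0" using g(2) by (auto simp: supported_def)
  qed
  note P = plancherel_supported_pi[OF hL hs]
  have eq: "fourier_integral g = (\<lambda>w. of_real a * fourier_integral h (0 + a * w))"
    using a by (auto simp: h_def[abs_def] fourier_integral_dilate)
  show "fourier_integral g \<in> L2"
    unfolding eq by (rule L2_cmult, rule L2_affine) (use P a in auto)
  have "norm_L2 (fourier_integral g) = a * norm_L2 (\<lambda>w. fourier_integral h (0 + a * w))"
    unfolding eq norm_L2_cmult using a by simp
  also have "norm_L2 (\<lambda>w. fourier_integral h (0 + a * w)) = norm_L2 (fourier_integral h) / sqrt a"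
    using norm_L2_affine[of a "fourier_integral h" 0] a by simp
  also have "\<dots> = sqrt (2 * pi) * norm_L2 h / sqrt a" using P by simp
  also have "norm_L2 h = norm_L2 g / sqrt a"
    using norm_L2_affine[of a g 0] a by (simp add: h_def[abs_def])
  finally show "norm_L2 (fourier_integral g) = sqrt (2 * pi) * norm_L2 g"
    using a by (simp add: field_simps)
qed

lemma fourier_integral_add:
  assumes "integrable lebesgue f" "integrable lebesgue g"
  shows "fourier_integral (\<lambda>x. f x + g x) w = fourier_integral f w + fourier_integral g w"
  unfolding fourier_integral_def distrib_right
  by (rule Bochner_Integration.integral_add) (intro integrable_mult_cis assms)+

lemma fourier_integral_cmult: "fourier_integral (\<lambda>x. c * f x) w = c * fourier_integral f w"
  by (simp add: fourier_integral_def mult.assoc)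

lemma fourier_integral_shift:
  "fourier_integral (\<lambda>x. g (x - t)) w = cis (- (w * t)) * fourier_integral g w"
proof -
  have "fourier_integral (\<lambda>x. g (x - t)) w = (LINT x|lebesgue. g x * cis (- (w * (t + x))))"
    using lebesgue_integral_real_affine[of 1 "\<lambda>x. g (x - t) * cis (- (w * x))" t]
    by (simp add: fourier_integral_def)
  also have "\<dots> = (LINT x|lebesgue. cis (- (w * t)) * (g x * cis (- (w * x))))"
    by (intro Bochner_Integration.integral_cong refl)
       (simp add: cis_mult algebra_simps)
  finally show ?thesis by (simp add: fourier_integral_def)
qed

text \<open>
  Unlike \<open>fourier_transform\<close> with its windows \<open>[-R, R]\<close>, approximability by compactly supported
  functions is visibly stable under translations.
\<close>

definition fourier_pair :: "(real \<Rightarrow> complex) \<Rightarrow> (real \<Rightarrow> complex) \<Rightarrow> bool" where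
  "fourier_pair f F \<longleftrightarrow> f \<in> L2 \<and> F \<in> L2 \<and>
     (\<forall>e>0. \<exists>g R. g \<in> L2 \<and> supported R g \<and> norm_L2 (\<lambda>x. f x - g x) < e \<and>
        norm_L2 (\<lambda>w. F w - fourier_integral g w) < e)"

lemma fourier_pair_L2: "fourier_pair f F \<Longrightarrow> f \<in> L2" "fourier_pair f F \<Longrightarrow> F \<in> L2"
  by (auto simp: fourier_pair_def)

lemma fourier_pairE:
  assumes "fourier_pair f F" "0 < e"
  obtains g R where "g \<in> L2" "supported R g" "norm_L2 (\<lambda>x. f x - g x) < e"
    "norm_L2 (\<lambda>w. F w - fourier_integral g w) < e" "fourier_integral g \<in> L2"
    "norm_L2 (fourier_integral g) = sqrt (2 * pi) * norm_L2 g"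
  using assms plancherel_supported unfolding fourier_pair_def by metis

lemma fourier_pair_supported:
  assumes "g \<in> L2" "supported R g"
  shows "fourier_pair g (fourier_integral g)"
  unfolding fourier_pair_def
  using assms plancherel_supported[OF assms] norm_L2_cmult[of 0 "\<lambda>x. 0"] by auto

theorem plancherel:
  assumes "fourier_pair f F"
  shows "norm_L2 F = sqrt (2 * pi) * norm_L2 f"
proof -
  have "\<bar>norm_L2 F - sqrt (2 * pi) * norm_L2 f\<bar> \<le> 0 + e" if "0 < e" for e
  proof -
    \<comment> \<open>The errors \<open>d\<close> on the transform side and
      \<open>sqrt (2 * pi) * d\<close> on the function side add up to \<open>e\<close>.\<close>
    define d where "d = e / (1 + sqrt (2 * pi))"
    have s: "0 \<le> sqrt (2 * pi)" by simp
    have d: "0 < d" using that s by (auto simp: d_def intro!: divide_pos_pos add_pos_nonneg)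
    obtain g R where g: "g \<in> L2" "supported R g" "norm_L2 (\<lambda>x. f x - g x) < d"
      "norm_L2 (\<lambda>w. F w - fourier_integral g w) < d" "fourier_integral g \<in> L2"
      "norm_L2 (fourier_integral g) = sqrt (2 * pi) * norm_L2 g"
      using fourier_pairE[OF assms d] by blast
    have 1: "\<bar>norm_L2 F - norm_L2 (fourier_integral g)\<bar> \<le> d"
      using norm_L2_diff_le[OF fourier_pair_L2(2)[OF assms] g(5)] g(4) by linarith
    have "\<bar>norm_L2 f - norm_L2 g\<bar> \<le> d"
      using norm_L2_diff_le[OF fourier_pair_L2(1)[OF assms] g(1)] g(3) by linarith
    then have "sqrt (2 * pi) * \<bar>norm_L2 f - norm_L2 g\<bar> \<le> sqrt (2 * pi) * d"
      by (rule mult_left_mono) simp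
    then have "\<bar>sqrt (2 * pi) * norm_L2 f - sqrt (2 * pi) * norm_L2 g\<bar> \<le> sqrt (2 * pi) * d"
      by (simp add: abs_mult right_diff_distrib[symmetric])
    with 1 g(6) have "\<bar>norm_L2 F - sqrt (2 * pi) * norm_L2 f\<bar> \<le> d + sqrt (2 * pi) * d" by linarith
    also have "\<dots> = d * (1 + sqrt (2 * pi))" by (simp add: algebra_simps)
    also have "\<dots> = e"
    proof -
      have "1 + sqrt (2 * pi) \<noteq> 0" using s by linarith
      then show ?thesis by (simp add: d_def)
    qed
    finally show ?thesis by simp
  qed
  then have "\<bar>norm_L2 F - sqrt (2 * pi) * norm_L2 f\<bar> \<le> 0" by (rule field_le_epsilon)
  then show ?thesis by simp
qed

lemma fourier_pair_add:
  assumes "fourier_pair f F" "fourier_pair g G"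
  shows "fourier_pair (\<lambda>x. f x + g x) (\<lambda>w. F w + G w)"
  unfolding fourier_pair_def
proof (intro conjI allI impI)
  note L = fourier_pair_L2[OF assms(1)] fourier_pair_L2[OF assms(2)]
  show "(\<lambda>x. f x + g x) \<in> L2" "(\<lambda>w. F w + G w) \<in> L2" using L by (auto intro: L2_add)
  fix e :: real assume "0 < e"
  then have e2: "0 < e / 2" by simp
  obtain u R where u: "u \<in> L2" "supported R u" "norm_L2 (\<lambda>x. f x - u x) < e / 2"
    "norm_L2 (\<lambda>w. F w - fourier_integral u w) < e / 2" "fourier_integral u \<in> L2"
    using fourier_pairE[OF assms(1) e2] by blast
  obtain v S where v: "v \<in> L2" "supported S v" "norm_L2 (\<lambda>x. g x - v x) < e / 2"
    "norm_L2 (\<lambda>w. G w - fourier_integral v w) < e / 2" "fourier_integral v \<in> L2"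
    using fourier_pairE[OF assms(2) e2] by blast
  have fi: "fourier_integral (\<lambda>x. u x + v x) w = fourier_integral u w + fourier_integral v w" for w
    using u v integrable_of_supported by (intro fourier_integral_add) blast+
  show "\<exists>h R. h \<in> L2 \<and> supported R h \<and> norm_L2 (\<lambda>x. f x + g x - h x) < e \<and>
        norm_L2 (\<lambda>w. F w + G w - fourier_integral h w) < e"
  proof (intro exI conjI)
    show "(\<lambda>x. u x + v x) \<in> L2" using u v by (intro L2_add)
    show "supported (max R S) (\<lambda>x. u x + v x)" using u v by (auto simp: supported_def)
    have "norm_L2 (\<lambda>x. (f x - u x) + (g x - v x)) < e"
      using norm_L2_triangle[OF L2_diff[OF L(1) u(1)] L2_diff[OF L(3) v(1)]] u v by linarith
    then show "norm_L2 (\<lambda>x. f x + g x - (u x + v x)) < e" by (simp add: algebra_simps)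
    have "norm_L2 (\<lambda>x. (F x - fourier_integral u x) + (G x - fourier_integral v x)) < e"
      using norm_L2_triangle[OF L2_diff[OF L(2) u(5)] L2_diff[OF L(4) v(5)]] u v by linarith
    then show "norm_L2 (\<lambda>w. F w + G w - fourier_integral (\<lambda>x. u x + v x) w) < e"
      by (simp add: fi algebra_simps)
  qed
qed

lemma fourier_pair_zero: "fourier_pair (\<lambda>x. 0) (\<lambda>w. 0)"
  using fourier_pair_supported[of "\<lambda>x. 0" 0] by (simp add: supported_def fourier_integral_def[abs_def])

lemma fourier_pair_cmult:
  assumes "fourier_pair f F"
  shows "fourier_pair (\<lambda>x. c * f x) (\<lambda>w. c * F w)"
  unfolding fourier_pair_def
proof (intro conjI allI impI)
  note L = fourier_pair_L2[OF assms(1)]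
  show "(\<lambda>x. c * f x) \<in> L2" "(\<lambda>w. c * F w) \<in> L2" using L by (auto intro: L2_cmult)
  fix e :: real assume "0 < e"
  define d where "d = e / (1 + cmod c)"
  have d: "0 < d" using \<open>0 < e\<close> by (auto simp: d_def intro!: divide_pos_pos add_pos_nonneg)
  have cd: "cmod c * d < e"
  proof -
    have "1 + cmod c > 0" by (intro add_pos_nonneg) auto
    then have "d * (1 + cmod c) = e" by (simp add: d_def)
    then show ?thesis using d by (simp add: algebra_simps)
  qed
  obtain u R where u: "u \<in> L2" "supported R u" "norm_L2 (\<lambda>x. f x - u x) < d"
    "norm_L2 (\<lambda>w. F w - fourier_integral u w) < d"
    using fourier_pairE[OF assms(1) d] by blast
  show "\<exists>h R. h \<in> L2 \<and> supported R h \<and> norm_L2 (\<lambda>x. c * f x - h x) < e \<and>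
        norm_L2 (\<lambda>w. c * F w - fourier_integral h w) < e"
  proof (intro exI conjI)
    show "(\<lambda>x. c * u x) \<in> L2" using u by (intro L2_cmult)
    show "supported R (\<lambda>x. c * u x)" using u by (auto simp: supported_def)
    show "norm_L2 (\<lambda>x. c * f x - c * u x) < e"
      using norm_L2_cmult[of c "\<lambda>x. f x - u x"] mult_left_mono[OF less_imp_le[OF u(3)], of "cmod c"] cd
      by (simp add: right_diff_distrib)
    show "norm_L2 (\<lambda>w. c * F w - fourier_integral (\<lambda>x. c * u x) w) < e"
      using norm_L2_cmult[of c "\<lambda>w. F w - fourier_integral u w"] mult_left_mono[OF less_imp_le[OF u(4)], of "cmod c"] cd
      by (simp add: right_diff_distrib fourier_integral_cmult)
  qed
qed

lemma fourier_pair_diff: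
  assumes "fourier_pair f F" "fourier_pair g G"
  shows "fourier_pair (\<lambda>x. f x - g x) (\<lambda>w. F w - G w)"
  using fourier_pair_add[OF assms(1) fourier_pair_cmult[OF assms(2), of "-1"]] by simp

lemma fourier_pair_sum:
  assumes "\<And>k. k \<in> A \<Longrightarrow> fourier_pair (f k) (F k)"
  shows "fourier_pair (\<lambda>x. \<Sum>k\<in>A. f k x) (\<lambda>w. \<Sum>k\<in>A. F k w)"
  using assms
  by (induction A rule: infinite_finite_induct) (auto intro: fourier_pair_add fourier_pair_zero)

lemma fourier_pair_shift:
  assumes "fourier_pair f F"
  shows "fourier_pair (\<lambda>x. f (x - t)) (\<lambda>w. cis (- (w * t)) * F w)"
  unfolding fourier_pair_def
proof (intro conjI allI impI)
  note L = fourier_pair_L2[OF assms(1)]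
  have m: "(\<lambda>w. cis (- (w * t))) \<in> borel_measurable lebesgue"
    by (intro borel_measurable_continuous_lebesgue continuous_intros)
  show "(\<lambda>x. f (x - t)) \<in> L2" using L by (intro L2_shift)
  show "(\<lambda>w. cis (- (w * t)) * F w) \<in> L2" by (rule L2_bounded_mult(1)[OF L(2) m, of 1]) simp
  fix e :: real assume "0 < e"
  then obtain u R where u: "u \<in> L2" "supported R u" "norm_L2 (\<lambda>x. f x - u x) < e"
    "norm_L2 (\<lambda>w. F w - fourier_integral u w) < e"
    using fourier_pairE[OF assms(1)] by blast
  show "\<exists>h R. h \<in> L2 \<and> supported R h \<and> norm_L2 (\<lambda>x. f (x - t) - h x) < e \<and>
        norm_L2 (\<lambda>w. cis (- (w * t)) * F w - fourier_integral h w) < e"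
  proof (intro exI conjI)
    show "(\<lambda>x. u (x - t)) \<in> L2" using u by (intro L2_shift)
    show "supported (R + \<bar>t\<bar>) (\<lambda>x. u (x - t))" using u by (auto simp: supported_def)
    show "norm_L2 (\<lambda>x. f (x - t) - u (x - t)) < e"
      using norm_L2_shift[of "\<lambda>x. f x - u x" t] u by simp
    have "norm_L2 (\<lambda>w. cis (- (w * t)) * F w - fourier_integral (\<lambda>x. u (x - t)) w)
      = norm_L2 (\<lambda>w. F w - fourier_integral u w)"
      by (simp add: fourier_integral_shift right_diff_distrib[symmetric] norm_L2_def norm_mult)
    then show "norm_L2 (\<lambda>w. cis (- (w * t)) * F w - fourier_integral (\<lambda>x. u (x - t)) w) < e" using u by simp
  qed
qed

lemma fourier_pair_dilate:
  assumes "fourier_pair f F" "0 < a"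
  shows "fourier_pair (\<lambda>x. f (a * x)) (\<lambda>w. F (w / a) / of_real a)"
  unfolding fourier_pair_def
proof (intro conjI allI impI)
  note L = fourier_pair_L2[OF assms(1)]
  have ia: "inverse a \<noteq> 0" "a \<noteq> 0" using assms by auto
  show "(\<lambda>x. f (a * x)) \<in> L2" using L2_affine[OF L(1) ia(2), of 0] by simp
  show "(\<lambda>w. F (w / a) / of_real a) \<in> L2"
    using L2_cmult[OF L2_affine[OF L(2) ia(1), of 0], of "inverse (of_real a)"]
    by (simp add: field_simps)
  fix e :: real assume "0 < e"
  \<comment> \<open>The dilation divides the norm on the function side by \<open>sqrt a\<close> and
    multiplies it on the transform side by \<open>sqrt a / a\<close>; the minimum serves
    both.\<close>
  define d where "d = min (e * sqrt a) (e * a / sqrt a)"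
  have "0 < d" using \<open>0 < e\<close> assms(2) by (simp add: d_def)
  then obtain u R where u: "u \<in> L2" "supported R u" "norm_L2 (\<lambda>x. f x - u x) < d"
    "norm_L2 (\<lambda>w. F w - fourier_integral u w) < d"
    using fourier_pairE[OF assms(1)] by blast
  show "\<exists>h R. h \<in> L2 \<and> supported R h \<and> norm_L2 (\<lambda>x. f (a * x) - h x) < e \<and>
        norm_L2 (\<lambda>w. F (w / a) / of_real a - fourier_integral h w) < e"
  proof (intro exI conjI)
    show "(\<lambda>x. u (a * x)) \<in> L2" using L2_affine[OF u(1) ia(2), of 0] by simp
    show "supported (R / a) (\<lambda>x. u (a * x))"
      using u assms(2) by (auto simp: supported_def field_simps abs_mult)
    have "norm_L2 (\<lambda>x. f x - u x) = sqrt a * norm_L2 (\<lambda>x. f (a * x) - u (a * x))"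
      using norm_L2_affine[OF ia(2), of "\<lambda>x. f x - u x" 0] assms(2) by simp
    then have "sqrt a * norm_L2 (\<lambda>x. f (a * x) - u (a * x)) < sqrt a * e"
      using u(3) by (simp add: d_def mult.commute)
    then show "norm_L2 (\<lambda>x. f (a * x) - u (a * x)) < e" using assms(2) by simp
    have "norm_L2 (\<lambda>w. F w - fourier_integral u w) = norm_L2 (\<lambda>w. F (w / a) - fourier_integral u (w / a)) / sqrt a"
      using norm_L2_affine[OF ia(1), of "\<lambda>x. F x - fourier_integral u x" 0] assms(2)
      by (simp add: real_sqrt_inverse divide_inverse mult.commute)
    also have "norm_L2 (\<lambda>w. F (w / a) - fourier_integral u (w / a)) =
      a * norm_L2 (\<lambda>w. F (w / a) / of_real a - fourier_integral (\<lambda>x. u (a * x)) w)"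
      using norm_L2_cmult[of "of_real a" "\<lambda>w. F (w / a) / of_real a - fourier_integral (\<lambda>x. u (a * x)) w"] assms(2)
      by (simp add: fourier_integral_dilate right_diff_distrib)
    finally have "norm_L2 (\<lambda>w. F (w / a) / of_real a - fourier_integral (\<lambda>x. u (a * x)) w) * a / sqrt a < e * a / sqrt a"
      using u(4) by (simp add: d_def mult.commute)
    then show "norm_L2 (\<lambda>w. F (w / a) / of_real a - fourier_integral (\<lambda>x. u (a * x)) w) < e"
      using assms(2) by (simp add: divide_less_cancel)
  qed
qed

text \<open>The restrictions of \<open>f\<close> to \<open>[-n, n]\<close> are the approximants:
  their transforms converge by hypothesis, and they themselves converge to \<open>f\<close> by
  dominated convergence.\<close>

lemma fourier_transform_imp_pair:
  assumes "fourier_transform f F"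
  shows "fourier_pair f F"
  unfolding fourier_pair_def
proof (intro conjI allI impI)
  show L: "f \<in> L2" "F \<in> L2" using assms by (auto simp: fourier_transform_def)
  then have [measurable]: "f \<in> borel_measurable lebesgue" "F \<in> borel_measurable lebesgue" by (auto simp: L2_def)
  fix e :: real assume "0 < e"
  define g where "g n x = indicator {- real n..real n} x * f x" for n x
  have gL: "g n \<in> L2" for n unfolding g_def by (intro L2_indicator L) auto
  have gs: "supported (real n) (g n)" for n by (auto simp: supported_def g_def indicator_def)
  have gf: "fourier_integral (g n) w = (LINT x:{- real n..real n}|lebesgue. f x * cis (- (w * x)))" for n w
    unfolding set_lebesgue_integral_def fourier_integral_def g_def
    by (intro Bochner_Integration.integral_cong refl) (auto simp: indicator_def)
  have "((\<lambda>R. \<integral>\<^sup>+ w. ennreal ((cmod (F w - (LINT x:{-R..R}|lebesgue. f x * cis (- (w * x)))))\<^sup>2) \<partial>lebesgue) \<longlongrightarrow> 0) at_top"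
    using assms by (simp add: fourier_transform_def)
  then have "(\<lambda>n. energy (\<lambda>w. F w - fourier_integral (g n) w)) \<longlonglongrightarrow> 0"
    unfolding energy_def gf by (rule filterlim_compose[OF _ filterlim_real_sequentially])
  then have ev1: "eventually (\<lambda>n. energy (\<lambda>w. F w - fourier_integral (g n) w) < ennreal (e\<^sup>2)) sequentially"
    using \<open>0 < e\<close> by (intro order_tendstoD(2)) auto
  have "(\<lambda>n. LINT x|lebesgue. (cmod (f x - g n x))\<^sup>2) \<longlonglongrightarrow> (LINT x|(lebesgue::real measure). 0)"
  proof (rule integral_dominated_convergence)
    show "integrable lebesgue (\<lambda>x. (cmod (f x))\<^sup>2)" using L by (simp add: L2_def)
    show "AE x in lebesgue. (\<lambda>n. (cmod (f x - g n x))\<^sup>2) \<longlonglongrightarrow> 0"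
    proof (rule AE_I2, rule tendsto_eventually, rule eventually_sequentiallyI)
      fix x :: real and n assume "nat \<lceil>\<bar>x\<bar>\<rceil> \<le> n"
      then have "x \<in> {- real n..real n}" by (auto simp: le_nat_iff)
      then show "(cmod (f x - g n x))\<^sup>2 = 0" by (simp add: g_def)
    qed
    show "(\<lambda>x. (cmod (f x - g n x))\<^sup>2) \<in> borel_measurable lebesgue" for n
      using L2_measurable[OF gL[of n]] by simp
    show "AE x in lebesgue. norm ((cmod (f x - g n x))\<^sup>2) \<le> (cmod (f x))\<^sup>2" for n
      by (auto simp: g_def indicator_def)
  qed simp
  then have ev2: "eventually (\<lambda>n. (LINT x|lebesgue. (cmod (f x - g n x))\<^sup>2) < e\<^sup>2) sequentially"
    using \<open>0 < e\<close> by (intro order_tendstoD(2)) auto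
  obtain n where n: "energy (\<lambda>w. F w - fourier_integral (g n) w) < ennreal (e\<^sup>2)"
    "(LINT x|lebesgue. (cmod (f x - g n x))\<^sup>2) < e\<^sup>2"
    using eventually_conj[OF ev1 ev2] by (auto simp: eventually_sequentially)
  have "(\<lambda>w. F w - fourier_integral (g n) w) \<in> L2"
    using L plancherel_supported[OF gL gs] by (intro L2_diff)
  then have "(norm_L2 (\<lambda>w. F w - fourier_integral (g n) w))\<^sup>2 < e\<^sup>2"
    using n(1) by (simp add: energy_eq_norm ennreal_less_iff)
  moreover have "(norm_L2 (\<lambda>x. f x - g n x))\<^sup>2 < e\<^sup>2" using n(2) by (simp add: norm_L2_power2)
  ultimately have "norm_L2 (\<lambda>w. F w - fourier_integral (g n) w) < e" "norm_L2 (\<lambda>x. f x - g n x) < e"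
    using \<open>0 < e\<close> by (auto intro: power2_less_imp_less)
  then show "\<exists>g R. g \<in> L2 \<and> supported R g \<and> norm_L2 (\<lambda>x. f x - g x) < e \<and>
        norm_L2 (\<lambda>w. F w - fourier_integral g w) < e"
    using gL gs by blast
qed

section \<open>Systems of integer translates\<close>

text \<open>The periodized squared modulus, which is the symbol of the Gram matrix of the integer
  translates. Extended values remove any question of summability.\<close>

definition bracket :: "(real \<Rightarrow> complex) \<Rightarrow> real \<Rightarrow> ennreal" where
  "bracket F w = (\<integral>\<^sup>+k. ennreal ((cmod (F (w + 2 * pi * of_int k)))\<^sup>2) \<partial>count_space (UNIV::int set))"

lemma borel_measurable_bracket:
  assumes "F \<in> borel_measurable lebesgue"
  shows "bracket F \<in> borel_measurable lebesgue"
proof -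
  have [measurable]: "(\<lambda>w. F (w + t)) \<in> borel_measurable lebesgue" for t
    using borel_measurable_lebesgue_affine[OF assms, of 1 t] by (simp add: add.commute)
  have "bracket F = (\<lambda>w. \<Sum>n. ennreal ((cmod (F (w + 2 * pi * of_int (int_decode n))))\<^sup>2))"
    unfolding bracket_def
    by (subst nn_integral_bij_count_space[OF bij_int_decode, symmetric]) (simp add: nn_integral_count_space_nat)
  then show ?thesis by simp
qed

lemma nn_integral_bracket:
  assumes "F \<in> borel_measurable lebesgue"
  shows "(\<integral>\<^sup>+w. bracket F w \<partial>circle) = energy F"
  unfolding energy_def bracket_def using assms
  by (subst nn_integral_periodization_circle[of "\<lambda>x. ennreal ((cmod (F x))\<^sup>2)"]) auto

lemma bracket_periodic: "bracket F (w + 2 * pi * of_int n) = bracket F w"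
proof -
  have "bij (\<lambda>k::int. n + k)" by simp
  from nn_integral_bij_count_space[OF this, of "\<lambda>k. ennreal ((cmod (F (w + 2 * pi * of_int k)))\<^sup>2)"]
  show ?thesis by (simp add: bracket_def algebra_simps)
qed

lemma bracket_mult_periodic:
  assumes "\<And>k. C (w + 2 * pi * of_int k) = C w"
  shows "bracket (\<lambda>w. C w * F w) w = ennreal ((cmod (C w))\<^sup>2) * bracket F w"
  unfolding bracket_def
  by (simp add: assms norm_mult power_mult_distrib ennreal_mult nn_integral_cmult)

lemma AE_lebesgue_shifts:
  fixes P :: "real \<Rightarrow> bool"
  assumes "AE x in lebesgue. P x"
  shows "AE x in lebesgue. \<forall>k::int. P (x + t * of_int k)"
  unfolding AE_all_countable
proof
  fix k :: int
  show "AE x in lebesgue. P (x + t * of_int k)"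
    using AE_lebesgue_affine[OF assms, of 1 "t * of_int k"] by (simp add: add.commute)
qed

lemma bracket_cong_AE:
  assumes "AE w in lebesgue. F w = G w"
  shows "AE w in lebesgue. bracket F w = bracket G w"
  using AE_lebesgue_shifts[OF assms, of "2 * pi"] by eventually_elim (simp add: bracket_def)

lemma AE_circle_periodic:
  assumes "AE w in circle. P w" and per: "\<And>w k. P (w + 2 * pi * of_int k) \<Longrightarrow> P w"
  shows "AE w in lebesgue. P w"
proof -
  have "AE w in lebesgue. \<forall>k::int. w + 2 * pi * of_int k \<in> {-pi..pi} \<longrightarrow> P (w + 2 * pi * of_int k)"
    using AE_lebesgue_shifts[of "\<lambda>w. w \<in> {-pi..pi} \<longrightarrow> P w" "2 * pi"] assms(1) by (simp add: AE_circle_iff)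
  then show ?thesis
  proof eventually_elim
    case (elim w)
    define k where "k = - \<lfloor>(w + pi) / (2 * pi)\<rfloor>"
    have "of_int (- k) \<le> (w + pi) / (2 * pi)" "(w + pi) / (2 * pi) < of_int (- k) + 1"
      unfolding k_def by (simp_all add: floor_correct)
    then have "w + 2 * pi * of_int k \<in> {-pi..pi}" by (auto simp: field_simps)
    then show ?case using elim per by blast
  qed
qed

definition shift_comb :: "(real \<Rightarrow> complex) \<Rightarrow> int set \<Rightarrow> (int \<Rightarrow> complex) \<Rightarrow> real \<Rightarrow> complex" where
  "shift_comb f F c x = (\<Sum>k\<in>F. c k * f (x - of_int k))"

lemma shift_comb_L2: "f \<in> L2 \<Longrightarrow> shift_comb f F c \<in> L2"
  unfolding shift_comb_def[abs_def] by (intro L2_sum L2_cmult L2_shift)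

lemma fourier_pair_shift_comb:
  assumes "fourier_pair f Fh"
  shows "fourier_pair (shift_comb f F c) (\<lambda>w. trig_sum F c w * Fh w)"
proof -
  have "fourier_pair (\<lambda>x. \<Sum>k\<in>F. c k * f (x - of_int k)) (\<lambda>w. \<Sum>k\<in>F. c k * (cis (- (w * of_int k)) * Fh w))"
    by (intro fourier_pair_sum fourier_pair_cmult fourier_pair_shift assms)
  then show ?thesis
    by (simp add: shift_comb_def[abs_def] trig_sum_def sum_distrib_left mult_ac)
qed

lemma energy_fourier_pair:
  assumes "fourier_pair f F"
  shows "energy F = ennreal (2 * pi * (norm_L2 f)\<^sup>2)"
  using energy_eq_norm[OF fourier_pair_L2(2)[OF assms]] plancherel[OF assms]
  by (simp add: power_mult_distrib)

text \<open>The transform of the combination is \<open>trig_sum F c w * Fh w\<close>. Folding its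
  energy onto the circle leaves the periodic factor outside, so \<open>bracket Fh\<close> is the
  weight of the quadratic form of the translates.\<close>

lemma nn_integral_trig_sum_bracket:
  assumes "fourier_pair f Fh"
  shows "(\<integral>\<^sup>+w. ennreal ((cmod (trig_sum F c w))\<^sup>2) * bracket Fh w \<partial>circle)
    = ennreal (2 * pi * (norm_L2 (shift_comb f F c))\<^sup>2)"
proof -
  note p = fourier_pair_shift_comb[OF assms, of F c]
  have "(\<integral>\<^sup>+w. ennreal ((cmod (trig_sum F c w))\<^sup>2) * bracket Fh w \<partial>circle)
    = (\<integral>\<^sup>+w. bracket (\<lambda>w. trig_sum F c w * Fh w) w \<partial>circle)"
    by (intro nn_integral_cong bracket_mult_periodic[symmetric] trig_sum_periodic)
  also have "\<dots> = energy (\<lambda>w. trig_sum F c w * Fh w)"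
    using fourier_pair_L2(2)[OF p] by (intro nn_integral_bracket) (simp add: L2_def)
  also have "\<dots> = ennreal (2 * pi * (norm_L2 (shift_comb f F c))\<^sup>2)"
    by (rule energy_fourier_pair[OF p])
  finally show ?thesis .
qed

lemma nn_integral_trig_sum_const:
  assumes "finite F" "0 \<le> B"
  shows "(\<integral>\<^sup>+w. ennreal ((cmod (trig_sum F c w))\<^sup>2) * ennreal B \<partial>circle) =
    ennreal (2 * pi * (B * (\<Sum>k\<in>F. (cmod (c k))\<^sup>2)))"
proof -
  have i: "integrable circle (\<lambda>w. (cmod (trig_sum F c w))\<^sup>2)"
    using trig_poly_integrable_mult[OF trig_poly_trig_sum[OF assms(1)], of "\<lambda>_. 1::real"] by simp
  have "(\<integral>\<^sup>+w. ennreal ((cmod (trig_sum F c w))\<^sup>2) * ennreal B \<partial>circle) =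
    ennreal (LINT w|circle. (cmod (trig_sum F c w))\<^sup>2 * B)"
    using i assms(2) by (subst nn_integral_eq_integral[symmetric]) (auto simp: ennreal_mult)
  also have "(LINT w|circle. (cmod (trig_sum F c w))\<^sup>2 * B) = 2 * pi * (B * (\<Sum>k\<in>F. (cmod (c k))\<^sup>2))"
    using i by (simp add: integral_trig_sum_square[OF assms(1)])
  finally show ?thesis .
qed

lemma bracket_finite_integral:
  assumes "fourier_pair f Fh"
  shows "(\<integral>\<^sup>+w. bracket Fh w \<partial>circle) < \<infinity>"
  using assms fourier_pair_L2[OF assms] energy_fourier_pair[OF assms]
  by (subst nn_integral_bracket) (auto simp: L2_def)

lemma const_finite_integral: "(\<integral>\<^sup>+w. ennreal B \<partial>circle) < \<infinity>"
  by (simp add: emeasure_restrict_space ennreal_mult_less_top)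

lemma bracket_measurable_circle:
  assumes "fourier_pair f Fh"
  shows "bracket Fh \<in> borel_measurable circle"
  using fourier_pair_L2(2)[OF assms] by (intro measurable_circle borel_measurable_bracket) (simp add: L2_def)

text \<open>The hypothesis says that, tested against every |T|^2, the weight
  \<open>bracket Fh\<close> is dominated by the constant weight \<open>B\<close>; the lower bound
  below is symmetric.\<close>

lemma bracket_le:
  assumes p: "fourier_pair f Fh" and B: "0 \<le> B"
    and le: "\<And>F c. finite F \<Longrightarrow> (norm_L2 (shift_comb f F c))\<^sup>2 \<le> B * (\<Sum>k\<in>F. (cmod (c k))\<^sup>2)"
  shows "AE w in lebesgue. bracket Fh w \<le> ennreal B"
proof (rule AE_circle_periodic)
  show "AE w in circle. bracket Fh w \<le> ennreal B"
  proof (rule AE_le_if_trig_poly_tests)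
    fix T assume "trig_poly T"
    then obtain F c where F: "finite F" "T = trig_sum F c" by (auto simp: trig_poly_def)
    show "(\<integral>\<^sup>+w. ennreal ((cmod (T w))\<^sup>2) * bracket Fh w \<partial>circle) \<le> (\<integral>\<^sup>+w. ennreal ((cmod (T w))\<^sup>2) * ennreal B \<partial>circle)"
      unfolding F(2) nn_integral_trig_sum_bracket[OF p] nn_integral_trig_sum_const[OF F(1) B]
      by (intro ennreal_leI mult_left_mono le F) auto
  qed (use bracket_measurable_circle[OF p] bracket_finite_integral[OF p] const_finite_integral in auto)
qed (simp add: bracket_periodic)

lemma bracket_ge:
  assumes p: "fourier_pair f Fh" and A: "0 \<le> A"
    and le: "\<And>F c. finite F \<Longrightarrow> A * (\<Sum>k\<in>F. (cmod (c k))\<^sup>2) \<le> (norm_L2 (shift_comb f F c))\<^sup>2"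
  shows "AE w in lebesgue. ennreal A \<le> bracket Fh w"
proof (rule AE_circle_periodic)
  show "AE w in circle. ennreal A \<le> bracket Fh w"
  proof (rule AE_le_if_trig_poly_tests)
    fix T assume "trig_poly T"
    then obtain F c where F: "finite F" "T = trig_sum F c" by (auto simp: trig_poly_def)
    show "(\<integral>\<^sup>+w. ennreal ((cmod (T w))\<^sup>2) * ennreal A \<partial>circle) \<le> (\<integral>\<^sup>+w. ennreal ((cmod (T w))\<^sup>2) * bracket Fh w \<partial>circle)"
      unfolding F(2) nn_integral_trig_sum_bracket[OF p] nn_integral_trig_sum_const[OF F(1) A]
      by (intro ennreal_leI mult_left_mono le F) auto
  qed (use bracket_measurable_circle[OF p] bracket_finite_integral[OF p] const_finite_integral in auto)
qed (simp add: bracket_periodic)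

text \<open>This carries polarized orthogonality to the Fourier side, where it becomes an equality
  of two brackets.\<close>

lemma bracket_eq:
  assumes p: "fourier_pair f Fh" "fourier_pair g Gh"
    and eq: "\<And>F c. finite F \<Longrightarrow> norm_L2 (shift_comb f F c) = norm_L2 (shift_comb g F c)"
  shows "AE w in lebesgue. bracket Fh w = bracket Gh w"
proof (rule AE_circle_periodic)
  have "(\<integral>\<^sup>+w. ennreal ((cmod (T w))\<^sup>2) * bracket Fh w \<partial>circle) = (\<integral>\<^sup>+w. ennreal ((cmod (T w))\<^sup>2) * bracket Gh w \<partial>circle)"
    if T: "trig_poly T" for T
  proof -
    obtain F c where F: "finite F" "T = trig_sum F c" using T by (auto simp: trig_poly_def)
    show ?thesis
      unfolding F(2) nn_integral_trig_sum_bracket[OF p(1)] nn_integral_trig_sum_bracket[OF p(2)] eq[OF F(1)] ..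
  qed
  then have "AE w in circle. bracket Fh w \<le> bracket Gh w" "AE w in circle. bracket Gh w \<le> bracket Fh w"
    using p by (auto intro!: AE_le_if_trig_poly_tests bracket_measurable_circle bracket_finite_integral)
  then show "AE w in circle. bracket Fh w = bracket Gh w" by eventually_elim simp
qed (simp add: bracket_periodic)

lemma nn_integral_count_space_even_odd:
  fixes f :: "int \<Rightarrow> ennreal"
  shows "(\<integral>\<^sup>+k. f k \<partial>count_space UNIV) =
    (\<integral>\<^sup>+l. f (2 * l) \<partial>count_space UNIV) + (\<integral>\<^sup>+l. f (2 * l + 1) \<partial>count_space UNIV)"
proof -
  have e: "bij_betw (\<lambda>l::int. 2 * l) UNIV {k. even k}"
    by (auto simp: bij_betw_def inj_on_def)
  have o: "bij_betw (\<lambda>l::int. 2 * l + 1) UNIV {k. odd k}"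
    by (auto simp: bij_betw_def inj_on_def elim: oddE)
  have "(\<integral>\<^sup>+k. f k \<partial>count_space UNIV) =
     (\<integral>\<^sup>+k. f k * indicator {k. even k} k + f k * indicator {k. odd k} k \<partial>count_space UNIV)"
    by (intro nn_integral_cong) (auto simp: indicator_def)
  also have "\<dots> = (\<integral>\<^sup>+k. f k \<partial>count_space {k. even k}) + (\<integral>\<^sup>+k. f k \<partial>count_space {k. odd k})"
    by (simp add: nn_integral_add nn_integral_count_space_indicator)
  finally show ?thesis
    using nn_integral_bij_count_space[OF e, of f] nn_integral_bij_count_space[OF o, of f] by simp
qed

text \<open>After halving, the even shifts of \<open>w\<close> run through the class of
  \<open>w / 2\<close> modulo \<open>2 * pi\<close> and the odd ones through that of
  \<open>w / 2 + pi\<close>; a factor of period \<open>4 * pi\<close> is constant on each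
  class.\<close>

lemma bracket_two_scale:
  assumes m: "\<And>k::int. m (w + 4 * pi * of_int k) = m w" "\<And>k::int. m (w + 2 * pi + 4 * pi * of_int k) = m (w + 2 * pi)"
  shows "bracket (\<lambda>w. m w * H (w / 2)) w =
    ennreal ((cmod (m w))\<^sup>2) * bracket H (w / 2) + ennreal ((cmod (m (w + 2 * pi)))\<^sup>2) * bracket H (w / 2 + pi)"
proof -
  let ?f = "\<lambda>k::int. ennreal ((cmod (m (w + 2 * pi * of_int k) * H ((w + 2 * pi * of_int k) / 2)))\<^sup>2)"
  have "?f (2 * l) = ennreal ((cmod (m w))\<^sup>2) * ennreal ((cmod (H (w / 2 + 2 * pi * of_int l)))\<^sup>2)" for l
  proof -
    have "m (w + 2 * pi * of_int (2 * l)) = m w" using m(1)[of l] by (simp add: algebra_simps)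
    moreover have "(w + 2 * pi * of_int (2 * l)) / 2 = w / 2 + 2 * pi * of_int l" by (simp add: field_simps)
    ultimately show ?thesis by (simp only: norm_mult power_mult_distrib) (simp add: ennreal_mult)
  qed
  moreover have "?f (2 * l + 1) = ennreal ((cmod (m (w + 2 * pi)))\<^sup>2) * ennreal ((cmod (H (w / 2 + pi + 2 * pi * of_int l)))\<^sup>2)" for l
  proof -
    have "m (w + 2 * pi * of_int (2 * l + 1)) = m (w + 2 * pi)" using m(2)[of l] by (simp add: algebra_simps)
    moreover have "(w + 2 * pi * of_int (2 * l + 1)) / 2 = w / 2 + pi + 2 * pi * of_int l" by (simp add: field_simps)
    ultimately show ?thesis by (simp only: norm_mult power_mult_distrib) (simp add: ennreal_mult)
  qed
  ultimately show ?thesis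
    unfolding bracket_def nn_integral_count_space_even_odd[of ?f] by (simp only:) (simp add: nn_integral_cmult)
qed

section \<open>Two-scale relations\<close>

lemma energy_symbol_eq_bracket:
  assumes "bracket F (w / 2) < \<infinity>"
  shows "energy_symbol F w = enn2real (bracket F (w / 2))"
proof -
  let ?f = "\<lambda>k::int. (cmod (F (w / 2 + 2 * of_int k * pi)))\<^sup>2"
  have b: "bracket F (w / 2) = (\<integral>\<^sup>+k. ennreal (?f k) \<partial>count_space UNIV)"
    by (simp add: bracket_def mult_ac)
  have s: "Infinite_Set_Sum.abs_summable_on ?f UNIV"
    unfolding Infinite_Set_Sum.abs_summable_on_def integrable_iff_bounded using assms b by simp
  have "energy_symbol F w = infsetsum ?f UNIV"
    unfolding energy_symbol_def using infsetsum_infsum[OF s] by simp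
  also have "\<dots> = enn2real (bracket F (w / 2))"
    unfolding b using assms b by (intro infsetsum_conv_nn_integral) auto
  finally show ?thesis .
qed

text \<open>Interpolation survives here only through \<open>p_sum\<close> and
  \<open>refinement\<close>. The period is \<open>4 * pi\<close> because \<open>p\<close> is a
  function of \<open>z = exp (- i w / 2)\<close>, and \<open>w + 2 * pi\<close> stands for
  \<open>- z\<close>.\<close>

locale scaling_symbol =
  fixes S Sh p :: "real \<Rightarrow> complex" and A B :: real
  assumes pair: "fourier_pair S Sh"
    and A_pos: "0 < A"
    and riesz_lower: "\<And>F c. finite F \<Longrightarrow> A * (\<Sum>k\<in>F. (cmod (c k))\<^sup>2) \<le> (norm_L2 (shift_comb S F c))\<^sup>2"
    and riesz_upper: "\<And>F c. finite F \<Longrightarrow> (norm_L2 (shift_comb S F c))\<^sup>2 \<le> B * (\<Sum>k\<in>F. (cmod (c k))\<^sup>2)"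
    and p_periodic: "\<And>w k. p (w + 4 * pi * of_int k) = p w"
    and p_sum: "\<And>w. p w + p (w + 2 * pi) = 1"
    and refinement: "AE w in lebesgue. Sh w = p w * Sh (w / 2)"
begin

definition G :: "real \<Rightarrow> real" where "G w = enn2real (bracket Sh w)"

lemma B_ge_A: "A \<le> B"
  using riesz_lower[of "{0}" "\<lambda>_. 1"] riesz_upper[of "{0}" "\<lambda>_. 1"] by simp

lemma Sh_measurable [measurable]: "Sh \<in> borel_measurable lebesgue"
  using fourier_pair_L2[OF pair] by (simp add: L2_def)

lemma G_measurable [measurable]: "G \<in> borel_measurable lebesgue"
  using borel_measurable_bracket[OF Sh_measurable] by (simp add: G_def[abs_def])

text \<open>\<open>enn2real\<close> sends an infinite value to 0; the last conjunct records that
  \<open>G w\<close> is the true bracket. Pointwise computations are made at good points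
  only.\<close>

definition good :: "real \<Rightarrow> bool" where
  "good w \<longleftrightarrow> A \<le> G w \<and> G w \<le> B \<and> bracket Sh w = ennreal (G w)"

lemma AE_good: "AE w in lebesgue. good w"
proof -
  have "AE w in lebesgue. bracket Sh w \<le> ennreal B"
    by (rule bracket_le[OF pair]) (use riesz_upper B_ge_A A_pos in auto)
  moreover have "AE w in lebesgue. ennreal A \<le> bracket Sh w"
    by (rule bracket_ge[OF pair]) (use riesz_lower A_pos in auto)
  ultimately show ?thesis
  proof eventually_elim
    case (elim w)
    then have "bracket Sh w < \<infinity>" using ennreal_less_top order.strict_trans1 by (metis infinity_ennreal_def)
    then have eq: "bracket Sh w = ennreal (G w)" unfolding G_def by simp
    have G0: "0 \<le> G w" by (simp add: G_def)
    show ?case using elim A_pos B_ge_A G0 unfolding good_def eq by auto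
  qed
qed

lemma AE_good_half: "AE w in lebesgue. good (w / 2) \<and> good (w / 2 + pi)"
proof -
  have "AE w in lebesgue. good (t + 1 / 2 * w)" for t by (rule AE_lebesgue_affine[OF AE_good]) simp
  from this[of 0] this[of pi] show ?thesis by eventually_elim (simp add: add.commute)
qed

lemma p_periodic': "p (w + 2 * pi + 4 * pi * of_int k) = p (w + 2 * pi)"
  by (rule p_periodic)

lemma AE_G_two_scale:
  "AE w in lebesgue. G w = (cmod (p w))\<^sup>2 * G (w / 2) + (cmod (p (w + 2 * pi)))\<^sup>2 * G (w / 2 + pi)"
  using bracket_cong_AE[OF refinement] AE_good AE_good_half
proof eventually_elim
  case (elim w)
  have "ennreal (G w) = ennreal ((cmod (p w))\<^sup>2) * ennreal (G (w / 2)) + ennreal ((cmod (p (w + 2 * pi)))\<^sup>2) * ennreal (G (w / 2 + pi))"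
    using elim bracket_two_scale[of p w Sh] p_periodic p_periodic' by (simp add: good_def add.commute)
  also have "\<dots> = ennreal ((cmod (p w))\<^sup>2 * G (w / 2) + (cmod (p (w + 2 * pi)))\<^sup>2 * G (w / 2 + pi))"
    by (simp add: G_def ennreal_mult)
  finally show ?case
    by (subst (asm) ennreal_inj) (auto simp: G_def)
qed

end

text \<open>
  Orthogonality of the translates of \<open>W\<close> and \<open>S\<close> is stated in polarized form: only norms, and
  hence only brackets of single functions, are needed to translate it into Fourier space.
\<close>

locale wavelet_symbol = scaling_symbol +
  fixes W Wh q :: "real \<Rightarrow> complex" and B' :: real
  assumes pair_W: "fourier_pair W Wh"
    and riesz_upper_W: "\<And>F c. finite F \<Longrightarrow> (norm_L2 (shift_comb W F c))\<^sup>2 \<le> B' * (\<Sum>k\<in>F. (cmod (c k))\<^sup>2)"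
    and q_periodic: "\<And>w k. q (w + 4 * pi * of_int k) = q w"
    and q_diff: "\<And>w. q w - q (w + 2 * pi) = cis (- (w / 2))"
    and two_scale_W: "AE w in lebesgue. Wh w = q w * Sh (w / 2)"
    and orthogonal: "\<And>F c \<alpha>. finite F \<Longrightarrow> \<alpha> \<in> {1, \<i>} \<Longrightarrow>
      norm_L2 (shift_comb (\<lambda>x. W x + \<alpha> * S x) F c) = norm_L2 (shift_comb (\<lambda>x. W x - \<alpha> * S x) F c)"
begin

lemma B'_nonneg: "0 \<le> B'"
  using order_trans[OF zero_le_power2 riesz_upper_W[of "{0}" "\<lambda>_. 1"]] by simp

text \<open>The bracket of \<open>Wh\<close> is at most \<open>B'\<close> and splits into two
  nonnegative terms, each a squared value of \<open>q\<close> times a value of \<open>G\<close>,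
  which is at least \<open>A\<close>.\<close>

lemma AE_q_bounded:
  "AE w in lebesgue. (cmod (q w))\<^sup>2 \<le> B' / A \<and> (cmod (q (w + 2 * pi)))\<^sup>2 \<le> B' / A"
proof -
  have "AE w in lebesgue. bracket Wh w \<le> ennreal B'"
    by (rule bracket_le[OF pair_W B'_nonneg]) (use riesz_upper_W in auto)
  with bracket_cong_AE[OF two_scale_W] AE_good_half
  show ?thesis
  proof eventually_elim
    case (elim w)
    let ?a = "(cmod (q w))\<^sup>2" and ?b = "(cmod (q (w + 2 * pi)))\<^sup>2"
    have g: "good (w / 2)" "good (w / 2 + pi)" using elim by auto
    have "ennreal (?a * G (w / 2) + ?b * G (w / 2 + pi)) \<le> ennreal B'"
      using elim g bracket_two_scale[of q w Sh] q_periodic q_periodic[of "w + 2 * pi"] by (simp add: good_def ennreal_mult G_def)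
    then have *: "?a * G (w / 2) + ?b * G (w / 2 + pi) \<le> B'"
      by (subst (asm) ennreal_le_iff) (use B'_nonneg in auto)
    have "?a * A \<le> ?a * G (w / 2)" "?b * A \<le> ?b * G (w / 2 + pi)"
      using g by (auto simp: good_def intro!: mult_left_mono)
    moreover have "0 \<le> ?a * A" "0 \<le> ?b * A" using A_pos by simp_all
    ultimately have "?a * A \<le> B'" "?b * A \<le> B'" using * by linarith+
    then show ?case using A_pos by (simp add: field_simps)
  qed
qed

text \<open>The brackets of \<open>W + \<alpha> S\<close> and \<open>W - \<alpha> S\<close> agree,
  and the difference of the squared moduli is a real part by polarization. The choice 1 for
  \<open>\<alpha>\<close> yields the real part of the claim, the choice \<open>\<i>\<close> its
  imaginary part.\<close>

lemma AE_orthogonality: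
  "AE w in lebesgue. q w * cnj (p w) * of_real (G (w / 2))
     + q (w + 2 * pi) * cnj (p (w + 2 * pi)) * of_real (G (w / 2 + pi)) = 0"
proof -
  have pairs: "fourier_pair (\<lambda>x. W x + \<alpha> * S x) (\<lambda>w. Wh w + \<alpha> * Sh w)"
    "fourier_pair (\<lambda>x. W x - \<alpha> * S x) (\<lambda>w. Wh w - \<alpha> * Sh w)" for \<alpha>
    by (intro fourier_pair_add fourier_pair_diff fourier_pair_cmult pair pair_W)+
  have eq: "AE w in lebesgue. (cmod (q w + \<alpha> * p w))\<^sup>2 * G (w / 2) + (cmod (q (w + 2 * pi) + \<alpha> * p (w + 2 * pi)))\<^sup>2 * G (w / 2 + pi)
    = (cmod (q w - \<alpha> * p w))\<^sup>2 * G (w / 2) + (cmod (q (w + 2 * pi) - \<alpha> * p (w + 2 * pi)))\<^sup>2 * G (w / 2 + pi)"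
    if \<alpha>: "\<alpha> \<in> {1, \<i>}" for \<alpha>
  proof -
    have "AE w in lebesgue. Wh w + \<alpha> * Sh w = (q w + \<alpha> * p w) * Sh (w / 2)"
      using refinement two_scale_W by eventually_elim (simp add: algebra_simps)
    note 1 = bracket_cong_AE[OF this]
    have "AE w in lebesgue. Wh w - \<alpha> * Sh w = (q w - \<alpha> * p w) * Sh (w / 2)"
      using refinement two_scale_W by eventually_elim (simp add: algebra_simps)
    note 2 = bracket_cong_AE[OF this]
    have "AE w in lebesgue. bracket (\<lambda>w. Wh w + \<alpha> * Sh w) w = bracket (\<lambda>w. Wh w - \<alpha> * Sh w) w"
      by (rule bracket_eq[OF pairs]) (rule orthogonal[OF _ \<alpha>])
    with 1 2 AE_good_half show ?thesis
    proof eventually_elim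
      case (elim w)
      have g: "good (w / 2)" "good (w / 2 + pi)" using elim by auto
      have 3: "bracket (\<lambda>w. m w * Sh (w / 2)) w =
        ennreal ((cmod (m w))\<^sup>2 * G (w / 2) + (cmod (m (w + 2 * pi)))\<^sup>2 * G (w / 2 + pi))"
        if "\<And>w k. m (w + 4 * pi * of_int k) = m w" for m
        using g bracket_two_scale[of m w Sh] that that[of "w + 2 * pi"] by (simp add: good_def ennreal_mult G_def)
      have "ennreal ((cmod (q w + \<alpha> * p w))\<^sup>2 * G (w / 2) + (cmod (q (w + 2 * pi) + \<alpha> * p (w + 2 * pi)))\<^sup>2 * G (w / 2 + pi))
        = ennreal ((cmod (q w - \<alpha> * p w))\<^sup>2 * G (w / 2) + (cmod (q (w + 2 * pi) - \<alpha> * p (w + 2 * pi)))\<^sup>2 * G (w / 2 + pi))"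
        using elim 3[of "\<lambda>w. q w + \<alpha> * p w"] 3[of "\<lambda>w. q w - \<alpha> * p w"] p_periodic q_periodic by simp
      then show ?case by (subst (asm) ennreal_inj) (auto simp: G_def)
    qed
  qed
  have sq: "(cmod (x + \<alpha> * y))\<^sup>2 = (cmod (x - \<alpha> * y))\<^sup>2 + 4 * Re (x * cnj (\<alpha> * y))" for x y \<alpha>
    unfolding cmod_power2 by (simp add: power2_eq_square algebra_simps)
  have "AE w in lebesgue. \<forall>\<alpha>\<in>{1, \<i>}. (cmod (q w + \<alpha> * p w))\<^sup>2 * G (w / 2) + (cmod (q (w + 2 * pi) + \<alpha> * p (w + 2 * pi)))\<^sup>2 * G (w / 2 + pi)
    = (cmod (q w - \<alpha> * p w))\<^sup>2 * G (w / 2) + (cmod (q (w + 2 * pi) - \<alpha> * p (w + 2 * pi)))\<^sup>2 * G (w / 2 + pi)"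
    by (rule AE_ball_countable') (use eq in auto)
  then show ?thesis
  proof eventually_elim
    case (elim w)
    let ?x = "q w * cnj (p w)" and ?y = "q (w + 2 * pi) * cnj (p (w + 2 * pi))"
    have e: "(cmod (q w + p w))\<^sup>2 * G (w / 2) + (cmod (q (w + 2 * pi) + p (w + 2 * pi)))\<^sup>2 * G (w / 2 + pi)
      = (cmod (q w - p w))\<^sup>2 * G (w / 2) + (cmod (q (w + 2 * pi) - p (w + 2 * pi)))\<^sup>2 * G (w / 2 + pi)"
      "(cmod (q w + \<i> * p w))\<^sup>2 * G (w / 2) + (cmod (q (w + 2 * pi) + \<i> * p (w + 2 * pi)))\<^sup>2 * G (w / 2 + pi)
      = (cmod (q w - \<i> * p w))\<^sup>2 * G (w / 2) + (cmod (q (w + 2 * pi) - \<i> * p (w + 2 * pi)))\<^sup>2 * G (w / 2 + pi)"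
      using elim by simp_all
    have "Re ?x * G (w / 2) + Re ?y * G (w / 2 + pi) = 0"
      using e(1) unfolding sq[of _ 1, unfolded mult_1] by (simp add: algebra_simps)
    moreover have "Im ?x * G (w / 2) + Im ?y * G (w / 2 + pi) = 0"
      using e(2) unfolding sq[of _ \<i>] by (simp add: algebra_simps)
    ultimately show ?case
      by (simp add: complex_eq_iff)
  qed
qed

definition D :: "real \<Rightarrow> complex" where
  "D w = cnj (p (w + 2 * pi)) * of_real (G (w / 2 + pi)) + cnj (p w) * of_real (G (w / 2))"

lemma AE_wavelet_formula:
  obtains K L where "0 < K" "K \<le> L"
    "AE w in lebesgue. K \<le> (cmod (D w))\<^sup>2 \<and> (cmod (D w))\<^sup>2 \<le> L \<and>
       q w * D w = cis (- (w / 2)) * of_real (G (w / 2 + pi)) * cnj (p (w + 2 * pi))"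
proof -
  \<comment> \<open>\<open>M\<close> bounds |q| and |q - z|, the added 1 keeping it positive;
    \<open>K\<close> comes from \<open>A \<le> 2 * M * cmod (D w)\<close>. \<open>L\<close> comes
    from the bounds \<open>sqrt (B / A)\<close> for \<open>p\<close> and \<open>B\<close> for
    \<open>G\<close> in the two summands of \<open>D\<close>.\<close>
  define M where "M = sqrt (B' / A) + 1"
  define K where "K = (A / (2 * M))\<^sup>2"
  define L where "L = (2 * B * sqrt (B / A))\<^sup>2"
  have M: "0 < M" using B'_nonneg A_pos by (auto simp: M_def intro!: add_nonneg_pos)
  have K: "0 < K" using M A_pos by (simp add: K_def)
  have ae: "AE w in lebesgue. K \<le> (cmod (D w))\<^sup>2 \<and> (cmod (D w))\<^sup>2 \<le> L \<and>
       q w * D w = cis (- (w / 2)) * of_real (G (w / 2 + pi)) * cnj (p (w + 2 * pi))"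
    using AE_q_bounded AE_orthogonality AE_good AE_G_two_scale AE_good_half
  proof eventually_elim
    case (elim w)
    define E E' P P' z where "E = G (w / 2)" and "E' = G (w / 2 + pi)" and "P = p w"
      and "P' = p (w + 2 * pi)" and "z = cis (- (w / 2))"
    have g: "A \<le> E" "E \<le> B" "A \<le> E'" "E' \<le> B" using elim by (simp_all add: good_def E_def E'_def)
    have q': "q (w + 2 * pi) = q w - z" using q_diff[of w] by (simp add: z_def algebra_simps)
    have Ddef: "D w = cnj P' * of_real E' + cnj P * of_real E"
      by (simp add: D_def E_def E'_def P_def P'_def)
    have o: "q w * cnj P * of_real E + (q w - z) * cnj P' * of_real E' = 0"
      using elim(2) by (simp add: q' E_def E'_def P_def P'_def)
    have "q w * D w - z * of_real E' * cnj P' = q w * cnj P * of_real E + (q w - z) * cnj P' * of_real E'"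
      unfolding Ddef by (simp add: algebra_simps)
    then have 1: "q w * D w = z * of_real E' * cnj P'" unfolding o by simp
    have 2: "(q w - z) * D w = - z * of_real E * cnj P"
      unfolding left_diff_distrib 1 unfolding Ddef by (simp add: algebra_simps)
    have n: "cmod z = 1" by (simp add: z_def)
    have qb: "cmod (q w) \<le> M" "cmod (q w - z) \<le> M"
      using elim(1) real_le_rsqrt[of "cmod (q w)" "B' / A"] real_le_rsqrt[of "cmod (q w - z)" "B' / A"]
      by (auto simp: q' M_def)
    have "A * (cmod P' + cmod P) \<le> E' * cmod P' + E * cmod P"
      unfolding distrib_left using g by (intro add_mono mult_right_mono) auto
    also have "\<dots> = cmod (q w * D w) + cmod ((q w - z) * D w)"
      unfolding 1 2 using g A_pos by (simp add: norm_mult n)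
    also have "\<dots> = (cmod (q w) + cmod (q w - z)) * cmod (D w)" by (simp add: norm_mult distrib_right)
    also have "\<dots> \<le> (M + M) * cmod (D w)" using qb by (intro mult_right_mono add_mono) auto
    finally have 3: "A * (cmod P' + cmod P) \<le> 2 * M * cmod (D w)" by simp
    have "1 \<le> cmod P' + cmod P" using norm_triangle_ineq[of P' P] p_sum[of w] by (simp add: P_def P'_def add.commute)
    then have "A \<le> A * (cmod P' + cmod P)" using A_pos by simp
    with 3 have "A / (2 * M) \<le> cmod (D w)" using M by (simp add: field_simps)
    then have KD: "K \<le> (cmod (D w))\<^sup>2" unfolding K_def using A_pos M by (intro power_mono) auto
    have "(cmod P)\<^sup>2 * E + (cmod P')\<^sup>2 * E' \<le> B"
      using elim(3,4) by (simp add: good_def E_def E'_def P_def P'_def)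
    moreover have "(cmod P)\<^sup>2 * A \<le> (cmod P)\<^sup>2 * E" "(cmod P')\<^sup>2 * A \<le> (cmod P')\<^sup>2 * E'"
      using g by (auto intro!: mult_left_mono)
    moreover have "0 \<le> (cmod P)\<^sup>2 * A" "0 \<le> (cmod P')\<^sup>2 * A" using A_pos by simp_all
    ultimately have "(cmod P)\<^sup>2 * A \<le> B" "(cmod P')\<^sup>2 * A \<le> B" by linarith+
    then have pb: "cmod P \<le> sqrt (B / A)" "cmod P' \<le> sqrt (B / A)"
      using A_pos by (auto intro!: real_le_rsqrt simp: field_simps)
    have "cmod (D w) \<le> cmod P' * E' + cmod P * E"
      unfolding Ddef using norm_triangle_ineq[of "cnj P' * of_real E'" "cnj P * of_real E"] g A_pos
      by (simp add: norm_mult)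
    also have "\<dots> \<le> sqrt (B / A) * B + sqrt (B / A) * B"
      using g A_pos pb by (intro add_mono mult_mono) auto
    finally have "(cmod (D w))\<^sup>2 \<le> L" unfolding L_def by (intro power_mono) (auto simp: mult_ac)
    then show ?case using KD 1 by (simp add: E'_def P'_def z_def)
  qed
  show thesis
  \<comment> \<open>The maximum settles the order of the two constants without comparing
    \<open>K\<close> and \<open>L\<close>.\<close>
  proof (rule that[OF K, of "max K L"])
    show "AE w in lebesgue. K \<le> (cmod (D w))\<^sup>2 \<and> (cmod (D w))\<^sup>2 \<le> max K L \<and>
       q w * D w = cis (- (w / 2)) * of_real (G (w / 2 + pi)) * cnj (p (w + 2 * pi))"
      using ae by eventually_elim auto
  qed simp
qed

end

section \<open>Dyadic limits at the origin\<close>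

context scaling_symbol
begin

text \<open>The share of the central term in the periodized sum. Equivalently, the squared modulus
  of \<open>Sh / sqrt G\<close>, the transform of the orthonormalised generator, whose value near
  the origin should be 1.\<close>

definition r :: "real \<Rightarrow> real" where "r w = (cmod (Sh w))\<^sup>2 / G w"

lemma r_measurable [measurable]: "r \<in> borel_measurable lebesgue"
  unfolding r_def[abs_def] by measurable

lemma good_G_pos: "good w \<Longrightarrow> 0 < G w"
  using A_pos by (auto simp: good_def)

lemma good_r: assumes "good w" shows "0 \<le> r w" "r w \<le> 1" "(cmod (Sh w))\<^sup>2 = r w * G w"
proof -
  have "ennreal ((cmod (Sh w))\<^sup>2) \<le> bracket Sh w"
    using sum_le_nn_integral_count_space[of "{0}" "\<lambda>k. ennreal ((cmod (Sh (w + 2 * pi * of_int k)))\<^sup>2)"]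
    by (simp add: bracket_def)
  then have "(cmod (Sh w))\<^sup>2 \<le> G w"
    using assms A_pos by (auto simp: good_def)
  then show "0 \<le> r w" "r w \<le> 1" "(cmod (Sh w))\<^sup>2 = r w * G w"
    using good_G_pos[OF assms] by (auto simp: r_def)
qed

text \<open>Multiplying the two-scale identity for \<open>G (2 * w)\<close> by \<open>r w\<close>
  and subtracting the refinement equation leaves \<open>r w * |p (2 * w + 2 * pi)|^2 * G (w + pi) =
  G (2 * w) * (r w - r (2 * w))\<close>. Its sign gives monotonicity, the bounds on \<open>G\<close>
  and \<open>r\<close> give the estimate.\<close>

lemma AE_r_doubling:
  "AE w in lebesgue. r w * (cmod (p (2 * w + 2 * pi)))\<^sup>2 * A \<le> B * (1 - r (2 * w)) \<and> r (2 * w) \<le> r w"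
proof -
  have 1: "AE w in lebesgue. Sh (0 + 2 * w) = p (0 + 2 * w) * Sh ((0 + 2 * w) / 2)"
    by (rule AE_lebesgue_affine[OF refinement]) simp
  have 2: "AE w in lebesgue. G (0 + 2 * w) = (cmod (p (0 + 2 * w)))\<^sup>2 * G ((0 + 2 * w) / 2)
     + (cmod (p (0 + 2 * w + 2 * pi)))\<^sup>2 * G ((0 + 2 * w) / 2 + pi)"
    by (rule AE_lebesgue_affine[OF AE_G_two_scale]) simp
  have 3: "AE w in lebesgue. good (0 + 2 * w)" by (rule AE_lebesgue_affine[OF AE_good]) simp
  have 4: "AE w in lebesgue. good (pi + 1 * w)" by (rule AE_lebesgue_affine[OF AE_good]) simp
  from 1 2 3 4 AE_good show ?thesis
  proof eventually_elim
    case (elim w)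
    define x y where "x = (cmod (p (2 * w)))\<^sup>2" and "y = (cmod (p (2 * w + 2 * pi)))\<^sup>2"
    have g: "good w" "good (2 * w)" "good (w + pi)" using elim by (simp_all add: add.commute)
    note gr = good_r[OF g(1)] good_r[OF g(2)]
    have "(cmod (Sh (2 * w)))\<^sup>2 = x * (cmod (Sh w))\<^sup>2"
      using elim(1) by (simp add: x_def norm_mult power_mult_distrib)
    then have e1: "r (2 * w) * G (2 * w) = x * (r w * G w)" using gr by simp
    have e2: "G (2 * w) = x * G w + y * G (w + pi)" using elim(2) by (simp add: x_def y_def)
    have "r w * G (2 * w) = x * (r w * G w) + r w * y * G (w + pi)"
      unfolding e2 by (simp only: distrib_left mult_ac)
    moreover have "G (2 * w) * (r w - r (2 * w)) = r w * G (2 * w) - r (2 * w) * G (2 * w)"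
      by (simp only: right_diff_distrib mult.commute)
    ultimately have e3: "r w * y * G (w + pi) = G (2 * w) * (r w - r (2 * w))"
      using e1 by linarith
    have y0: "0 \<le> r w * y" using gr by (simp add: y_def)
    have "0 \<le> r w * y * G (w + pi)" using y0 good_G_pos[OF g(3)] by simp
    then have m: "r (2 * w) \<le> r w"
      unfolding e3 using good_G_pos[OF g(2)] by (simp add: zero_le_mult_iff)
    have "r w * y * A \<le> r w * y * G (w + pi)" using y0 g(3) by (intro mult_left_mono) (auto simp: good_def)
    also have "\<dots> \<le> B * (r w - r (2 * w))"
      unfolding e3 using m g(2) by (intro mult_right_mono) (auto simp: good_def)
    also have "\<dots> \<le> B * (1 - r (2 * w))" using gr A_pos B_ge_A by (intro mult_left_mono) auto
    finally show ?case using m by (simp add: y_def)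
  qed
qed

lemma AE_dyadic:
  assumes "AE w in lebesgue. P w"
  shows "AE w in lebesgue. \<forall>n::nat. P (w / 2 ^ n :: real)"
  unfolding AE_all_countable
proof
  fix n :: nat
  show "AE w in lebesgue. P (w / 2 ^ n)"
    using AE_lebesgue_affine[OF assms, of "1 / 2 ^ n" 0] by simp
qed

text \<open>
  For fixed \<open>u\<close> the sum over \<open>k\<close> of \<open>|\<delta>\<^sub>0\<^sub>k g(u) - C(u) Sh(u + 2 pi k)|\<^sup>2\<close> is a quadratic
  polynomial in \<open>C(u)\<close>; its minimum is \<open>|g(u)|\<^sup>2 (1 - r(u))\<close>.
\<close>

lemma bracket_cut_ge:
  assumes u: "good u" "u \<in> {-pi..<pi}" and C: "\<And>k. C (u + 2 * pi * of_int k) = C u"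
  shows "ennreal ((cmod (g u))\<^sup>2 * (1 - r u)) \<le>
    bracket (\<lambda>v. indicator {-pi..<pi} v * g v - C v * Sh v) u"
proof -
  let ?X = "\<lambda>v. indicator {-pi..<pi} v * g v - C v * Sh v"
  let ?a = "\<lambda>k::int. ennreal ((cmod (?X (u + 2 * pi * of_int k)))\<^sup>2)"
  let ?b = "\<lambda>k::int. ennreal ((cmod (C u * Sh (u + 2 * pi * of_int k)))\<^sup>2)"
  let ?i = "\<lambda>k::int. indicator {k. k \<noteq> 0} k :: ennreal"
  have split: "(\<integral>\<^sup>+k. f k \<partial>count_space UNIV) = f 0 + (\<integral>\<^sup>+k. f k * ?i k \<partial>count_space UNIV)" for f :: "int \<Rightarrow> ennreal"
  proof -
    have "(\<integral>\<^sup>+k. f k \<partial>count_space UNIV) = (\<integral>\<^sup>+k. f 0 * indicator {0} k + f k * ?i k \<partial>count_space UNIV)"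
      by (intro nn_integral_cong) (auto simp: indicator_def)
    also have "\<dots> = f 0 + (\<integral>\<^sup>+k. f k * ?i k \<partial>count_space UNIV)"
      by (simp add: nn_integral_add nn_integral_cmult)
    finally show ?thesis .
  qed
  have off: "u + 2 * pi * of_int k \<notin> {-pi..<pi}" if "k \<noteq> 0" for k
  proof
    assume *: "u + 2 * pi * of_int k \<in> {-pi..<pi}"
    define m where "m = 2 * pi * real_of_int k"
    from that consider "1 \<le> k" | "k \<le> -1" by linarith
    then show False
    proof cases
      case 1
      then have "2 * pi * 1 \<le> 2 * pi * real_of_int k" by (intro mult_left_mono) auto
      then have "2 * pi \<le> m" by (simp only: m_def mult_1_right)
      then show False using * u(2) unfolding m_def[symmetric] by auto
    next
      case 2
      then have "2 * pi * real_of_int k \<le> 2 * pi * (-1)" by (intro mult_left_mono) auto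
      then have "m \<le> - (2 * pi)" by (simp only: m_def mult_minus_right mult_1_right)
      then show False using * u(2) unfolding m_def[symmetric] by auto
    qed
  qed
  \<comment> \<open>For nonzero \<open>k\<close> the cut function vanishes, so the tail is the one
    of the periodic multiple of \<open>Sh\<close>.\<close>
  have "?a k * ?i k = ?b k * ?i k" for k
    using off[of k] C by (cases "k = 0") auto
  then have tail: "(\<integral>\<^sup>+k. ?a k * ?i k \<partial>count_space UNIV) = (\<integral>\<^sup>+k. ?b k * ?i k \<partial>count_space UNIV)" (is "_ = ?t")
    by (intro nn_integral_cong) simp
  define \<gamma> where "\<gamma> = C u"
  define s where "s = Sh u"
  define z where "z = g u"
  have "(\<integral>\<^sup>+k. ?b k \<partial>count_space UNIV) = ennreal ((cmod \<gamma>)\<^sup>2) * bracket Sh u"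
    by (simp add: bracket_def \<gamma>_def norm_mult power_mult_distrib ennreal_mult nn_integral_cmult)
  then have bt: "ennreal ((cmod \<gamma>)\<^sup>2 * G u) = ennreal ((cmod (\<gamma> * s))\<^sup>2) + ?t"
    using split[of ?b] u(1) by (simp add: good_def G_def ennreal_mult \<gamma>_def s_def)
  then have "?t \<le> ennreal ((cmod \<gamma>)\<^sup>2 * G u)" by (simp only:) simp
  then have "?t < top" by (rule order.strict_trans1[OF _ ennreal_less_top])
  then obtain t where t: "?t = ennreal t" "0 \<le> t"
    using that[of "enn2real ?t"] by simp
  have "ennreal ((cmod \<gamma>)\<^sup>2 * G u) = ennreal ((cmod (\<gamma> * s))\<^sup>2 + t)" using bt t by simp
  then have t': "(cmod \<gamma>)\<^sup>2 * G u = (cmod \<gamma>)\<^sup>2 * (cmod s)\<^sup>2 + t"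
    using t good_G_pos[OF u(1)] by (subst (asm) ennreal_inj) (auto simp: norm_mult power_mult_distrib)
  have G: "0 < G u" by (rule good_G_pos[OF u(1)])
  have sq: "(cmod (z - \<gamma> * s))\<^sup>2 = (cmod z)\<^sup>2 + (cmod \<gamma>)\<^sup>2 * (cmod s)\<^sup>2 - 2 * Re (z * cnj (\<gamma> * s))"
    by (simp only: cmod_diff_square norm_mult power_mult_distrib)
  \<comment> \<open>Completing the square in \<open>cmod \<gamma>\<close> exhibits the
    minimum.\<close>
  have "Re (z * cnj (\<gamma> * s)) \<le> cmod z * (cmod \<gamma> * cmod s)"
    using complex_Re_le_cmod[of "z * cnj (\<gamma> * s)"] by (simp only: norm_mult complex_mod_cnj)
  moreover have "0 \<le> (cmod \<gamma> * G u - cmod z * cmod s)\<^sup>2 / G u" using G by simp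
  moreover have "(cmod \<gamma> * G u - cmod z * cmod s)\<^sup>2 / G u =
      (cmod \<gamma>)\<^sup>2 * G u - 2 * (cmod z * (cmod \<gamma> * cmod s)) + (cmod z)\<^sup>2 * ((cmod s)\<^sup>2 / G u)"
  proof -
    have "(a * y - b * c)\<^sup>2 / y = a\<^sup>2 * y - 2 * (b * (a * c)) + b\<^sup>2 * (c\<^sup>2 / y)" if "y \<noteq> 0" for a b c y :: real
      using that by (simp add: field_simps power2_eq_square)
    then show ?thesis using G by simp
  qed
  ultimately have "(cmod z)\<^sup>2 * (1 - r u) \<le> (cmod (z - \<gamma> * s))\<^sup>2 + t"
    unfolding sq using t' by (simp add: r_def s_def right_diff_distrib)
  then have "ennreal ((cmod z)\<^sup>2 * (1 - r u)) \<le> ennreal ((cmod (z - \<gamma> * s))\<^sup>2 + t)"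
    by (rule ennreal_leI)
  also have "\<dots> = ennreal ((cmod (z - \<gamma> * s))\<^sup>2) + ?t" using t by simp
  also have "\<dots> = (\<integral>\<^sup>+k. ?a k \<partial>count_space UNIV)"
    unfolding split[of ?a] tail using u(2) by (simp add: z_def \<gamma>_def s_def)
  finally show ?thesis by (simp add: bracket_def z_def)
qed

text \<open>Clamping to \<open>[0, 1]\<close> makes the weight bounded and its square root
  meaningful everywhere; at good points it is just \<open>1 - r w\<close>.\<close>

definition gap :: "real \<Rightarrow> real" where "gap w = max 0 (min 1 (1 - r w))"

lemma gap_measurable [measurable]: "gap \<in> borel_measurable lebesgue"
  unfolding gap_def[abs_def] by measurable

lemma gap_bounds: "0 \<le> gap w" "gap w \<le> 1"
  by (auto simp: gap_def)

lemma good_gap: "good w \<Longrightarrow> gap w = 1 - r w"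
  using good_r[of w] by (auto simp: gap_def)

text \<open>Its norm bounds from below the distance from the cut-off \<open>gh\<close> to the
  transforms of all finite combinations of the functions \<open>S (a * x - k)\<close>.\<close>

definition weighted_cut :: "(real \<Rightarrow> complex) \<Rightarrow> real \<Rightarrow> real \<Rightarrow> complex" where
  "weighted_cut gh a v = (indicator {- (a * pi)..<a * pi} v * of_real (sqrt (gap (v / a)))) * gh v"

lemma weighted_cut_L2:
  assumes "gh \<in> L2" "0 < a" shows "weighted_cut gh a \<in> L2"
proof -
  have "(\<lambda>v. gap (v / a)) \<in> borel_measurable lebesgue"
    using borel_measurable_lebesgue_affine[OF gap_measurable, of "1 / a" 0] assms by simp
  then have m: "(\<lambda>v. complex_of_real (sqrt (gap (v / a)))) \<in> borel_measurable lebesgue" by simp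
  have "(\<lambda>v. indicator {- (a * pi)..<a * pi} v * complex_of_real (sqrt (gap (v / a)))) \<in> borel_measurable lebesgue"
    by (rule borel_measurable_times[OF _ m]) (intro borel_measurable_indicator, auto)
  then show ?thesis
    unfolding weighted_cut_def[abs_def]
    by (rule L2_bounded_mult(1)[OF assms(1), of _ 1]) (use gap_bounds in \<open>auto simp: norm_mult indicator_def\<close>)
qed

text \<open>Rescaling to \<open>a = 1\<close> replaces \<open>gh\<close> by the transform
  \<open>h\<close> of \<open>g (x / a)\<close>. The pointwise lower bound for the bracket,
  integrated over the circle, controls the weighted cut by the distance from the cut-off
  \<open>h\<close> to \<open>C w * Sh w\<close>; the triangle inequality splits this into the
  approximation error and the cut-off error.\<close>

lemma norm_weighted_cut_le:
  assumes pg: "fourier_pair g gh" and a: "0 < a"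
  shows "norm_L2 (weighted_cut gh a) \<le>
    sqrt (2 * pi) * norm_L2 (\<lambda>x. g x - shift_comb S F c (a * x)) +
    norm_L2 (\<lambda>v. gh v - indicator {- (a * pi)..<a * pi} v * gh v)"
proof -
  define h where "h w = of_real a * gh (a * w)" for w
  define I :: "real \<Rightarrow> complex" where "I = indicator {-pi..<pi}"
  define C where "C = trig_sum F c"
  note gL = fourier_pair_L2[OF pg]
  have a0: "a \<noteq> 0" using a by simp
  have hL: "h \<in> L2" unfolding h_def[abs_def] using L2_cmult[OF L2_affine[OF gL(2) a0, of 0]] by simp
  have IhL: "(\<lambda>w. I w * h w) \<in> L2" unfolding I_def by (rule L2_indicator[OF hL]) simp
  have "fourier_pair (\<lambda>x. g ((1 / a) * x)) (\<lambda>w. gh (w / (1 / a)) / of_real (1 / a))"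
    using a by (intro fourier_pair_dilate pg) simp
  also have "(\<lambda>w. gh (w / (1 / a)) / of_real (1 / a)) = h"
    using a by (auto simp: h_def field_simps)
  finally have pf: "fourier_pair (\<lambda>x. g ((1 / a) * x) - shift_comb S F c x) (\<lambda>w. h w - C w * Sh w)"
    unfolding C_def by (intro fourier_pair_diff fourier_pair_shift_comb pair)
  note pL = fourier_pair_L2[OF pf]
  have n1: "norm_L2 (\<lambda>w. h w - C w * Sh w) = sqrt a * (sqrt (2 * pi) * norm_L2 (\<lambda>x. g x - shift_comb S F c (a * x)))"
    using plancherel[OF pf] norm_L2_affine[OF a0, of "\<lambda>x. g ((1 / a) * x) - shift_comb S F c x" 0] a by simp
  have scale: "norm_L2 (\<lambda>w. of_real a * u (a * w)) = sqrt a * norm_L2 u" for u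
  proof -
    show ?thesis
      using norm_L2_affine[OF a0, of u 0] a by (simp add: norm_L2_cmult mult.assoc[symmetric])
  qed
  have ind: "indicator {- (a * pi)..<a * pi} (a * w) = I w" for w
    using mult_le_cancel_left_pos[OF a, of "-pi" w] mult_less_cancel_left_pos[OF a, of w pi]
    by (simp add: I_def indicator_def)
  have n2: "norm_L2 (\<lambda>w. h w - I w * h w) = sqrt a * norm_L2 (\<lambda>v. gh v - indicator {- (a * pi)..<a * pi} v * gh v)"
  proof -
    have "h w - I w * h w = of_real a * (gh (a * w) - indicator {- (a * pi)..<a * pi} (a * w) * gh (a * w))" for w
      unfolding ind h_def by (simp add: algebra_simps)
    then show ?thesis using scale[of "\<lambda>v. gh v - indicator {- (a * pi)..<a * pi} v * gh v"] by simp
  qed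
  define Z where "Z w = (I w * of_real (sqrt (gap w))) * h w" for w
  have Z: "Z = (\<lambda>w. of_real a * weighted_cut gh a (a * w))"
    using a by (auto simp: Z_def weighted_cut_def ind h_def)
  have n3: "norm_L2 Z = sqrt a * norm_L2 (weighted_cut gh a)" unfolding Z scale ..
  have ZL: "Z \<in> L2"
    using L2_cmult[OF L2_affine[OF weighted_cut_L2[OF gL(2) a] a0, of 0], of "of_real a"] by (simp add: Z)
  define X where "X w = I w * h w - C w * Sh w" for w
  have CL: "(\<lambda>w. C w * Sh w) \<in> L2"
    using L2_diff[OF hL pL(2)] by simp
  have XL: "X \<in> L2" unfolding X_def[abs_def] by (intro L2_diff IhL CL)
  have Xm: "X \<in> borel_measurable lebesgue" using XL by (simp add: L2_def)
  have "energy Z = (\<integral>\<^sup>+w. ennreal ((cmod (Z w))\<^sup>2) \<partial>circle)"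
    unfolding energy_def by (subst nn_integral_restrict_space) (auto intro!: nn_integral_cong simp: Z_def I_def indicator_def)
  also have "\<dots> \<le> (\<integral>\<^sup>+w. bracket X w \<partial>circle)"
  proof (rule nn_integral_mono_AE)
    have "AE x in lebesgue. x \<notin> {pi}"
      by (rule AE_not_in) (auto simp: negligible_iff_null_sets[symmetric])
    with AE_good show "AE w in circle. ennreal ((cmod (Z w))\<^sup>2) \<le> bracket X w"
      unfolding AE_circle_iff
    proof (eventually_elim, intro impI)
      fix w assume w: "good w" "w \<notin> {pi}" "w \<in> {-pi..pi}"
      then have wI: "w \<in> {-pi..<pi}" by auto
      have "(cmod (Z w))\<^sup>2 = (cmod (h w))\<^sup>2 * (1 - r w)"
        using wI good_r[OF w(1)] by (simp add: Z_def I_def norm_mult power_mult_distrib good_gap[OF w(1)])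
      then show "ennreal ((cmod (Z w))\<^sup>2) \<le> bracket X w"
        using bracket_cut_ge[OF w(1) wI, of C h] by (simp add: C_def trig_sum_periodic X_def[abs_def] I_def)
    qed
  qed
  also have "\<dots> = energy X" by (rule nn_integral_bracket[OF Xm])
  finally have "ennreal ((norm_L2 Z)\<^sup>2) \<le> ennreal ((norm_L2 X)\<^sup>2)" by (simp add: energy_eq_norm ZL XL)
  then have "(norm_L2 Z)\<^sup>2 \<le> (norm_L2 X)\<^sup>2" by (subst (asm) ennreal_le_iff) auto
  then have "norm_L2 Z \<le> norm_L2 X" by (rule power2_le_imp_le) simp
  also have "X = (\<lambda>w. (h w - C w * Sh w) - (h w - I w * h w))" by (auto simp: X_def)
  also have "norm_L2 \<dots> \<le> norm_L2 (\<lambda>w. h w - C w * Sh w) + norm_L2 (\<lambda>w. h w - I w * h w)"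
    by (intro norm_L2_triangle_diff pL L2_diff hL IhL)
  finally have "sqrt a * norm_L2 (weighted_cut gh a) \<le>
    sqrt a * (sqrt (2 * pi) * norm_L2 (\<lambda>x. g x - shift_comb S F c (a * x)) +
    norm_L2 (\<lambda>v. gh v - indicator {- (a * pi)..<a * pi} v * gh v))"
    unfolding n1 n2 n3 by (simp add: algebra_simps)
  then show ?thesis using a by (simp add: mult_le_cancel_left_pos)
qed

lemma eventually_in_dyadic_interval:
  "eventually (\<lambda>n::nat. v \<in> {- (2 ^ n * pi)..<2 ^ n * pi}) sequentially"
proof (rule eventually_sequentiallyI)
  fix n assume n: "nat \<lceil>\<bar>v\<bar>\<rceil> \<le> n"
  have "\<bar>v\<bar> \<le> real n" using n by linarith
  also have "real n < 2 ^ n" by (rule of_nat_less_two_power)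
  also have "(2::real) ^ n * 1 \<le> 2 ^ n * pi" using pi_gt3 by (intro mult_left_mono) auto
  finally show "v \<in> {- (2 ^ n * pi)..<2 ^ n * pi}" by auto
qed

lemma norm_tail_tendsto_0:
  assumes "gh \<in> L2"
  shows "(\<lambda>n::nat. norm_L2 (\<lambda>v. gh v - indicator {- (2 ^ n * pi)..<2 ^ n * pi} v * gh v)) \<longlonglongrightarrow> 0"
proof -
  let ?I = "\<lambda>n. indicator {- (2 ^ n * pi)..<2 ^ n * pi} :: real \<Rightarrow> complex"
  have L: "(\<lambda>v. gh v - ?I n v * gh v) \<in> L2" for n by (intro L2_diff L2_indicator assms) auto
  have "(\<lambda>n. LINT v|lebesgue. (cmod (gh v - ?I n v * gh v))\<^sup>2) \<longlonglongrightarrow> (LINT v|(lebesgue::real measure). 0)"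
  proof (rule integral_dominated_convergence)
    show "integrable lebesgue (\<lambda>x. (cmod (gh x))\<^sup>2)" using assms by (simp add: L2_def)
    show "AE x in lebesgue. (\<lambda>n. (cmod (gh x - ?I n x * gh x))\<^sup>2) \<longlonglongrightarrow> 0"
    proof (rule AE_I2, rule tendsto_eventually)
      fix x
      show "eventually (\<lambda>n. (cmod (gh x - ?I n x * gh x))\<^sup>2 = 0) sequentially"
        using eventually_in_dyadic_interval[of x] by eventually_elim simp
    qed
    show "(\<lambda>x. (cmod (gh x - ?I n x * gh x))\<^sup>2) \<in> borel_measurable lebesgue" for n
      using L2_measurable[OF L[of n]] by simp
    show "AE x in lebesgue. norm ((cmod (gh x - ?I n x * gh x))\<^sup>2) \<le> (cmod (gh x))\<^sup>2" for n
      by (auto simp: indicator_def)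
  qed simp
  then have "(\<lambda>n. sqrt (LINT v|lebesgue. (cmod (gh v - ?I n v * gh v))\<^sup>2)) \<longlonglongrightarrow> sqrt 0"
    by (intro tendsto_real_sqrt) simp
  then show ?thesis by (simp add: norm_L2_def)
qed

text \<open>By density and the vanishing tail the weighted cuts tend to 0 in norm. By monotonicity
  of \<open>r\<close> along dyadic points they also converge pointwise, to
  \<open>sqrt (1 - R w) * gh w\<close>, which must then vanish; as \<open>gh\<close> does not,
  \<open>R w\<close> is 1.\<close>

lemma AE_r_tendsto_1:
  assumes pg: "fourier_pair g gh" and nz: "AE w in lebesgue. gh w \<noteq> 0"
    and dense: "\<And>e. 0 < e \<Longrightarrow> \<exists>N. \<forall>n\<ge>N. \<exists>F c. norm_L2 (\<lambda>x. g x - shift_comb S F c (2 ^ n * x)) < e"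
  shows "AE w in lebesgue. (\<lambda>n. r (w / 2 ^ n)) \<longlonglongrightarrow> 1"
proof -
  note gL = fourier_pair_L2[OF pg]
  have to0: "(\<lambda>n. norm_L2 (weighted_cut gh (2 ^ n))) \<longlonglongrightarrow> 0"
  proof (rule LIMSEQ_I)
    fix e :: real assume "0 < e"
    define d where "d = e / (2 * sqrt (2 * pi))"
    have d: "0 < d" using \<open>0 < e\<close> by (simp add: d_def)
    obtain N where N: "\<And>n. N \<le> n \<Longrightarrow> \<exists>F c. norm_L2 (\<lambda>x. g x - shift_comb S F c (2 ^ n * x)) < d"
      using dense[OF d] by blast
    have "0 < e / 2" using \<open>0 < e\<close> by simp
    from LIMSEQ_D[OF norm_tail_tendsto_0[OF gL(2)] this] obtain M where
      M: "\<And>n. M \<le> n \<Longrightarrow> norm_L2 (\<lambda>v. gh v - indicator {- (2 ^ n * pi)..<2 ^ n * pi} v * gh v) < e / 2"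
      by auto
    show "\<exists>n0. \<forall>n\<ge>n0. norm (norm_L2 (weighted_cut gh (2 ^ n)) - 0) < e"
    proof (intro exI allI impI)
      fix n assume n: "max N M \<le> n"
      have "N \<le> n" "M \<le> n" using n by auto
      obtain F c where F: "norm_L2 (\<lambda>x. g x - shift_comb S F c (2 ^ n * x)) < d" using N[OF \<open>N \<le> n\<close>] by blast
      have "sqrt (2 * pi) * norm_L2 (\<lambda>x. g x - shift_comb S F c (2 ^ n * x)) < sqrt (2 * pi) * d"
        using F by (intro mult_strict_left_mono) auto
      also have "\<dots> = e / 2" by (simp add: d_def)
      finally show "norm (norm_L2 (weighted_cut gh (2 ^ n)) - 0) < e"
        using norm_weighted_cut_le[OF pg, of "2 ^ n" F c] M[OF \<open>M \<le> n\<close>] by simp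
    qed
  qed
  \<comment> \<open>\<open>lim\<close> is only a total function here; the monotone bounded sequence
    makes it an actual limit at almost every point.\<close>
  define R where "R w = lim (\<lambda>n. r (w / 2 ^ n))" for w
  have conv: "AE w in lebesgue. (\<lambda>n. r (w / 2 ^ n)) \<longlonglongrightarrow> R w \<and> (\<forall>n. gap (w / 2 ^ n) = 1 - r (w / 2 ^ n))"
    using AE_dyadic[OF AE_good] AE_dyadic[OF AE_r_doubling]
  proof eventually_elim
    case (elim w)
    have "r (w / 2 ^ n) \<le> r (w / 2 ^ Suc n)" for n using elim(2)[rule_format, of "Suc n"] by simp
    then have "incseq (\<lambda>n. r (w / 2 ^ n))" by (rule incseq_SucI)
    moreover have "\<forall>n. r (w / 2 ^ n) \<le> 1" using elim(1) good_r(2) by blast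
    ultimately obtain L where L: "(\<lambda>n. r (w / 2 ^ n)) \<longlonglongrightarrow> L" using incseq_convergent by blast
    then have "R w = L" unfolding R_def by (rule limI)
    moreover have "\<forall>n. gap (w / 2 ^ n) = 1 - r (w / 2 ^ n)" using elim(1) good_gap by blast
    ultimately show ?case using L by simp
  qed
  have "AE w in lebesgue. of_real (sqrt (1 - R w)) * gh w = 0"
  proof (rule AE_zero_if_pointwise_limit[OF _ to0])
    show "weighted_cut gh (2 ^ n) \<in> L2" for n using gL by (intro weighted_cut_L2) auto
    show "AE w in lebesgue. (\<lambda>n. weighted_cut gh (2 ^ n) w) \<longlonglongrightarrow> of_real (sqrt (1 - R w)) * gh w"
      using conv
    proof eventually_elim
      case (elim w)
      have "(\<lambda>n. of_real (sqrt (1 - r (w / 2 ^ n))) * gh w) \<longlonglongrightarrow> of_real (sqrt (1 - R w)) * gh w"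
        using elim by (intro tendsto_intros) auto
      moreover have "eventually (\<lambda>n. of_real (sqrt (1 - r (w / 2 ^ n))) * gh w = weighted_cut gh (2 ^ n) w) sequentially"
        using eventually_in_dyadic_interval[of w] by eventually_elim (simp add: weighted_cut_def elim)
      ultimately show ?case by (rule Lim_transform_eventually)
    qed
  qed
  with nz conv show ?thesis
  proof eventually_elim
    case (elim w)
    then have "R w = 1" by simp
    then show ?case using elim by simp
  qed
qed

text \<open>The doubling estimate at \<open>w / 2 ^ Suc n\<close> speaks of \<open>p\<close> at
  \<open>w / 2 ^ n + 2 * pi\<close>: its right-hand side tends to 0, while the factor
  \<open>r\<close> on the left tends to 1.\<close>

lemma AE_p_tendsto_0:
  assumes "AE w in lebesgue. (\<lambda>n. r (w / 2 ^ n)) \<longlonglongrightarrow> 1"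
  shows "AE w in lebesgue. (\<lambda>n. p (w / 2 ^ n + 2 * pi)) \<longlonglongrightarrow> 0"
  using assms AE_dyadic[OF AE_r_doubling]
proof eventually_elim
  case (elim w)
  let ?r = "\<lambda>n. r (w / 2 ^ n)" and ?p = "\<lambda>n. (cmod (p (w / 2 ^ n + 2 * pi)))\<^sup>2"
  have r1: "(\<lambda>n. ?r (Suc n)) \<longlonglongrightarrow> 1" using elim(1) by (rule LIMSEQ_Suc)
  have b: "?r (Suc n) * ?p n * A \<le> B * (1 - ?r n)" for n
    using elim(2)[rule_format, of "Suc n"] by simp
  have "(\<lambda>n. B * (1 - ?r n) / (?r (Suc n) * A)) \<longlonglongrightarrow> B * (1 - 1) / (1 * A)"
    using elim(1) r1 A_pos by (intro tendsto_intros) auto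
  then have lim: "(\<lambda>n. B * (1 - ?r n) / (?r (Suc n) * A)) \<longlonglongrightarrow> 0" by simp
  have "eventually (\<lambda>n. 0 < ?r (Suc n)) sequentially" using r1 by (rule order_tendstoD) simp
  then have "eventually (\<lambda>n. norm (?p n) \<le> B * (1 - ?r n) / (?r (Suc n) * A)) sequentially"
  proof eventually_elim
    case (elim n)
    then show ?case using b[of n] A_pos by (simp add: pos_le_divide_eq mult_ac)
  qed
  from Lim_null_comparison[OF this lim] have "?p \<longlonglongrightarrow> 0" .
  then have "(\<lambda>n. sqrt (?p n)) \<longlonglongrightarrow> sqrt 0" by (rule tendsto_real_sqrt)
  then show ?case by (simp add: tendsto_norm_zero_iff)
qed

end

context wavelet_symbol
begin

text \<open>The lower bound for \<open>D\<close> turns the wavelet formula into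
  \<open>cmod (q w) \<le> B / sqrt K * cmod (p (w + 2 * pi))\<close>.\<close>

lemma AE_q_tendsto_0:
  assumes "AE w in lebesgue. (\<lambda>n. r (w / 2 ^ n)) \<longlonglongrightarrow> 1"
  shows "AE w in lebesgue. (\<lambda>n. q (w / 2 ^ n)) \<longlonglongrightarrow> 0"
proof -
  obtain K L where K: "0 < K" and ae: "AE w in lebesgue. K \<le> (cmod (D w))\<^sup>2 \<and> (cmod (D w))\<^sup>2 \<le> L \<and>
       q w * D w = cis (- (w / 2)) * of_real (G (w / 2 + pi)) * cnj (p (w + 2 * pi))"
    using AE_wavelet_formula by blast
  have "AE w in lebesgue. cmod (q w) \<le> B / sqrt K * cmod (p (w + 2 * pi))"
    using ae AE_good_half
  proof eventually_elim
    case (elim w)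
    have g: "A \<le> G (w / 2 + pi)" "G (w / 2 + pi) \<le> B" using elim by (auto simp: good_def)
    have "sqrt K \<le> cmod (D w)" using elim K by (intro real_le_lsqrt) auto
    then have "cmod (q w) * sqrt K \<le> cmod (q w * D w)" by (simp add: norm_mult mult_left_mono)
    also have "\<dots> = G (w / 2 + pi) * cmod (p (w + 2 * pi))" using elim g A_pos by (simp add: norm_mult)
    also have "\<dots> \<le> B * cmod (p (w + 2 * pi))" using g by (intro mult_right_mono) auto
    finally show ?case using K by (simp add: pos_le_divide_eq)
  qed
  from AE_dyadic[OF this] AE_p_tendsto_0[OF assms] show ?thesis
  proof eventually_elim
    case (elim w)
    have "(\<lambda>n. B / sqrt K * cmod (p (w / 2 ^ n + 2 * pi))) \<longlonglongrightarrow> B / sqrt K * cmod 0"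
      using elim(2) by (intro tendsto_intros)
    then have lim: "(\<lambda>n. B / sqrt K * cmod (p (w / 2 ^ n + 2 * pi))) \<longlonglongrightarrow> 0" by simp
    have "eventually (\<lambda>n. norm (q (w / 2 ^ n)) \<le> B / sqrt K * cmod (p (w / 2 ^ n + 2 * pi))) sequentially"
      using elim(1) by (intro always_eventually)
    then show ?case using lim by (rule Lim_null_comparison)
  qed
qed

end

section \<open>Summation at the origin\<close>

lemma cesaro_means_tendsto:
  fixes s :: "nat \<Rightarrow> complex"
  assumes "s \<longlonglongrightarrow> L"
  shows "(\<lambda>m. (\<Sum>n<m. s n) / of_nat m) \<longlonglongrightarrow> L"
proof (rule LIMSEQ_I)
  fix e :: real assume "0 < e"
  then have "0 < e / 2" by simp
  from LIMSEQ_D[OF assms this] obtain N where N: "\<And>n. N \<le> n \<Longrightarrow> cmod (s n - L) < e / 2" by auto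
  define K where "K = (\<Sum>n<N. cmod (s n - L))"
  have K: "0 \<le> K" by (simp add: K_def sum_nonneg)
  obtain M where M: "2 * K / e < real M" using reals_Archimedean2 by blast
  show "\<exists>n0. \<forall>m\<ge>n0. norm ((\<Sum>n<m. s n) / of_nat m - L) < e"
  proof (intro exI allI impI)
    fix m assume m: "N + M + 1 \<le> m"
    have m0: "0 < real m" using m by simp
    have "(\<Sum>n<m. s n) / of_nat m - L = (\<Sum>n<m. s n - L) / of_nat m"
      using m0 by (simp add: sum_subtractf field_simps)
    then have "norm ((\<Sum>n<m. s n) / of_nat m - L) \<le> (\<Sum>n<m. cmod (s n - L)) / real m"
      by (simp add: norm_divide divide_right_mono norm_sum)
    also have "(\<Sum>n<m. cmod (s n - L)) = K + (\<Sum>n=N..<m. cmod (s n - L))"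
      unfolding K_def using m by (subst sum.atLeastLessThan_concat[symmetric, of 0 N m, unfolded atLeast0LessThan]) auto
    also have "(\<Sum>n=N..<m. cmod (s n - L)) \<le> real (card {N..<m}) * (e / 2)"
      by (rule sum_bounded_above) (use N in \<open>auto intro: less_imp_le\<close>)
    also have "real (card {N..<m}) * (e / 2) \<le> real m * (e / 2)"
      using \<open>0 < e\<close> by (intro mult_right_mono) auto
    finally have "norm ((\<Sum>n<m. s n) / of_nat m - L) \<le> (K + real m * (e / 2)) / real m"
      using m0 by (simp add: divide_right_mono)
    also have "\<dots> = K / real m + e / 2" using m0 by (simp add: field_simps)
    also have "K / real m < e / 2"
    proof -
      have "2 * K < e * real M" using M \<open>0 < e\<close> by (simp add: field_simps)
      also have "\<dots> \<le> e * real m" using m \<open>0 < e\<close> by (intro mult_left_mono) auto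
      finally show ?thesis using m0 by (simp add: field_simps)
    qed
    finally show "norm ((\<Sum>n<m. s n) / of_nat m - L) < e" by simp
  qed
qed

text \<open>The one-sided geometric sum, chosen because its squared modulus is \<open>m\<close>
  times the Fejer kernel of order \<open>m\<close>.\<close>

definition dirichlet :: "nat \<Rightarrow> real \<Rightarrow> complex" where
  "dirichlet m w = (\<Sum>j<m. cis (- (real j * w)))"

lemma continuous_on_dirichlet: "continuous_on A (dirichlet m)"
  unfolding dirichlet_def by (intro continuous_intros)

lemma borel_measurable_fejer:
  "(\<lambda>w. complex_of_real ((cmod (dirichlet m w))\<^sup>2)) \<in> borel_measurable lebesgue"
  by (intro borel_measurable_continuous_lebesgue continuous_intros continuous_on_dirichlet)

lemma dirichlet_le: "cmod (dirichlet m w) \<le> real m"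
  unfolding dirichlet_def by (rule order_trans[OF norm_sum]) simp

lemma cmod_cis_minus_1: "cmod (cis x - 1) = 2 * \<bar>sin (x / 2)\<bar>"
proof -
  have "(cmod (cis x - 1))\<^sup>2 = (cos x - 1)\<^sup>2 + (sin x)\<^sup>2" by (simp add: cmod_power2)
  also have "\<dots> = 2 - 2 * cos x" using sin_cos_squared_add[of x] by (simp add: power2_diff)
  also have "cos x = 1 - 2 * (sin (x / 2))\<^sup>2" using cos_double_sin[of "x / 2"] by simp
  finally have "(cmod (cis x - 1))\<^sup>2 = (2 * \<bar>sin (x / 2)\<bar>)\<^sup>2" by (simp add: power_mult_distrib)
  then show ?thesis by (rule power2_eq_imp_eq) auto
qed

text \<open>The Taylor error \<open>\<bar>x\<bar>^3 / 6\<close> is at most two thirds of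
  \<open>\<bar>x\<bar>\<close> on this range, which contains all halves of points of
  \<open>[-pi, pi]\<close>.\<close>

lemma abs_sin_ge:
  assumes "\<bar>x\<bar> \<le> 2" shows "\<bar>x\<bar> / 3 \<le> \<bar>sin (x::real)\<bar>"
proof -
  have "\<bar>sin x - (\<Sum>m<3. sin_coeff m * x ^ m)\<bar> \<le> inverse (fact 3) * \<bar>x\<bar> ^ 3"
    by (rule Maclaurin_sin_bound)
  also have "(\<Sum>m<3. sin_coeff m * x ^ m) = x" by (simp add: eval_nat_numeral sin_coeff_def)
  also have "inverse (fact 3) * \<bar>x\<bar> ^ 3 = \<bar>x\<bar> * (\<bar>x\<bar>\<^sup>2 / 6)" by (simp add: eval_nat_numeral)
  also have "\<dots> \<le> \<bar>x\<bar> * (2\<^sup>2 / 6)"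
    using assms by (intro mult_left_mono divide_right_mono power_mono) auto
  finally show ?thesis by (simp add: abs_if split: if_splits)
qed

text \<open>The geometric sum times \<open>cis (- w) - 1\<close> has modulus at most 2, and that
  factor has modulus at least \<open>\<bar>w\<bar> / 3\<close>.\<close>

lemma dirichlet_decay:
  assumes "\<bar>w\<bar> \<le> pi" shows "cmod (dirichlet m w) * \<bar>w\<bar> \<le> 6"
proof -
  have "dirichlet m w = (\<Sum>j<m. cis (- w) ^ j)"
    unfolding dirichlet_def by (intro sum.cong refl) (simp add: Complex.DeMoivre)
  then have "dirichlet m w * (cis (- w) - 1) = cis (- w) ^ m - 1"
    using power_diff_1_eq[of "cis (- w)" m] by (simp add: mult.commute)
  then have "cmod (dirichlet m w) * cmod (cis (- w) - 1) \<le> 2"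
    using norm_triangle_ineq4[of "cis (- w) ^ m" 1] by (simp add: norm_mult[symmetric] norm_power)
  then have "cmod (dirichlet m w) * (2 * \<bar>sin (w / 2)\<bar>) \<le> 2"
    by (simp add: cmod_cis_minus_1)
  moreover have "\<bar>w / 2\<bar> / 3 \<le> \<bar>sin (w / 2)\<bar>" using assms pi_less_4 by (intro abs_sin_ge) auto
  then have "cmod (dirichlet m w) * (2 * (\<bar>w / 2\<bar> / 3)) \<le> cmod (dirichlet m w) * (2 * \<bar>sin (w / 2)\<bar>)"
    by (intro mult_left_mono) auto
  ultimately show ?thesis by simp
qed

text \<open>The trivial bound \<open>m^2\<close> and the decay bound \<open>6^2 * m^2\<close> add up
  to the constant 37.\<close>

lemma fejer_kernel_bound:
  assumes "0 < m" "\<bar>u\<bar> \<le> real m * pi"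
  shows "(cmod (dirichlet m (u / real m)))\<^sup>2 / (real m)\<^sup>2 \<le> 37 / (1 + u\<^sup>2)"
proof -
  define d where "d = cmod (dirichlet m (u / real m))"
  have d: "0 \<le> d" "d \<le> real m" by (simp_all add: d_def dirichlet_le)
  have "\<bar>u / real m\<bar> \<le> pi" using assms by (simp add: pos_divide_le_eq mult.commute)
  from dirichlet_decay[OF this, of m] have "d * \<bar>u / real m\<bar> \<le> 6" by (simp add: d_def)
  then have "d * \<bar>u\<bar> \<le> 6 * real m" using assms by (simp add: pos_divide_le_eq)
  then have "(d * \<bar>u\<bar>)\<^sup>2 \<le> (6 * real m)\<^sup>2" using d by (intro power_mono) auto
  moreover have "d\<^sup>2 \<le> (real m)\<^sup>2" using d by (intro power_mono)
  ultimately have "d\<^sup>2 * (1 + u\<^sup>2) \<le> 37 * (real m)\<^sup>2" by (simp add: power_mult_distrib distrib_left)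
  moreover have "0 < 1 + u\<^sup>2" by (simp add: add_pos_nonneg)
  ultimately show ?thesis using assms by (simp add: d_def divide_simps)
qed

text \<open>The three parts are the new column, row and corner when the square of index pairs in the
  next lemma is enlarged by one.\<close>

lemma sum_symmetric_interval:
  fixes a :: "int \<Rightarrow> complex"
  shows "(\<Sum>k=-int m..int m. a k) = (\<Sum>j<m. a (int j - int m)) + (\<Sum>j<m. a (int m - int j)) + a 0"
proof -
  have set_eq: "{-int m..int m} = ((\<lambda>j. int j - int m) ` {..<m} \<union> (\<lambda>j. int m - int j) ` {..<m}) \<union> {0}"
  proof (intro set_eqI iffI)
    fix k assume "k \<in> {-int m..int m}"
    then consider "k = 0" | "k < 0" "- int m \<le> k" | "0 < k" "k \<le> int m" by force
    then show "k \<in> ((\<lambda>j. int j - int m) ` {..<m} \<union> (\<lambda>j. int m - int j) ` {..<m}) \<union> {0}"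
    proof cases
      case 2
      then have "k = int (nat (k + int m)) - int m" "nat (k + int m) < m" by auto
      then show ?thesis by blast
    next
      case 3
      then have "k = int m - int (nat (int m - k))" "nat (int m - k) < m" by auto
      then show ?thesis by blast
    qed simp
  qed auto
  have "(\<Sum>k=-int m..int m. a k) = (\<Sum>k\<in>(\<lambda>j. int j - int m) ` {..<m}. a k) + (\<Sum>k\<in>(\<lambda>j. int m - int j) ` {..<m}. a k) + a 0"
    unfolding set_eq by (subst sum.union_disjoint; (subst sum.union_disjoint)?) auto
  then show ?thesis by (simp add: sum.reindex inj_on_def)
qed

text \<open>Each bordering of the square adds every difference between \<open>-m\<close> and
  \<open>m\<close> exactly once. The result is \<open>m\<close> times a Cesaro mean of the symmetric
  partial sums.\<close>

lemma double_sum_differences: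
  fixes a :: "int \<Rightarrow> complex"
  shows "(\<Sum>i<m. \<Sum>j<m. a (int i - int j)) = (\<Sum>l<m. \<Sum>k=-int l..int l. a k)"
proof (induction m)
  case (Suc m)
  have "(\<Sum>i<Suc m. \<Sum>j<Suc m. a (int i - int j)) =
    (\<Sum>i<m. \<Sum>j<m. a (int i - int j)) + ((\<Sum>i<m. a (int i - int m)) + (\<Sum>j<m. a (int m - int j)) + a 0)"
    by (simp add: sum.distrib)
  then show ?case unfolding Suc.IH sum_symmetric_interval[of a m, symmetric] by simp
qed simp

lemma dirichlet_square:
  "complex_of_real ((cmod (dirichlet m w))\<^sup>2) = (\<Sum>i<m. \<Sum>j<m. cis (of_int (int i - int j) * w))"
  unfolding complex_norm_square dirichlet_def cnj_sum sum_product
  by (subst sum.swap) (intro sum.cong refl, simp add: cis_cnj cis_mult algebra_simps)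

text \<open>For \<open>m \<le> n\<close> all differences \<open>i - j\<close> lie in the summation
  range, so orthogonality of the exponentials picks out a value independent of
  \<open>n\<close>.\<close>

lemma integral_trig_sum_fejer:
  assumes "m \<le> n"
  shows "(LINT w|circle. trig_sum {-int n..int n} a w * of_real ((cmod (dirichlet m w))\<^sup>2))
    = of_real (2 * pi) * (\<Sum>l<m. \<Sum>k=-int l..int l. a k)"
proof -
  have i: "integrable circle (\<lambda>w. b * cis (of_int k * w))" for b k
    by (rule integrable_circle_bounded[of _ "cmod b"])
       (auto intro!: measurable_circle borel_measurable_continuous_lebesgue continuous_intros simp: norm_mult)
  have "trig_sum {-int n..int n} a w * of_real ((cmod (dirichlet m w))\<^sup>2) =
    (\<Sum>k=-int n..int n. \<Sum>i<m. \<Sum>j<m. a k * cis (of_int ((int i - int j) - k) * w))" for w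
    unfolding trig_sum_def sum_distrib_right unfolding dirichlet_square unfolding sum_distrib_left
    by (intro sum.cong refl) (simp add: mult.assoc cis_mult algebra_simps)
  then have "(LINT w|circle. trig_sum {-int n..int n} a w * of_real ((cmod (dirichlet m w))\<^sup>2)) =
    (\<Sum>k=-int n..int n. \<Sum>i<m. \<Sum>j<m. a k * (LINT w|circle. cis (of_int ((int i - int j) - k) * w)))"
    by (simp add: Bochner_Integration.integral_sum i del: of_int_diff)
  also have "\<dots> = (\<Sum>k=-int n..int n. \<Sum>i<m. \<Sum>j<m. if k = int i - int j then a k * of_real (2 * pi) else 0)"
    unfolding integral_circle_cis by (intro sum.cong refl) auto
  also have "\<dots> = (\<Sum>i<m. \<Sum>j<m. \<Sum>k=-int n..int n. if k = int i - int j then a k * of_real (2 * pi) else 0)"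
    by (subst sum.swap) (intro sum.cong refl sum.swap)
  also have "\<dots> = (\<Sum>i<m. \<Sum>j<m. a (int i - int j) * of_real (2 * pi))"
    by (intro sum.cong refl) (use assms in auto)
  also have "\<dots> = of_real (2 * pi) * (\<Sum>i<m. \<Sum>j<m. a (int i - int j))"
    by (simp add: sum_distrib_left mult.commute)
  finally show ?thesis unfolding double_sum_differences .
qed

lemma integrable_inverse_one_plus_square: "integrable lebesgue (\<lambda>x::real. K / (1 + x\<^sup>2))"
proof -
  have "integrable lborel (\<lambda>x::real. inverse (1 + x\<^sup>2))"
    using integrable_inverse_1_plus_square by (simp add: set_integrable_def)
  then have "integrable lebesgue (\<lambda>x::real. inverse (1 + x\<^sup>2))"
    by (subst integrable_completion) auto
  then have "integrable lebesgue (\<lambda>x::real. K * inverse (1 + x\<^sup>2))" by (rule integrable_mult_right)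
  then show ?thesis by (simp add: divide_inverse)
qed

text \<open>
  The rescaled Fejer kernels have the integrable majorant \<open>37 / (1 + u\<^sup>2)\<close>, so their dyadic
  means at the origin only see the limits of \<open>t\<close> along \<open>u / 2\<^sup>n\<close>.
\<close>

lemma fejer_means_tendsto_0:
  fixes t :: "real \<Rightarrow> complex"
  assumes t [measurable]: "t \<in> borel_measurable lebesgue"
    and bd: "AE w in lebesgue. cmod (t w) \<le> K"
    and lim: "AE u in lebesgue. (\<lambda>n. t (u / 2 ^ n)) \<longlonglongrightarrow> 0"
  shows "(\<lambda>n. (LINT w|circle. t w * of_real ((cmod (dirichlet (2 ^ n) w))\<^sup>2)) / of_nat (2 ^ n)) \<longlonglongrightarrow> 0"
proof -
  \<comment> \<open>In the variable \<open>u = 2^n * w\<close> the Jacobian and the division by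
    \<open>2^n\<close> together produce the square in the denominator.\<close>
  define F where "F n u = indicator {-pi..pi} (u / 2 ^ n) *\<^sub>R
     (t (u / 2 ^ n) * of_real ((cmod (dirichlet (2 ^ n) (u / 2 ^ n)))\<^sup>2 / (2 ^ n)\<^sup>2))" for n :: nat and u :: real
  have Fm: "F n \<in> borel_measurable lebesgue" for n
  proof -
    have "(\<lambda>w. indicator {-pi..pi} w *\<^sub>R (t w * of_real ((cmod (dirichlet (2 ^ n) w))\<^sup>2 / (2 ^ n)\<^sup>2))) \<in> borel_measurable lebesgue"
    proof -
      have "(\<lambda>w. t w * (complex_of_real ((cmod (dirichlet (2 ^ n) w))\<^sup>2) / of_real ((2 ^ n)\<^sup>2))) \<in> borel_measurable lebesgue"
        using t borel_measurable_fejer[of "2 ^ n"] by (intro borel_measurable_times borel_measurable_divide) auto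
      moreover have "(indicator {-pi..pi} :: real \<Rightarrow> real) \<in> borel_measurable lebesgue"
        by (intro borel_measurable_indicator) auto
      ultimately show ?thesis unfolding of_real_divide by (intro borel_measurable_scaleR)
    qed
    from borel_measurable_lebesgue_affine[OF this, of "1 / 2 ^ n" 0] show ?thesis
      by (simp add: F_def[abs_def])
  qed
  have eq: "(LINT w|circle. t w * of_real ((cmod (dirichlet (2 ^ n) w))\<^sup>2)) / of_nat (2 ^ n) = (LINT u|lebesgue. F n u)" for n
  proof -
    have "(LINT w|circle. t w * of_real ((cmod (dirichlet (2 ^ n) w))\<^sup>2)) =
      \<bar>1 / 2 ^ n\<bar> *\<^sub>R (LINT u|lebesgue. indicator {-pi..pi} (0 + 1 / 2 ^ n * u) *\<^sub>R
        (t (0 + 1 / 2 ^ n * u) * of_real ((cmod (dirichlet (2 ^ n) (0 + 1 / 2 ^ n * u)))\<^sup>2)))"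
      by (subst integral_restrict_space, simp) (rule lebesgue_integral_real_affine, simp)
    also have "(LINT u|lebesgue. indicator {-pi..pi} (0 + 1 / 2 ^ n * u) *\<^sub>R
        (t (0 + 1 / 2 ^ n * u) * of_real ((cmod (dirichlet (2 ^ n) (0 + 1 / 2 ^ n * u)))\<^sup>2)))
      = (LINT u|lebesgue. (2 ^ n)\<^sup>2 * F n u)"
      by (intro Bochner_Integration.integral_cong refl) (simp add: F_def scaleR_conv_of_real)
    finally show ?thesis by (simp add: scaleR_conv_of_real power2_eq_square)
  qed
  have "(\<lambda>n. LINT u|lebesgue. F n u) \<longlonglongrightarrow> (LINT u|(lebesgue::real measure). 0)"
  proof (rule integral_dominated_convergence)
    show "integrable lebesgue (\<lambda>u::real. K * 37 / (1 + u\<^sup>2))" by (rule integrable_inverse_one_plus_square)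
    have bF: "cmod (F n u) \<le> cmod (t (u / 2 ^ n)) * (37 / (1 + u\<^sup>2))" for n u
    proof (cases "u / 2 ^ n \<in> {-pi..pi}")
      case True
      then have "\<bar>u\<bar> \<le> real (2 ^ n) * pi" by (auto simp: field_simps abs_le_iff)
      from fejer_kernel_bound[OF _ this] have
        "(cmod (dirichlet (2 ^ n) (u / 2 ^ n)))\<^sup>2 / (2 ^ n)\<^sup>2 \<le> 37 / (1 + u\<^sup>2)" by simp
      then have "cmod (t (u / 2 ^ n)) * ((cmod (dirichlet (2 ^ n) (u / 2 ^ n)))\<^sup>2 / (2 ^ n)\<^sup>2) \<le> cmod (t (u / 2 ^ n)) * (37 / (1 + u\<^sup>2))"
        by (rule mult_left_mono) simp
      then show ?thesis using True by (simp add: F_def norm_mult norm_divide norm_power)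
    next
      case False
      then show ?thesis by (simp add: F_def)
    qed
    show "AE u in lebesgue. (\<lambda>n. F n u) \<longlonglongrightarrow> 0"
      using lim
    proof eventually_elim
      case (elim u)
      have "(\<lambda>n. cmod (t (u / 2 ^ n)) * (37 / (1 + u\<^sup>2))) \<longlonglongrightarrow> cmod 0 * (37 / (1 + u\<^sup>2))"
        using elim by (intro tendsto_mult_right tendsto_norm)
      then have l: "(\<lambda>n. cmod (t (u / 2 ^ n)) * (37 / (1 + u\<^sup>2))) \<longlonglongrightarrow> 0" by simp
      have "eventually (\<lambda>n. norm (F n u) \<le> cmod (t (u / 2 ^ n)) * (37 / (1 + u\<^sup>2))) sequentially"
        using bF by (intro always_eventually allI)
      then show ?case using l by (rule Lim_null_comparison)
    qed
    show "AE u in lebesgue. norm (F n u) \<le> K * 37 / (1 + u\<^sup>2)" for n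
      using AE_lebesgue_affine[OF bd, of "1 / 2 ^ n" 0, simplified]
    proof eventually_elim
      case (elim u)
      have "0 \<le> 37 / (1 + u\<^sup>2)" by simp
      from mult_right_mono[OF elim this] bF[of n u] show ?case by simp
    qed
  qed (use Fm in auto)
  then show ?thesis unfolding eq by simp
qed

context wavelet_symbol
begin

text \<open>The function \<open>2 * q (2 * w)\<close> has period \<open>2 * pi\<close>; doubling
  value and argument undoes the normalisation of the symbol and gives the sum of the plain
  trigonometric series.\<close>

lemma AE_t_bounded: "AE w in lebesgue. cmod (2 * q (2 * w)) \<le> 2 * sqrt (B' / A)"
proof -
  have "AE w in lebesgue. (cmod (q (0 + 2 * w)))\<^sup>2 \<le> B' / A \<and> (cmod (q (0 + 2 * w + 2 * pi)))\<^sup>2 \<le> B' / A"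
    by (rule AE_lebesgue_affine[OF AE_q_bounded]) simp
  then show ?thesis by eventually_elim (auto simp: norm_mult intro: real_le_rsqrt)
qed

text \<open>Since the bracket of \<open>Sh\<close> is at least \<open>A\<close>, convergence
  weighted by \<open>Sh\<close> on the line implies convergence in mean square on the circle. There
  the bounded kernel may be integrated against the partial sums, whose integrals no longer depend on
  \<open>n\<close> once \<open>m \<le> n\<close>.\<close>

lemma integral_fejer_q:
  assumes qm: "q \<in> borel_measurable lebesgue"
    and L2conv: "(\<lambda>n. norm_L2 (\<lambda>w. (2 * q (2 * w) - trig_sum {-int n..int n} a w) * Sh w)) \<longlonglongrightarrow> 0"
  shows "(LINT w|circle. 2 * q (2 * w) * of_real ((cmod (dirichlet m w))\<^sup>2)) =
    of_real (2 * pi) * (\<Sum>l<m. \<Sum>k=-int l..int l. a k)"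
proof -
  define t where "t w = 2 * q (2 * w)" for w
  define C where "C n = trig_sum {-int n..int n} a" for n :: nat
  have tm [measurable]: "t \<in> borel_measurable lebesgue"
    unfolding t_def[abs_def] using borel_measurable_lebesgue_affine[OF qm, of 2 0] by simp
  have Cm [measurable]: "C n \<in> borel_measurable lebesgue" for n
    unfolding C_def by (intro borel_measurable_trig_poly trig_poly_trig_sum) simp
  have mc [measurable]: "t \<in> borel_measurable circle" "C n \<in> borel_measurable circle" for n
    using measurable_circle[OF tm] measurable_circle[OF Cm] by auto
  define Kt where "Kt = 2 * sqrt (B' / A)"
  have tb: "AE w in circle. cmod (t w) \<le> Kt"
    using AE_t_bounded unfolding AE_circle_iff t_def Kt_def by (auto elim: eventually_mono)
  define Kc where "Kc n = (\<Sum>k=-int n..int n. cmod (a k))" for n :: nat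
  have cb: "cmod (C n w) \<le> Kc n" for n w unfolding C_def Kc_def by (rule trig_sum_bound)
  have db: "AE w in circle. cmod (t w - C n w) \<le> Kt + Kc n" for n
    using tb by eventually_elim (rule order_trans[OF norm_triangle_ineq4 add_mono[OF _ cb]])
  have i1: "integrable circle (\<lambda>w. cmod (t w - C n w))" for n
    by (rule finite_measure.integrable_const_bound[OF finite_measure_circle, of _ "Kt + Kc n"])
       (use db in auto)
  have i2: "integrable circle (\<lambda>w. (cmod (t w - C n w))\<^sup>2)" for n
  proof (rule finite_measure.integrable_const_bound[OF finite_measure_circle, of _ "(Kt + Kc n)\<^sup>2"])
    show "AE w in circle. norm ((cmod (t w - C n w))\<^sup>2) \<le> (Kt + Kc n)\<^sup>2"
      using db[of n] by eventually_elim (auto intro: power_mono)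
  qed simp
  define X where "X n = (LINT w|circle. (cmod (t w - C n w))\<^sup>2)" for n
  have qper: "q (2 * (w + 2 * pi * of_int k)) = q (2 * w)" for w k
    using q_periodic[of "2 * w" k] by (simp add: algebra_simps)
  define f where "f n w = (t w - C n w) * Sh w" for n w
  have fm: "f n \<in> borel_measurable lebesgue" for n unfolding f_def[abs_def] by measurable
  \<comment> \<open>The difference \<open>t - C n\<close> is periodic, so it factors out of the
    bracket of \<open>f n\<close>, leaving the weight \<open>G\<close>.\<close>
  have X: "A * X n \<le> (norm_L2 (f n))\<^sup>2" if fL: "f n \<in> L2" for n
  proof -
    have "ennreal (A * X n) = (\<integral>\<^sup>+w. ennreal (A * (cmod (t w - C n w))\<^sup>2) \<partial>circle)"
    proof -
      have "(\<integral>\<^sup>+w. ennreal (A * (cmod (t w - C n w))\<^sup>2) \<partial>circle) = ennreal (LINT w|circle. A * (cmod (t w - C n w))\<^sup>2)"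
        by (rule nn_integral_eq_integral) (use i2[of n] A_pos in auto)
      then show ?thesis by (simp add: X_def)
    qed
    also have "\<dots> \<le> (\<integral>\<^sup>+w. bracket (f n) w \<partial>circle)"
    proof (rule nn_integral_mono_AE)
      have "AE w in circle. good w" using AE_good unfolding AE_circle_iff by (auto elim: eventually_mono)
      then show "AE w in circle. ennreal (A * (cmod (t w - C n w))\<^sup>2) \<le> bracket (f n) w"
      proof eventually_elim
        case (elim w)
        have "bracket (f n) w = ennreal ((cmod (t w - C n w))\<^sup>2) * bracket Sh w"
          unfolding f_def[abs_def]
          by (rule bracket_mult_periodic) (simp only: t_def C_def qper trig_sum_periodic)
        also have "\<dots> = ennreal ((cmod (t w - C n w))\<^sup>2 * G w)"
          using elim by (simp add: good_def ennreal_mult G_def)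
        finally have eq: "bracket (f n) w = ennreal ((cmod (t w - C n w))\<^sup>2 * G w)" .
        have "A * (cmod (t w - C n w))\<^sup>2 \<le> G w * (cmod (t w - C n w))\<^sup>2"
          using elim by (intro mult_right_mono) (auto simp: good_def)
        then show ?case unfolding eq by (intro ennreal_leI) (simp only: mult.commute)
      qed
    qed
    also have "\<dots> = ennreal ((norm_L2 (f n))\<^sup>2)"
      unfolding nn_integral_bracket[OF fm] by (rule energy_eq_norm[OF fL])
    finally show ?thesis by (simp only: ennreal_le_iff[OF zero_le_power2])
  qed
  have fL: "f n \<in> L2" for n
  proof -
    have "AE w in lebesgue. cmod (t w - C n w) \<le> Kt + Kc n"
      using AE_t_bounded unfolding t_def[symmetric] Kt_def[symmetric]
      by eventually_elim (rule order_trans[OF norm_triangle_ineq4 add_mono[OF _ cb]])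
    then have bd: "AE w in lebesgue. (cmod (f n w))\<^sup>2 \<le> (Kt + Kc n)\<^sup>2 * (cmod (Sh w))\<^sup>2"
    proof eventually_elim
      case (elim w)
      have "cmod (f n w) \<le> (Kt + Kc n) * cmod (Sh w)"
        unfolding f_def norm_mult by (rule mult_right_mono[OF elim]) simp
      then have "(cmod (f n w))\<^sup>2 \<le> ((Kt + Kc n) * cmod (Sh w))\<^sup>2" by (rule power_mono) simp
      then show ?case by (simp only: power_mult_distrib)
    qed
    have "integrable lebesgue (\<lambda>w. (cmod (f n w))\<^sup>2)"
    proof (rule Bochner_Integration.integrable_bound)
      show "integrable lebesgue (\<lambda>w. (Kt + Kc n)\<^sup>2 * (cmod (Sh w))\<^sup>2)"
        by (intro integrable_mult_right L2_integrable fourier_pair_L2(2)[OF pair])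
      show "AE w in lebesgue. norm ((cmod (f n w))\<^sup>2) \<le> norm ((Kt + Kc n)\<^sup>2 * (cmod (Sh w))\<^sup>2)"
        using bd by eventually_elim simp
      show "(\<lambda>w. (cmod (f n w))\<^sup>2) \<in> borel_measurable lebesgue"
        using fm[of n] by simp
    qed
    then show ?thesis using fm by (simp add: L2_def)
  qed
  have "(\<lambda>n. (norm_L2 (f n))\<^sup>2 / A) \<longlonglongrightarrow> 0\<^sup>2 / A"
    using L2conv A_pos unfolding f_def[abs_def] t_def C_def by (intro tendsto_intros) auto
  then have lim: "(\<lambda>n. (norm_L2 (f n))\<^sup>2 / A) \<longlonglongrightarrow> 0" by simp
  have "X n \<le> (norm_L2 (f n))\<^sup>2 / A" for n
    using X[OF fL[of n]] A_pos by (simp add: pos_le_divide_eq mult.commute)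
  moreover have "0 \<le> X n" for n by (simp add: X_def)
  ultimately have "eventually (\<lambda>n. norm (X n) \<le> (norm_L2 (f n))\<^sup>2 / A) sequentially"
    by (intro always_eventually allI) simp
  then have Xlim: "X \<longlonglongrightarrow> 0" using lim by (rule Lim_null_comparison)
  define d where "d w = complex_of_real ((cmod (dirichlet m w))\<^sup>2)" for w
  have dm [measurable]: "d \<in> borel_measurable circle" unfolding d_def[abs_def]
    by (intro measurable_circle borel_measurable_fejer)
  have dle: "cmod (d w) \<le> (real m)\<^sup>2" for w
    using dirichlet_le[of m w] by (auto simp: d_def norm_power intro: power_mono)
  have it: "integrable circle (\<lambda>w. t w * d w)"
  proof (rule finite_measure.integrable_const_bound[OF finite_measure_circle, of _ "Kt * (real m)\<^sup>2"])
    show "AE w in circle. norm (t w * d w) \<le> Kt * (real m)\<^sup>2"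
      using tb
    proof eventually_elim
      case (elim w)
      have "0 \<le> Kt" using elim norm_ge_zero order_trans by blast
      then show ?case unfolding norm_mult using elim dle by (intro mult_mono) auto
    qed
  qed simp
  have iC: "integrable circle (\<lambda>w. C n w * d w)" for n
  proof (rule integrable_circle_bounded[of _ "Kc n * (real m)\<^sup>2"])
    show "norm (C n w * d w) \<le> Kc n * (real m)\<^sup>2" for w
      unfolding norm_mult by (rule mult_mono) (use cb dle in \<open>auto simp: Kc_def sum_nonneg\<close>)
  qed simp
  let ?I = "(LINT w|circle. t w * d w)" and ?J = "of_real (2 * pi) * (\<Sum>l<m. \<Sum>k=-int l..int l. a k)"
  \<comment> \<open>The elementary bound \<open>x \<le> \<delta> + x^2 / \<delta>\<close> passes
    from the mean square to the mean; first \<open>n\<close> tends to infinity, then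
    \<open>\<delta>\<close> to 0.\<close>
  have bound: "cmod (?I - ?J) \<le> (real m)\<^sup>2 * (\<delta> * (2 * pi) + X n / \<delta>)" if "m \<le> n" "0 < \<delta>" for n \<delta>
  proof -
    have J: "?J = (LINT w|circle. C n w * d w)"
      unfolding C_def d_def by (rule integral_trig_sum_fejer[OF that(1), symmetric])
    have "?I - ?J = (LINT w|circle. (t w - C n w) * d w)"
      unfolding J left_diff_distrib by (rule Bochner_Integration.integral_diff[symmetric, OF it iC])
    also have "cmod \<dots> \<le> (LINT w|circle. (real m)\<^sup>2 * (\<delta> + (cmod (t w - C n w))\<^sup>2 / \<delta>))"
    proof (rule order_trans[OF integral_norm_bound], rule integral_mono)
      show "integrable circle (\<lambda>w. norm ((t w - C n w) * d w))"
        unfolding left_diff_distrib by (intro integrable_norm Bochner_Integration.integrable_diff it iC)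
      show "integrable circle (\<lambda>w. (real m)\<^sup>2 * (\<delta> + (cmod (t w - C n w))\<^sup>2 / \<delta>))"
        using i2 by (intro integrable_mult_right Bochner_Integration.integrable_add integrable_divide) auto
      fix w
      define x where "x = cmod (t w - C n w)"
      have "x * \<delta> \<le> \<delta> * \<delta> + x\<^sup>2"
      proof -
        have "0 \<le> (x - \<delta>)\<^sup>2" by simp
        moreover have "(x - \<delta>)\<^sup>2 = \<delta> * \<delta> + x\<^sup>2 - 2 * (x * \<delta>)"
          by (simp add: power2_eq_square algebra_simps)
        moreover have "0 \<le> x * \<delta>" using that(2) by (simp add: x_def)
        ultimately show ?thesis by linarith
      qed
      then have "x \<le> (\<delta> * \<delta> + x\<^sup>2) / \<delta>" using that(2) by (simp add: pos_le_divide_eq)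
      also have "\<dots> = \<delta> + x\<^sup>2 / \<delta>" using that(2) by (simp add: add_divide_distrib)
      finally have "x \<le> \<delta> + x\<^sup>2 / \<delta>" .
      then have "x * cmod (d w) \<le> (\<delta> + x\<^sup>2 / \<delta>) * (real m)\<^sup>2"
        using dle that(2) by (intro mult_mono) auto
      then show "norm ((t w - C n w) * d w) \<le> (real m)\<^sup>2 * (\<delta> + (cmod (t w - C n w))\<^sup>2 / \<delta>)"
        by (simp add: norm_mult x_def mult.commute)
    qed
    also have "\<dots> = (real m)\<^sup>2 * (\<delta> * (2 * pi) + X n / \<delta>)"
      using i2 by (simp add: X_def Bochner_Integration.integral_add measure_restrict_space)
    finally show ?thesis .
  qed
  have "cmod (?I - ?J) \<le> (real m)\<^sup>2 * (\<delta> * (2 * pi))" if "0 < \<delta>" for \<delta>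
  proof (rule LIMSEQ_le_const)
    have "(\<lambda>n. (real m)\<^sup>2 * (\<delta> * (2 * pi) + X n / \<delta>)) \<longlonglongrightarrow> (real m)\<^sup>2 * (\<delta> * (2 * pi) + 0 / \<delta>)"
      using Xlim that by (intro tendsto_intros) auto
    then show "(\<lambda>n. (real m)\<^sup>2 * (\<delta> * (2 * pi) + X n / \<delta>)) \<longlonglongrightarrow> (real m)\<^sup>2 * (\<delta> * (2 * pi))" by simp
    show "\<exists>N. \<forall>n\<ge>N. cmod (?I - ?J) \<le> (real m)\<^sup>2 * (\<delta> * (2 * pi) + X n / \<delta>)"
      using bound that by blast
  qed
  from this[of "1 / real (Suc n)" for n] have
    *: "\<And>n. cmod (?I - ?J) \<le> (real m)\<^sup>2 * (1 / real (Suc n) * (2 * pi))" by simp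
  have "(\<lambda>n. (real m)\<^sup>2 * (1 / real (Suc n) * (2 * pi))) \<longlonglongrightarrow> (real m)\<^sup>2 * (0 * (2 * pi))"
    using LIMSEQ_inverse_real_of_nat by (intro tendsto_intros) (simp add: inverse_eq_divide)
  then have "cmod (?I - ?J) \<le> (real m)\<^sup>2 * (0 * (2 * pi))"
    by (rule LIMSEQ_le_const) (use * in blast)
  then have "?I = ?J" by simp
  then show ?thesis by (simp add: t_def d_def)
qed

text \<open>The same dyadic Fejer means have two limits: a multiple of \<open>s\<close> because they
  are Cesaro means of convergent partial sums, and 0 because \<open>q\<close> tends to 0 along
  dyadic points.\<close>

lemma series_at_origin_zero:
  assumes qm: "q \<in> borel_measurable lebesgue"
    and L2conv: "(\<lambda>n. norm_L2 (\<lambda>w. (2 * q (2 * w) - trig_sum {-int n..int n} a w) * Sh w)) \<longlonglongrightarrow> 0"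
    and r1: "AE w in lebesgue. (\<lambda>n. r (w / 2 ^ n)) \<longlonglongrightarrow> 1"
    and s: "(\<lambda>n. \<Sum>k=-int n..int n. a k) \<longlonglongrightarrow> s"
  shows "s = 0"
proof -
  define t where "t w = 2 * q (2 * w)" for w
  have "AE w in lebesgue. (\<lambda>n. q ((0 + 2 * w) / 2 ^ n)) \<longlonglongrightarrow> 0"
    by (rule AE_lebesgue_affine[OF AE_q_tendsto_0[OF r1]]) simp
  then have tl: "AE w in lebesgue. (\<lambda>n. t (w / 2 ^ n)) \<longlonglongrightarrow> 0"
  proof eventually_elim
    case (elim w)
    have "(\<lambda>n. 2 * q ((0 + 2 * w) / 2 ^ n)) \<longlonglongrightarrow> 2 * 0"
      by (rule tendsto_mult_left[OF elim])
    then show ?case by (simp add: t_def)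
  qed
  have "(\<lambda>n. (LINT w|circle. t w * of_real ((cmod (dirichlet (2 ^ n) w))\<^sup>2)) / of_nat (2 ^ n)) \<longlonglongrightarrow> 0"
  proof (rule fejer_means_tendsto_0[OF _ _ tl])
    show "t \<in> borel_measurable lebesgue"
      unfolding t_def[abs_def] using borel_measurable_lebesgue_affine[OF qm, of 2 0] by simp
    show "AE w in lebesgue. cmod (t w) \<le> 2 * sqrt (B' / A)" using AE_t_bounded by (simp add: t_def)
  qed
  then have 1: "(\<lambda>n. of_real (2 * pi) * ((\<Sum>l<2 ^ n. \<Sum>k=-int l..int l. a k) / of_nat (2 ^ n))) \<longlonglongrightarrow> 0"
    unfolding t_def integral_fejer_q[OF qm L2conv] by simp
  have "filterlim (\<lambda>n::nat. (2::nat) ^ n) at_top sequentially"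
    by (rule filterlim_subseq) (simp add: strict_mono_def)
  then have "(\<lambda>n. (\<Sum>l<2 ^ n. \<Sum>k=-int l..int l. a k) / of_nat (2 ^ n)) \<longlonglongrightarrow> s"
    using cesaro_means_tendsto[OF s] by (rule filterlim_compose[rotated])
  then have "(\<lambda>n. of_real (2 * pi) * ((\<Sum>l<2 ^ n. \<Sum>k=-int l..int l. a k) / of_nat (2 ^ n))) \<longlonglongrightarrow> of_real (2 * pi) * s"
    by (rule tendsto_mult_left)
  from LIMSEQ_unique[OF this 1] show ?thesis by simp
qed

end

section \<open>The indicator function of the unit interval\<close>

lemma indicator_unit_interval_L2: "(\<lambda>x. indicator {0..1} x :: complex) \<in> L2"
  and supported_indicator_unit_interval: "supported 1 (\<lambda>x. indicator {0..1} x :: complex)"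
proof -
  have "integrable lebesgue (indicator {0..1::real} :: real \<Rightarrow> real)"
    by (rule integrable_real_indicator) (auto simp: emeasure_lborel_Icc_eq)
  moreover have "(cmod (indicator {0..1} x))\<^sup>2 = (indicator {0..1} x :: real)" for x :: real
    by (auto simp: indicator_def)
  moreover have "(\<lambda>x. indicator {0..1::real} x :: complex) \<in> borel_measurable lebesgue"
    by (intro borel_measurable_indicator) auto
  ultimately show "(\<lambda>x. indicator {0..1} x :: complex) \<in> L2" by (simp add: L2_def)
  show "supported 1 (\<lambda>x. indicator {0..1} x :: complex)" by (auto simp: supported_def indicator_def)
qed

text \<open>Away from 0 the transform is \<open>\<i> / w * (cis (- w) - 1)\<close>, so all its zeros
  lie among the countably many multiples of \<open>2 * pi\<close>.\<close>

lemma AE_fourier_integral_unit_interval_nonzero: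
  "AE w in lebesgue. fourier_integral (indicator {0..1}) w \<noteq> 0"
proof -
  have nz: "fourier_integral (indicator {0..1}) w \<noteq> 0" if w: "w \<notin> range (\<lambda>n::int. 2 * pi * of_int n)" for w
  proof -
    have w0: "w \<noteq> 0" using w by (metis mult_zero_right of_int_0 rangeI)
    have "((\<lambda>x. cis (- (w * x))) has_integral (\<i> / w * cis (- (w * 1)) - \<i> / w * cis (- (w * 0)))) {0..1}"
    proof (rule fundamental_theorem_of_calculus)
      fix x :: real
      have "((\<lambda>x. \<i> / w * exp (\<i> * of_real (- (w * x)))) has_vector_derivative
         exp (\<i> * of_real (- (w * x)))) (at x within {0..1})"
        using w0 by (auto intro!: derivative_eq_intros has_vector_derivative_real_field simp: field_simps)
      then show "((\<lambda>x. \<i> / w * cis (- (w * x))) has_vector_derivative cis (- (w * x))) (at x within {0..1})"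
        by (simp add: cis_conv_exp)
    qed simp
    moreover have "integrable (lebesgue_on {0..1}) (\<lambda>x. cis (- (w * x)))"
      by (rule continuous_imp_integrable_real) (intro continuous_intros)
    moreover have "fourier_integral (indicator {0..1}) w = (LINT x|lebesgue_on {0..1}. cis (- (w * x)))"
      unfolding fourier_integral_def
      by (subst integral_restrict_space) (auto intro!: Bochner_Integration.integral_cong simp: indicator_def)
    ultimately have "fourier_integral (indicator {0..1}) w = \<i> / w * (cis (- w) - 1)"
      using lebesgue_integral_eq_integral[of "{0..1}" "\<lambda>x. cis (- (w * x))"]
      by (simp add: integral_unique right_diff_distrib)
    moreover have "cis (- w) \<noteq> 1"
    proof
      assume "cis (- w) = 1"
      then have "cos w = 1" by (simp add: complex_eq_iff)
      then obtain n :: int where "w = of_int n * 2 * pi" unfolding cos_one_2pi_int by blast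
      then show False using w by (auto simp: mult_ac)
    qed
    ultimately show ?thesis using w0 by simp
  qed
  have "countable (range (\<lambda>n::int. 2 * pi * of_int n))" by simp
  then have "AE w in lebesgue. w \<notin> range (\<lambda>n::int. 2 * pi * of_int n)"
    by (intro AE_not_in null_sets_completionI countable_imp_null_set_lborel)
  then show ?thesis by eventually_elim (rule nz)
qed

section \<open>Symbols of interpolating functions\<close>

text \<open>Once the range contains \<open>k\<close> and \<open>m\<close>, the expansion error is a
  finite combination of basis elements, and the lower Riesz bound controls each of its coefficients.
  Applied to the interpolating function itself, this yields its samples.\<close>

lemma expansion_of_basis_element:
  assumes R: "riesz_basis e V" and ex: "L2_expansion e c (e m)"
  shows "c k = (if k = m then 1 else 0)"
proof -
  obtain A where A: "0 < A" "\<And>F c. finite F \<Longrightarrow> A * (\<Sum>k\<in>F. (cmod (c k))\<^sup>2) \<le> (norm_L2 (\<lambda>x. \<Sum>k\<in>F. c k * e k x))\<^sup>2"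
  proof -
    from R obtain A B where "0 < A \<and> A \<le> B \<and> (\<forall>F c. finite F \<longrightarrow>
           A * (\<Sum>k\<in>F. (cmod (c k))\<^sup>2) \<le> (norm_L2 (\<lambda>x. \<Sum>k\<in>F. c k * e k x))\<^sup>2 \<and>
           (norm_L2 (\<lambda>x. \<Sum>k\<in>F. c k * e k x))\<^sup>2 \<le> B * (\<Sum>k\<in>F. (cmod (c k))\<^sup>2))"
      unfolding riesz_basis_def by (elim conjE exE) (rule that, intro conjI)
    then show thesis by (intro that[of A]) simp_all
  qed
  define d where "d j = (if j = m then 1 else 0) - c j" for j
  define u where "u n = norm_L2 (\<lambda>x. e m x - (\<Sum>k = - int n..int n. c k * e k x))" for n
  have u0: "u \<longlonglongrightarrow> 0" using ex by (simp add: L2_expansion_def u_def[abs_def])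
  have le: "A * (cmod (d k))\<^sup>2 \<le> (u n)\<^sup>2" if n: "nat \<bar>k\<bar> + nat \<bar>m\<bar> \<le> n" for n
  proof -
    have in_range: "k \<in> {- int n..int n}" "m \<in> {- int n..int n}" using n by auto
    have "e m x - (\<Sum>k = - int n..int n. c k * e k x) = (\<Sum>k = - int n..int n. d k * e k x)" for x
    proof -
      have "(\<Sum>k = - int n..int n. d k * e k x) = (\<Sum>k = - int n..int n. (if k = m then e k x else 0) - c k * e k x)"
        by (intro sum.cong refl) (auto simp: d_def left_diff_distrib)
      also have "\<dots> = e m x - (\<Sum>k = - int n..int n. c k * e k x)"
        using in_range by (simp add: sum_subtractf)
      finally show ?thesis by simp
    qed
    then have "A * (\<Sum>k = - int n..int n. (cmod (d k))\<^sup>2) \<le> (u n)\<^sup>2"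
      using A(2)[of "{- int n..int n}" d] by (simp add: u_def)
    moreover have "(cmod (d k))\<^sup>2 \<le> (\<Sum>k = - int n..int n. (cmod (d k))\<^sup>2)"
      using in_range by (intro member_le_sum) auto
    then have "A * (cmod (d k))\<^sup>2 \<le> A * (\<Sum>k = - int n..int n. (cmod (d k))\<^sup>2)"
      using A(1) by (intro mult_left_mono) auto
    ultimately show ?thesis by linarith
  qed
  have "(\<lambda>n. (u n)\<^sup>2) \<longlonglongrightarrow> 0\<^sup>2" using u0 by (rule tendsto_power)
  then have "A * (cmod (d k))\<^sup>2 \<le> 0\<^sup>2"
    by (rule LIMSEQ_le_const) (rule exI[of _ "nat \<bar>k\<bar> + nat \<bar>m\<bar>"], use le in blast)
  then have "d k = 0" using A(1) by (simp add: mult_le_0_iff)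
  then show ?thesis by (simp add: d_def split: if_splits)
qed

lemma bi_sums_suminf:
  assumes "bi_summable a" shows "bi_sums a (bi_suminf a)"
  using assms unfolding bi_summable_def bi_sums_def bi_suminf_def by (auto simp: limI)

lemma bi_sums_unique: "bi_sums a s \<Longrightarrow> bi_sums a t \<Longrightarrow> s = t"
  unfolding bi_sums_def by (rule LIMSEQ_unique)

lemma bi_sums_add: "bi_sums a s \<Longrightarrow> bi_sums b t \<Longrightarrow> bi_sums (\<lambda>k. a k + b k) (s + t)"
  unfolding bi_sums_def by (simp add: sum.distrib tendsto_add)

lemma bi_sums_diff: "bi_sums a s \<Longrightarrow> bi_sums b t \<Longrightarrow> bi_sums (\<lambda>k. a k - b k) (s - t)"
  unfolding bi_sums_def by (simp add: sum_subtractf tendsto_diff)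

lemma bi_sums_single: "bi_sums (\<lambda>k. if k = m then c else 0) c"
  unfolding bi_sums_def
proof (rule tendsto_eventually, rule eventually_sequentiallyI)
  fix n assume "nat \<bar>m\<bar> \<le> n"
  then have "m \<in> {- int n..int n}" by auto
  then show "(\<Sum>k = - int n..int n. if k = m then c else 0) = c" by simp
qed

abbreviation "half_samples f \<equiv> \<lambda>k::int. f (of_int k / 2)"

lemma half_poisson_sums:
  assumes "half_poisson f F" "cmod z = 1"
  shows "bi_sums (\<lambda>k. half_samples f k * z powi k) (2 * half_symbol (half_samples f) z)"
proof -
  \<comment> \<open>Every point of the unit circle is \<open>exp (- i w / 2)\<close> for
    \<open>w = - 2 * Arg z\<close>.\<close>
  have "cis (- ((- 2 * Arg z) / 2)) = z" using assms(2) cis_Arg[of z] by (cases "z = 0") (auto simp: sgn_div_norm)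
  moreover have "bi_summable (\<lambda>k. half_samples f k * cis (- ((- 2 * Arg z) / 2)) powi k)"
    by (rule conjunct1[OF assms(1)[unfolded half_poisson_def, rule_format, of "- 2 * Arg z"]])
  ultimately have "bi_summable (\<lambda>k. half_samples f k * z powi k)" by (simp only:)
  then show ?thesis unfolding half_symbol_def by (simp add: bi_sums_suminf)
qed

lemma minus_powi_even_odd:
  fixes z :: complex
  shows "(- z) powi k = (if even k then z powi k else - (z powi k))"
  by (simp add: power_int_minus_left)

text \<open>Adding the series at \<open>z\<close> and \<open>- z\<close> cancels odd indices and
  doubles even ones, which are the samples at integers.\<close>

lemma half_symbol_even_samples:
  assumes F: "half_poisson f F" and f: "\<And>k::int. f (of_int k) = (if k = 0 then 1 else 0)" and z: "cmod z = 1"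
  shows "half_symbol (half_samples f) (- z) + half_symbol (half_samples f) z = 1"
proof -
  let ?H = "half_symbol (half_samples f)"
  have "bi_sums (\<lambda>k. half_samples f k * z powi k + half_samples f k * (- z) powi k) (2 * ?H z + 2 * ?H (- z))"
    using z by (intro bi_sums_add half_poisson_sums[OF F]) auto
  moreover have "half_samples f k * z powi k + half_samples f k * (- z) powi k = (if k = 0 then 2 else 0)" for k :: int
  proof (cases "even k")
    case True
    then obtain l where l: "k = 2 * l" by (rule evenE)
    then have "half_samples f k = (if k = 0 then 1 else 0)" using f[of l] by simp
    then show ?thesis using True by simp
  next
    case False
    then have "k \<noteq> 0" by auto
    then show ?thesis using False by (simp add: minus_powi_even_odd)
  qed
  ultimately have "2 * ?H z + 2 * ?H (- z) = 2"
    using bi_sums_single[of 0 2] bi_sums_unique by auto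
  then show ?thesis by (simp add: add.commute distrib_left[symmetric] del: distrib_left_numeral)
qed

text \<open>Subtraction keeps the odd indices, the samples at \<open>l + 1 / 2\<close>; the only
  nonzero one is at 1/2, that is at index 1, whence the right-hand side \<open>z\<close>.\<close>

lemma half_symbol_odd_samples:
  assumes F: "half_poisson f F" and f: "\<And>k::int. f (of_int k + 1 / 2) = (if k = 0 then 1 else 0)" and z: "cmod z = 1"
  shows "half_symbol (half_samples f) z - half_symbol (half_samples f) (- z) = z"
proof -
  let ?H = "half_symbol (half_samples f)"
  have "bi_sums (\<lambda>k. half_samples f k * z powi k - half_samples f k * (- z) powi k) (2 * ?H z - 2 * ?H (- z))"
    using z by (intro bi_sums_diff half_poisson_sums[OF F]) auto
  moreover have "half_samples f k * z powi k - half_samples f k * (- z) powi k = (if k = 1 then 2 * z else 0)" for k :: int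
  proof (cases "even k")
    case True
    then show ?thesis by auto
  next
    case False
    then obtain l where l: "k = 2 * l + 1" by (rule oddE)
    then have "half_samples f k = (if k = 1 then 1 else 0)" using f[of l] by (simp add: add_divide_distrib)
    then show ?thesis using False by (simp add: minus_powi_even_odd)
  qed
  ultimately have "2 * ?H z - 2 * ?H (- z) = 2 * z"
    using bi_sums_single[of 1 "2 * z"] bi_sums_unique by auto
  then show ?thesis by (simp add: right_diff_distrib[symmetric] del: right_diff_distrib_numeral)
qed

definition half_symbol_at :: "(real \<Rightarrow> complex) \<Rightarrow> real \<Rightarrow> complex" where
  "half_symbol_at f w = half_symbol (half_samples f) (cis (- (w / 2)))"

lemma half_symbol_at_shift: "half_symbol (half_samples f) (- cis (- (w / 2))) = half_symbol_at f (w + 2 * pi)"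
proof -
  have "- ((w + 2 * pi) / 2) = - (w / 2) + - pi" by (simp add: field_simps)
  then have "cis (- ((w + 2 * pi) / 2)) = cis (- (w / 2)) * cis (- pi)" by (simp only: cis_mult)
  also have "cis (- pi) = -1" by (simp add: complex_eq_iff)
  finally have "cis (- ((w + 2 * pi) / 2)) = - cis (- (w / 2))" by simp
  then show ?thesis by (simp add: half_symbol_at_def)
qed

lemma half_symbol_at_periodic: "half_symbol_at f (w + 4 * pi * of_int k) = half_symbol_at f w"
proof -
  have "- ((w + 4 * pi * of_int k) / 2) = - (w / 2) + 2 * pi * of_int (- k)" by (simp add: field_simps)
  then have "cis (- ((w + 4 * pi * of_int k) / 2)) = cis (- (w / 2)) * cis (2 * pi * of_int (- k))"
    by (simp only: cis_mult)
  also have "cis (2 * pi * of_int (- k)) = 1" by (rule cis_multiple_2pi) auto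
  finally show ?thesis by (simp add: half_symbol_at_def)
qed

lemma half_symbol_at_tendsto:
  assumes "half_poisson f F"
  shows "(\<lambda>n. trig_sum {- int n..int n} (half_samples f) (w / 2)) \<longlonglongrightarrow> 2 * half_symbol_at f w"
proof -
  have "trig_sum {- int n..int n} (half_samples f) (w / 2) =
    (\<Sum>k = - int n..int n. half_samples f k * cis (- (w / 2)) powi k)" for n
    unfolding trig_sum_def by (intro sum.cong refl) (simp add: cis_power_int)
  then show ?thesis
    using half_poisson_sums[OF assms, of "cis (- (w / 2))"] by (simp add: bi_sums_def half_symbol_at_def)
qed

lemma half_symbol_at_measurable:
  assumes "half_poisson f F"
  shows "half_symbol_at f \<in> borel_measurable lebesgue"
proof -
  have "(\<lambda>w. trig_sum {- int n..int n} (half_samples f) (w / 2) / 2) \<in> borel_measurable lebesgue" for n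
    unfolding trig_sum_def by (intro borel_measurable_continuous_lebesgue continuous_intros) auto
  moreover have "(\<lambda>n. trig_sum {- int n..int n} (half_samples f) (w / 2) / 2) \<longlonglongrightarrow> half_symbol_at f w" for w
    using tendsto_divide[OF half_symbol_at_tendsto[OF assms, of w] tendsto_const[of 2]] by simp
  ultimately show ?thesis by (rule borel_measurable_LIMSEQ_metric)
qed

text \<open>The transform of \<open>f (x / 2)\<close> is \<open>2 * Fh (2 * w)\<close>, and by
  Plancherel the transformed partial sums converge to it in \<open>L2\<close>. They also converge
  pointwise through the symbol series, so the limits agree almost everywhere. The \<open>L2\<close>
  statement is kept for the argument at the origin.\<close>

lemma two_scale_expansion:
  assumes S: "fourier_pair S Sh" and f: "fourier_pair f Fh" and P: "half_poisson f F"
    and ex: "L2_expansion (\<lambda>k x. S (x - of_int k)) (half_samples f) (\<lambda>x. f (x / 2))"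
  shows "(\<lambda>n. norm_L2 (\<lambda>w. 2 * Fh (2 * w) - trig_sum {- int n..int n} (half_samples f) w * Sh w)) \<longlonglongrightarrow> 0"
    and "AE w in lebesgue. Fh w = half_symbol_at f w * Sh (w / 2)"
proof -
  let ?C = "\<lambda>n. trig_sum {- int n..int n} (half_samples f)"
  let ?u = "\<lambda>n w. 2 * Fh (2 * w) - ?C n w * Sh w"
  have "fourier_pair (\<lambda>x. f (1 / 2 * x)) (\<lambda>w. Fh (w / (1 / 2)) / of_real (1 / 2))"
    by (rule fourier_pair_dilate[OF f]) simp
  then have "fourier_pair (\<lambda>x. f (x / 2)) (\<lambda>w. 2 * Fh (2 * w))" by (simp add: mult.commute)
  then have pairs: "fourier_pair (\<lambda>x. f (x / 2) - shift_comb S {- int n..int n} (half_samples f) x) (?u n)" for n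
    by (intro fourier_pair_diff fourier_pair_shift_comb S)
  have "(\<lambda>n. sqrt (2 * pi) * norm_L2 (\<lambda>x. f (x / 2) - shift_comb S {- int n..int n} (half_samples f) x)) \<longlonglongrightarrow> sqrt (2 * pi) * 0"
    using ex unfolding L2_expansion_def shift_comb_def by (rule tendsto_mult_left)
  then show lim: "(\<lambda>n. norm_L2 (?u n)) \<longlonglongrightarrow> 0" by (simp add: plancherel[OF pairs])
  have "AE w in lebesgue. 2 * Fh (2 * w) - 2 * half_symbol_at f (2 * w) * Sh w = 0"
  proof (rule AE_zero_if_pointwise_limit[OF fourier_pair_L2(2)[OF pairs] lim])
    show "AE w in lebesgue. (\<lambda>n. ?u n w) \<longlonglongrightarrow> 2 * Fh (2 * w) - 2 * half_symbol_at f (2 * w) * Sh w"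
    proof (rule AE_I2)
      fix w
      have "(\<lambda>n. ?C n w) \<longlonglongrightarrow> 2 * half_symbol_at f (2 * w)"
        using half_symbol_at_tendsto[OF P, of "2 * w"] by simp
      then show "(\<lambda>n. ?u n w) \<longlonglongrightarrow> 2 * Fh (2 * w) - 2 * half_symbol_at f (2 * w) * Sh w"
        by (intro tendsto_diff tendsto_const tendsto_mult_right)
    qed
  qed
  from AE_lebesgue_affine[OF this, of "1 / 2" 0]
  show "AE w in lebesgue. Fh w = half_symbol_at f w * Sh (w / 2)" by simp
qed

section \<open>Multiresolution analyses\<close>

lemma mra_dilate:
  assumes V: "\<And>j f. f \<in> V j \<longleftrightarrow> (\<lambda>x. f (2 * x)) \<in> V (j + 1)"
  shows "f \<in> V i \<longleftrightarrow> (\<lambda>x::real. f (2 powi j * x) :: complex) \<in> V (i + j)"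
proof -
  have nat_case: "f \<in> V i \<longleftrightarrow> (\<lambda>x. f (2 ^ n * x)) \<in> V (i + int n)" for f i n
  proof (induction n)
    case (Suc n)
    have "f \<in> V i \<longleftrightarrow> (\<lambda>x. f (2 ^ n * x)) \<in> V (i + int n)" by (rule Suc.IH)
    also have "\<dots> \<longleftrightarrow> (\<lambda>x. f (2 ^ n * (2 * x))) \<in> V (i + int n + 1)" by (rule V)
    also have "(\<lambda>x. f (2 ^ n * (2 * x))) = (\<lambda>x. f (2 ^ Suc n * x))" by (simp add: mult.assoc mult.left_commute)
    also have "i + int n + 1 = i + int (Suc n)" by simp
    finally show ?case .
  qed simp
  show ?thesis
  proof (cases "0 \<le> j")
    case True
    then obtain n where "j = int n" by (rule nonneg_int_cases)
    then show ?thesis using nat_case[of f i n] by simp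
  next
    case False
    then have n: "j = - int (nat (- j))" by simp
    define n where "n = nat (- j)"
    note n = n[folded n_def]
    \<comment> \<open>For negative \<open>j\<close> the natural-number case is applied to the
      dilated function, which dilation by \<open>2 ^ n\<close> turns back into
      \<open>f\<close>.\<close>
    have cancel: "2 powi j * (2 ^ n * x) = x" for x :: real
      by (simp add: n power_int_minus)
    have i: "i + j + int n = i" by (simp add: n)
    have "(\<lambda>x. f (2 powi j * x)) \<in> V (i + j) \<longleftrightarrow> (\<lambda>x. f (2 powi j * (2 ^ n * x))) \<in> V (i + j + int n)"
      by (rule nat_case)
    then show ?thesis unfolding cancel i by blast
  qed
qed

lemma mra_mono:
  assumes "\<And>j::int. V j \<subseteq> V (j + 1)" "i \<le> j" shows "V i \<subseteq> V j"
  using assms(2)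
proof (induction j rule: int_ge_induct)
  case (step j)
  then show ?case using assms(1)[of j] by blast
qed simp

lemma integrable_inner_L2:
  assumes "f \<in> L2" "g \<in> L2" shows "integrable lebesgue (\<lambda>x. f x * cnj (g x))"
proof (rule Bochner_Integration.integrable_bound)
  show "integrable lebesgue (\<lambda>x. (cmod (f x))\<^sup>2 + (cmod (g x))\<^sup>2)"
    using assms by (intro Bochner_Integration.integrable_add L2_integrable)
  show "(\<lambda>x. f x * cnj (g x)) \<in> borel_measurable lebesgue"
  proof (rule borel_measurable_times[OF L2_measurable[OF assms(1)]])
    show "(\<lambda>x. cnj (g x)) \<in> borel_measurable lebesgue"
      by (rule measurable_compose[OF L2_measurable[OF assms(2)]])
         (intro borel_measurable_continuous_onI continuous_intros)
  qed
  show "AE x in lebesgue. norm (f x * cnj (g x)) \<le> norm ((cmod (f x))\<^sup>2 + (cmod (g x))\<^sup>2)"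
  proof (rule AE_I2)
    fix x
    have "0 \<le> (cmod (f x) - cmod (g x))\<^sup>2" "0 \<le> cmod (f x) * cmod (g x)" by simp_all
    moreover have "(cmod (f x) - cmod (g x))\<^sup>2 = (cmod (f x))\<^sup>2 + (cmod (g x))\<^sup>2 - 2 * (cmod (f x) * cmod (g x))"
      by (simp add: power2_eq_square algebra_simps)
    ultimately have "cmod (f x) * cmod (g x) \<le> (cmod (f x))\<^sup>2 + (cmod (g x))\<^sup>2" by linarith
    then show "norm (f x * cnj (g x)) \<le> norm ((cmod (f x))\<^sup>2 + (cmod (g x))\<^sup>2)" by (simp add: norm_mult)
  qed
qed

lemma norm_L2_add_orthogonal:
  assumes L: "f \<in> L2" "g \<in> L2" and o: "inner_L2 f g = 0"
  shows "(norm_L2 (\<lambda>x. f x + \<beta> * g x))\<^sup>2 = (norm_L2 f)\<^sup>2 + (cmod \<beta>)\<^sup>2 * (norm_L2 g)\<^sup>2"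
proof -
  have i: "integrable lebesgue (\<lambda>x. cnj \<beta> * (f x * cnj (g x)))"
    by (intro integrable_mult_right integrable_inner_L2 L)
  have sq: "(cmod (f x + \<beta> * g x))\<^sup>2 = (cmod (f x))\<^sup>2 + (cmod \<beta>)\<^sup>2 * (cmod (g x))\<^sup>2 + 2 * Re (cnj \<beta> * (f x * cnj (g x)))" for x
    using cmod_diff_square[of "f x" "- (\<beta> * g x)"]
    by (simp add: norm_mult power_mult_distrib mult_ac)
  have "(LINT x|lebesgue. Re (cnj \<beta> * (f x * cnj (g x)))) = Re (cnj \<beta> * inner_L2 f g)"
    by (subst integral_Re[OF i]) (simp add: inner_L2_def)
  then have 0: "(LINT x|lebesgue. Re (cnj \<beta> * (f x * cnj (g x)))) = 0" using o by simp
  show ?thesis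
    unfolding norm_L2_power2 sq
    using L2_integrable[OF L(1)] L2_integrable[OF L(2)] integrable_Re[OF i] 0
    by (simp only: Bochner_Integration.integral_add Bochner_Integration.integrable_add integrable_mult_right integral_mult_right_zero)
qed

lemma inner_L2_shift_comb:
  assumes L: "f \<in> L2" "g \<in> L2"
    and o: "\<And>k l. inner_L2 (\<lambda>x. f (x - of_int k)) (\<lambda>x. g (x - of_int l)) = 0"
  shows "inner_L2 (shift_comb f F c) (shift_comb g F' d) = 0"
proof -
  have i: "integrable lebesgue (\<lambda>x. (c k * cnj (d l)) * (f (x - of_int k) * cnj (g (x - of_int l))))" for k l
    by (intro integrable_mult_right integrable_inner_L2 L2_shift L)
  have "shift_comb f F c x * cnj (shift_comb g F' d x) =
    (\<Sum>k\<in>F. \<Sum>l\<in>F'. (c k * cnj (d l)) * (f (x - of_int k) * cnj (g (x - of_int l))))" for x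
    unfolding shift_comb_def cnj_sum sum_product by (intro sum.cong refl) (simp add: mult_ac)
  then have "inner_L2 (shift_comb f F c) (shift_comb g F' d) =
    (\<Sum>k\<in>F. \<Sum>l\<in>F'. (c k * cnj (d l)) * inner_L2 (\<lambda>x. f (x - of_int k)) (\<lambda>x. g (x - of_int l)))"
    unfolding inner_L2_def by (simp only: Bochner_Integration.integral_sum i Bochner_Integration.integrable_sum integral_mult_right_zero)
  then show ?thesis by (simp add: o)
qed

text \<open>By Pythagoras both squared norms have the same two terms, because
  \<open>\<alpha>\<close> and \<open>- \<alpha>\<close> have equal modulus.\<close>

lemma norm_L2_shift_comb_orthogonal:
  assumes L: "f \<in> L2" "g \<in> L2"
    and o: "\<And>k l. inner_L2 (\<lambda>x. f (x - of_int k)) (\<lambda>x. g (x - of_int l)) = 0"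
  shows "norm_L2 (shift_comb (\<lambda>x. f x + \<alpha> * g x) F c) = norm_L2 (shift_comb (\<lambda>x. f x - \<alpha> * g x) F c)"
proof -
  have eq: "shift_comb (\<lambda>x. f x + \<beta> * g x) F c = (\<lambda>x. shift_comb f F c x + \<beta> * shift_comb g F c x)" for \<beta>
    by (rule ext) (simp add: shift_comb_def sum_distrib_left sum.distrib distrib_left mult_ac)
  have "(norm_L2 (shift_comb (\<lambda>x. f x + \<beta> * g x) F c))\<^sup>2 =
    (norm_L2 (shift_comb f F c))\<^sup>2 + (cmod \<beta>)\<^sup>2 * (norm_L2 (shift_comb g F c))\<^sup>2" for \<beta>
    unfolding eq by (intro norm_L2_add_orthogonal shift_comb_L2 L inner_L2_shift_comb o)
  from this[of \<alpha>] this[of "- \<alpha>"]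
  have "(norm_L2 (shift_comb (\<lambda>x. f x + \<alpha> * g x) F c))\<^sup>2 = (norm_L2 (shift_comb (\<lambda>x. f x - \<alpha> * g x) F c))\<^sup>2"
    by simp
  then show ?thesis by (rule power2_eq_imp_eq) auto
qed

text \<open>A set of full measure meets every nonempty open interval. This carries almost everywhere
  statements to points of continuity.\<close>

lemma AE_imp_sequence:
  fixes w :: real
  assumes "AE x in lebesgue. P x"
  obtains x where "\<And>n::nat. P (x n)" "x \<longlonglongrightarrow> w"
proof -
  have "\<exists>x. P x \<and> \<bar>x - w\<bar> < 1 / real (Suc n)" for n
  proof (rule ccontr)
    assume no: "\<not> ?thesis"
    have "AE x in lebesgue. x \<notin> {w<..<w + 1 / real (Suc n)}"
      using assms by eventually_elim (use no in auto)
    then have "{w<..<w + 1 / real (Suc n)} \<in> null_sets lebesgue"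
      by (subst AE_iff_null_sets) auto
    then have "emeasure lborel {w<..<w + 1 / real (Suc n)} = 0" by (auto dest: null_setsD1)
    then show False by (subst (asm) emeasure_lborel_Ioo) auto
  qed
  then obtain x where x: "\<And>n. P (x n)" "\<And>n. \<bar>x n - w\<bar> < 1 / real (Suc n)" by metis
  have "(\<lambda>n. x n - w) \<longlonglongrightarrow> 0"
  proof (rule Lim_null_comparison)
    show "eventually (\<lambda>n. norm (x n - w) \<le> 1 / real (Suc n)) sequentially"
      using x(2) by (auto intro!: always_eventually less_imp_le)
    show "(\<lambda>n. 1 / real (Suc n)) \<longlonglongrightarrow> 0"
      using LIMSEQ_inverse_real_of_nat by (simp add: inverse_eq_divide)
  qed
  then have "x \<longlonglongrightarrow> w" by (simp add: LIM_zero_iff)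
  with x(1) show thesis by (rule that)
qed

lemma norm_L2_cong_AE:
  assumes "f \<in> L2" "g \<in> L2" "AE x in lebesgue. f x = g x"
  shows "norm_L2 f = norm_L2 g"
  unfolding norm_L2_def
  using assms
  by (intro arg_cong[of _ _ sqrt] integral_cong_AE) (auto simp: L2_def elim: eventually_mono)

text \<open>
  The approximants of an \<open>L\<^sup>2\<close> function lie in every \<open>V n\<close> with \<open>n\<close> large, and rescaling by
  \<open>2\<^sup>n\<close> moves them to \<open>V 0\<close>, where integer translates of \<open>S\<close> are complete.
\<close>

lemma mra_translates_dense:
  assumes mono: "\<And>j::int. V j \<subseteq> V (j + 1)"
    and dil: "\<And>j f. f \<in> V j \<longleftrightarrow> (\<lambda>x. f (2 * x)) \<in> V (j + 1)"
    and dense: "\<And>g e. g \<in> L2 \<Longrightarrow> 0 < e \<Longrightarrow> \<exists>j. \<exists>f\<in>V j. norm_L2 (\<lambda>x. g x - f x) < e"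
    and sub: "\<And>j. V j \<subseteq> L2"
    and basis: "riesz_basis (\<lambda>k x. S (x - of_int k)) (V 0)"
    and g: "g \<in> L2" and e: "0 < e"
  shows "\<exists>N. \<forall>n\<ge>N. \<exists>F c. norm_L2 (\<lambda>x. g x - shift_comb S F c (2 ^ n * x)) < e"
proof -
  have "0 < e / 2" using e by simp
  from dense[OF g this] obtain j f where f: "f \<in> V j" "norm_L2 (\<lambda>x. g x - f x) < e / 2" by blast
  show ?thesis
  proof (rule exI[of _ "nat j"], intro allI impI)
    fix n assume n: "nat j \<le> n"
    have "V j \<subseteq> V (int n)" by (rule mra_mono[of V, OF mono]) (use n in linarith)
    then have fn: "f \<in> V (int n)" using f by blast
    define h where "h x = f (x / 2 ^ n)" for x
    have "h \<in> V 0 \<longleftrightarrow> (\<lambda>x. h (2 powi (int n) * x)) \<in> V (0 + int n)"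
      by (rule mra_dilate[of V, OF dil])
    then have h: "h \<in> V 0" using fn by (simp add: h_def)
    \<comment> \<open>Dilation by \<open>2 ^ n\<close> divides the norm by
      \<open>sqrt (2 ^ n)\<close>, so this accuracy in \<open>V 0\<close> becomes
      \<open>e / 2\<close> at scale \<open>n\<close>.\<close>
    have e': "0 < e / 2 * sqrt (2 ^ n)" using e by simp
    have "\<forall>f\<in>V 0. \<forall>\<epsilon>>0. \<exists>F c. finite F \<and> norm_L2 (\<lambda>x. f x - (\<Sum>k\<in>F. c k * S (x - of_int k))) < \<epsilon>"
      using basis unfolding riesz_basis_def by (elim conjE)
    from this[rule_format, OF h e'] obtain F c where
      F: "norm_L2 (\<lambda>x. h x - shift_comb S F c x) < e / 2 * sqrt (2 ^ n)"
      unfolding shift_comb_def by blast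
    have "norm_L2 (\<lambda>x. h x - shift_comb S F c x) = sqrt (2 ^ n) * norm_L2 (\<lambda>x. f x - shift_comb S F c (2 ^ n * x))"
      using norm_L2_affine[of "2 ^ n" "\<lambda>x. h x - shift_comb S F c x" 0] by (simp add: h_def)
    then have "sqrt (2 ^ n) * norm_L2 (\<lambda>x. f x - shift_comb S F c (2 ^ n * x)) < sqrt (2 ^ n) * (e / 2)"
      using F by (simp only: mult.commute)
    then have fF: "norm_L2 (\<lambda>x. f x - shift_comb S F c (2 ^ n * x)) < e / 2"
      by (subst (asm) mult_less_cancel_left_pos) simp_all
    have SL: "S \<in> L2"
    proof -
      have "\<forall>k. (\<lambda>x. S (x - of_int k)) \<in> V 0" using basis unfolding riesz_basis_def by (elim conjE)
      from spec[OF this, of 0] show ?thesis using sub by auto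
    qed
    have L: "f \<in> L2" "(\<lambda>x. shift_comb S F c (2 ^ n * x)) \<in> L2"
      using f sub L2_affine[OF shift_comb_L2[OF SL], of "2 ^ n" F c 0] by auto
    have "norm_L2 (\<lambda>x. (g x - f x) + (f x - shift_comb S F c (2 ^ n * x))) < e"
      using norm_L2_triangle[OF L2_diff[OF g L(1)] L2_diff[OF L]] f(2) fF by linarith
    then show "\<exists>F c. norm_L2 (\<lambda>x. g x - shift_comb S F c (2 ^ n * x)) < e" by auto
  qed
qed

text \<open>The clause on \<open>isCont\<close> keeps the null set honest: it contains no common
  continuity point of the functions involved, so it is empty when the symbols are continuous.
  \<open>E (w + 2 * pi)\<close> stands for the value of the energy symbol at
  \<open>- z\<close>.\<close>

theorem theorem2:
  fixes V :: "int \<Rightarrow> (real \<Rightarrow> complex) set"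
    and \<phi> :: "real \<Rightarrow> real"
    and S\<phi> S\<psi> :: "real \<Rightarrow> complex"
    and \<phi>_hat S\<phi>_hat S\<psi>_hat :: "real \<Rightarrow> complex"
    and q :: "int \<Rightarrow> complex"
    and j :: int
    and P Q :: "complex \<Rightarrow> complex"
    and E :: "real \<Rightarrow> real"
  assumes mra: "multiresolution_analysis V \<phi>"
    and fourier_\<phi>: "fourier_transform (\<lambda>x. complex_of_real (\<phi> x)) \<phi>_hat"
    and poisson_\<phi>: "half_poisson (\<lambda>x. complex_of_real (\<phi> x)) \<phi>_hat"
    and basis_V: "interpolation_basis (\<lambda>k x. S\<phi> (x - of_int k)) (\<lambda>k. of_int k) (V 0)"
    and fourier_S\<phi>: "fourier_transform S\<phi> S\<phi>_hat"
    and poisson_S\<phi>: "half_poisson S\<phi> S\<phi>_hat"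
    and basis_W: "interpolation_basis (\<lambda>k x. S\<psi> (2 powi j * x - of_int k))
                    (\<lambda>k. 1 / 2 powi (j + 1) + of_int k / 2 powi j) (wavelet_space V j)"
    and fourier_S\<psi>: "fourier_transform S\<psi> S\<psi>_hat"
    and two_scale_S\<psi>: "L2_expansion (\<lambda>k x. complex_of_real (\<phi> (2 * x - of_int k))) q S\<psi>"
    and symbol_S\<psi>: "\<forall>z. cmod z = 1 \<longrightarrow> bi_summable (\<lambda>k. q k * z powi k)"
    and poisson_S\<psi>: "half_poisson S\<psi> S\<psi>_hat"
    and P_eq: "P = half_symbol (\<lambda>k. S\<phi> (of_int k / 2))"
    and Q_eq: "Q = half_symbol (\<lambda>k. S\<psi> (of_int k / 2))"
    and E_eq: "E = energy_symbol S\<phi>_hat"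
  shows "(\<forall>z. cmod z = 1 \<longrightarrow> P (- z) + P z = 1 \<and> Q z / z - Q (- z) / z = 1) \<and>
         Q (- 1) = - 1 \<and>
         (\<exists>A B N. 0 < A \<and> A \<le> B \<and>
            N \<in> null_sets lebesgue \<and>
            (\<forall>w\<in>N. \<not> (isCont E w \<and> isCont E (w + 2 * pi) \<and>
                       isCont (\<lambda>v. P (cis (- (v / 2)))) w \<and>
                       isCont (\<lambda>v. P (cis (- (v / 2)))) (w + 2 * pi) \<and>
                       isCont (\<lambda>v. Q (cis (- (v / 2)))) w)) \<and>
            (\<forall>w. w \<notin> N \<longrightarrow> (let z = cis (- (w / 2));
                                  D = cnj (P (- z)) * E (w + 2 * pi) + cnj (P z) * E w
                              in A \<le> (cmod D)\<^sup>2 \<and> (cmod D)\<^sup>2 \<le> B \<and>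
                                 Q z = z * E (w + 2 * pi) * cnj (P (- z)) / D)))"
proof -

  \<comment> \<open>Level-zero data and samples of the two interpolating functions\<close>
  have "\<forall>j. rkhs_L2 (V j)" and "\<forall>j. V j \<subseteq> V (j + 1)"
    and "\<forall>j f. f \<in> V j \<longleftrightarrow> (\<lambda>x. f (2 * x)) \<in> V (j + 1)"
    and "\<forall>g\<in>L2. \<forall>\<epsilon>>0. \<exists>j. \<exists>f\<in>V j. norm_L2 (\<lambda>x. g x - f x) < \<epsilon>"
    using mra unfolding multiresolution_analysis_def by - (elim conjE, assumption)+
  note mra_parts = this
  have rkhs: "rkhs_L2 (V i)" for i by (rule spec[OF mra_parts(1)])
  have mono: "V i \<subseteq> V (i + 1)" for i by (rule spec[OF mra_parts(2)])
  have dil: "f \<in> V i \<longleftrightarrow> (\<lambda>x. f (2 * x)) \<in> V (i + 1)" for i f by (rule mra_parts(3)[rule_format])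
  have dense: "\<exists>j. \<exists>f\<in>V j. norm_L2 (\<lambda>x. g x - f x) < e" if "g \<in> L2" "0 < e" for g e
    by (rule mra_parts(4)[rule_format, OF that])
  have sub: "V i \<subseteq> L2" for i using rkhs[of i] by (simp add: rkhs_L2_def)
  have rV: "riesz_basis (\<lambda>k x. S\<phi> (x - of_int k)) (V 0)"
    and exV: "\<And>f. f \<in> V 0 \<Longrightarrow> L2_expansion (\<lambda>k x. S\<phi> (x - of_int k)) (\<lambda>k. f (of_int k)) f"
    using basis_V by (auto simp: interpolation_basis_def)
  \<comment> \<open>The dilation factor by which every statement about level \<open>j\<close> is
    brought back to level 0.\<close>
  define a where "a = (2::real) powi j"
  have a: "0 < a" "a \<noteq> 0" by (simp_all add: a_def)
  have rW: "riesz_basis (\<lambda>k x. S\<psi> (a * x - of_int k)) (wavelet_space V j)"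
    and exW: "\<And>f. f \<in> wavelet_space V j \<Longrightarrow>
      L2_expansion (\<lambda>k x. S\<psi> (a * x - of_int k)) (\<lambda>k. f (1 / 2 powi (j + 1) + of_int k / a)) f"
    using basis_W by (auto simp: interpolation_basis_def a_def)
  have SkV: "(\<lambda>x. S\<phi> (x - of_int k)) \<in> V 0" for k using rV by (simp add: riesz_basis_def)
  have SkW: "(\<lambda>x. S\<psi> (a * x - of_int k)) \<in> wavelet_space V j" for k using rW by (simp add: riesz_basis_def)
  have SV: "S\<phi> \<in> V 0" using SkV[of 0] by simp
  have S_L2: "S\<phi> \<in> L2" using SV sub by blast
  have "(\<lambda>x. S\<psi> (a * x)) \<in> V (1 + j)" using SkW[of 0] by (simp add: wavelet_space_def add.commute)
  then have WV: "S\<psi> \<in> V 1" using mra_dilate[of V S\<psi> 1 j, OF dil] by (simp add: a_def)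
  have W_L2: "S\<psi> \<in> L2" using WV sub by blast

  \<comment> \<open>The interpolation formula for a basis element expands it in its own basis, so
    the samples are forced to be 1 and 0.\<close>
  have S_int: "S\<phi> (of_int k) = (if k = 0 then 1 else 0)" for k
  proof (rule expansion_of_basis_element[OF rV, of "\<lambda>k. S\<phi> (of_int k)"])
    show "L2_expansion (\<lambda>k x. S\<phi> (x - of_int k)) (\<lambda>k. S\<phi> (of_int k)) (\<lambda>x. S\<phi> (x - of_int 0))"
      using exV[OF SV] by simp
  qed
  have W_int: "S\<psi> (of_int k + 1 / 2) = (if k = 0 then 1 else 0)" for k
  proof (rule expansion_of_basis_element[OF rW, of "\<lambda>k. S\<psi> (of_int k + 1 / 2)"])
    have "a * (1 / 2 powi (j + 1) + of_int k / a) = of_int k + 1 / 2" for k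
      using a by (simp add: a_def power_int_add field_simps)
    then show "L2_expansion (\<lambda>k x. S\<psi> (a * x - of_int k)) (\<lambda>k. S\<psi> (of_int k + 1 / 2)) (\<lambda>x. S\<psi> (a * x - of_int 0))"
      using exW[OF SkW[of 0]] by simp
  qed

  \<comment> \<open>The symbol identities on the unit circle\<close>
  have P_sum: "P (- z) + P z = 1" if "cmod z = 1" for z
    unfolding P_eq by (rule half_symbol_even_samples[OF poisson_S\<phi> S_int that])
  have Q_diff: "Q z - Q (- z) = z" if "cmod z = 1" for z
    unfolding Q_eq by (rule half_symbol_odd_samples[OF poisson_S\<psi> W_int that])
  have symbols: "P z + P (- z) = 1 \<and> Q z / z - Q (- z) / z = 1" if z: "cmod z = 1" for z
  proof -
    have "z \<noteq> 0" using z by auto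
    then have "Q z / z - Q (- z) / z = 1" using Q_diff[OF z] by (simp add: diff_divide_distrib[symmetric])
    then show ?thesis using P_sum[OF z] by (simp add: add.commute)
  qed

  define p where "p = half_symbol_at S\<phi>"
  define q' where "q' = half_symbol_at S\<psi>"
  have pP: "p w = P (cis (- (w / 2)))" and qQ: "q' w = Q (cis (- (w / 2)))"
    and pP': "p (w + 2 * pi) = P (- cis (- (w / 2)))" and qQ': "q' (w + 2 * pi) = Q (- cis (- (w / 2)))" for w
    by (simp_all add: p_def q'_def P_eq Q_eq half_symbol_at_def[symmetric] half_symbol_at_shift)

  \<comment> \<open>Two-scale relations, Riesz bounds and orthogonality\<close>
  note pair_S = fourier_transform_imp_pair[OF fourier_S\<phi>]
  note pair_W = fourier_transform_imp_pair[OF fourier_S\<psi>]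
  \<comment> \<open>The integer samples of \<open>f (x / 2)\<close> are the half-integer samples of
    \<open>f\<close>; the interpolation formula in \<open>V 0\<close> thus supplies the two-scale
    coefficients.\<close>
  have half_V: "(\<lambda>x. f (x / 2)) \<in> V 0" if "f \<in> V 1" for f
    using dil[of "\<lambda>x. f (x / 2)" 0] that by simp
  have S_half: "L2_expansion (\<lambda>k x. S\<phi> (x - of_int k)) (half_samples S\<phi>) (\<lambda>x. S\<phi> (x / 2))"
    using exV[OF half_V] SV mono[of 0] by auto
  have W_half: "L2_expansion (\<lambda>k x. S\<phi> (x - of_int k)) (half_samples S\<psi>) (\<lambda>x. S\<psi> (x / 2))"
    using exV[OF half_V[OF WV]] by simp
  note two_S = two_scale_expansion[OF pair_S pair_S poisson_S\<phi> S_half]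
  note two_W = two_scale_expansion[OF pair_S pair_W poisson_S\<psi> W_half]

  obtain A B where AB: "0 < A" "\<And>F c. finite F \<Longrightarrow> A * (\<Sum>k\<in>F. (cmod (c k))\<^sup>2) \<le> (norm_L2 (shift_comb S\<phi> F c))\<^sup>2 \<and>
      (norm_L2 (shift_comb S\<phi> F c))\<^sup>2 \<le> B * (\<Sum>k\<in>F. (cmod (c k))\<^sup>2)"
    using rV unfolding riesz_basis_def shift_comb_def[abs_def] by (elim conjE exE) blast
  obtain B0 where B0: "\<And>F c. finite F \<Longrightarrow>
      (norm_L2 (\<lambda>x. \<Sum>k\<in>F. c k * S\<psi> (a * x - of_int k)))\<^sup>2 \<le> B0 * (\<Sum>k\<in>F. (cmod (c k))\<^sup>2)"
    using rW unfolding riesz_basis_def by (elim conjE exE) blast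
  \<comment> \<open>The factor \<open>a\<close> is the Jacobian of passing from level
    \<open>j\<close> to level 0.\<close>
  have W_upper: "(norm_L2 (shift_comb S\<psi> F c))\<^sup>2 \<le> (a * B0) * (\<Sum>k\<in>F. (cmod (c k))\<^sup>2)" if F: "finite F" for F c
  proof -
    have "(norm_L2 (shift_comb S\<psi> F c))\<^sup>2 = a * (norm_L2 (\<lambda>x. \<Sum>k\<in>F. c k * S\<psi> (a * x - of_int k)))\<^sup>2"
      using norm_L2_affine[OF a(2), of "shift_comb S\<psi> F c" 0] a(1)
      by (simp add: shift_comb_def power_mult_distrib)
    then show ?thesis using mult_left_mono[OF B0[OF F, of c], of a] a(1) by (simp add: mult.assoc)
  qed
  have inner0: "inner_L2 (\<lambda>x. S\<psi> (x - of_int k)) (\<lambda>x. S\<phi> (x - of_int l)) = 0" for k l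
  proof -
    have "(\<lambda>x. S\<phi> (a * x - of_int l)) \<in> V j"
      using mra_dilate[of V "\<lambda>x. S\<phi> (x - of_int l)" 0 j, OF dil] SkV[of l] by (simp add: a_def)
    then have "inner_L2 (\<lambda>x. S\<psi> (a * x - of_int k)) (\<lambda>x. S\<phi> (a * x - of_int l)) = 0"
      using SkW[of k] by (simp add: wavelet_space_def)
    then show ?thesis
      using lebesgue_integral_real_affine[OF a(2), of "\<lambda>x. S\<psi> (x - of_int k) * cnj (S\<phi> (x - of_int l))" 0]
      by (simp add: inner_L2_def)
  qed

  interpret wavelet_symbol S\<phi> S\<phi>_hat p A B S\<psi> S\<psi>_hat q' "a * B0"
  proof unfold_locales
    show "p w + p (w + 2 * pi) = 1" for w
      using P_sum[of "cis (- (w / 2))"] unfolding pP' unfolding pP by (simp add: add.commute)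
    show "q' w - q' (w + 2 * pi) = cis (- (w / 2))" for w
      using Q_diff[of "cis (- (w / 2))"] unfolding qQ' unfolding qQ by simp
    show "AE w in lebesgue. S\<phi>_hat w = p w * S\<phi>_hat (w / 2)" using two_S(2) by (simp add: p_def)
    show "AE w in lebesgue. S\<psi>_hat w = q' w * S\<phi>_hat (w / 2)" using two_W(2) by (simp add: q'_def)
    show "norm_L2 (shift_comb (\<lambda>x. S\<psi> x + \<alpha> * S\<phi> x) F c) = norm_L2 (shift_comb (\<lambda>x. S\<psi> x - \<alpha> * S\<phi> x) F c)" for F c \<alpha>
      by (rule norm_L2_shift_comb_orthogonal[OF W_L2 S_L2 inner0])
  qed (use AB W_upper pair_S pair_W in \<open>auto simp: p_def q'_def half_symbol_at_periodic\<close>)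

  \<comment> \<open>The value at -1\<close>
  have "Q 1 = 0"
  proof -
    have qm: "q' \<in> borel_measurable lebesgue" unfolding q'_def by (rule half_symbol_at_measurable[OF poisson_S\<psi>])
    let ?C = "\<lambda>n. trig_sum {- int n..int n} (half_samples S\<psi>)"
    have "AE w in lebesgue. S\<psi>_hat (0 + 2 * w) = q' (0 + 2 * w) * S\<phi>_hat ((0 + 2 * w) / 2)"
      by (rule AE_lebesgue_affine[OF two_scale_W]) simp
    then have ae: "AE w in lebesgue. 2 * S\<psi>_hat (2 * w) - ?C n w * S\<phi>_hat w = (2 * q' (2 * w) - ?C n w) * S\<phi>_hat w" for n
      by eventually_elim (simp add: algebra_simps)
    \<comment> \<open>The expansion controls the transform of the wavelet, while the argument at the
      origin speaks of its symbol; by the two-scale relation the integrands agree almost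
      everywhere.\<close>
    have eq: "norm_L2 (\<lambda>w. (2 * q' (2 * w) - ?C n w) * S\<phi>_hat w) = norm_L2 (\<lambda>w. 2 * S\<psi>_hat (2 * w) - ?C n w * S\<phi>_hat w)" for n
    proof -
      have L: "(\<lambda>w. 2 * S\<psi>_hat (2 * w) - ?C n w * S\<phi>_hat w) \<in> L2"
        using L2_cmult[OF L2_affine[OF fourier_pair_L2(2)[OF pair_W], of 2 0], of 2]
          fourier_pair_L2(2)[OF fourier_pair_shift_comb[OF pair_S]]
        by (intro L2_diff) auto
      have m: "(\<lambda>w. (2 * q' (2 * w) - ?C n w) * S\<phi>_hat w) \<in> borel_measurable lebesgue"
        using borel_measurable_lebesgue_affine[OF qm, of 2 0]
          borel_measurable_trig_poly[OF trig_poly_trig_sum[of "{- int n..int n}" "half_samples S\<psi>"]] Sh_measurable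
        by (intro borel_measurable_times borel_measurable_diff) auto
      have "energy (\<lambda>w. (2 * q' (2 * w) - ?C n w) * S\<phi>_hat w) = energy (\<lambda>w. 2 * S\<psi>_hat (2 * w) - ?C n w * S\<phi>_hat w)"
        unfolding energy_def by (rule nn_integral_cong_AE) (use ae[of n] in eventually_elim, simp)
      then have "(\<lambda>w. (2 * q' (2 * w) - ?C n w) * S\<phi>_hat w) \<in> L2"
        using L m by (simp add: L2_iff_energy)
      then show ?thesis by (rule norm_L2_cong_AE[OF _ L]) (use ae[of n] in eventually_elim, simp)
    qed
    have L2conv: "(\<lambda>n. norm_L2 (\<lambda>w. (2 * q' (2 * w) - ?C n w) * S\<phi>_hat w)) \<longlonglongrightarrow> 0"
      unfolding eq by (rule two_W(1))
    have r1: "AE w in lebesgue. (\<lambda>n. r (w / 2 ^ n)) \<longlonglongrightarrow> 1"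
    proof (rule AE_r_tendsto_1)
      show "fourier_pair (indicator {0..1}) (fourier_integral (indicator {0..1}))"
        using fourier_pair_supported[OF indicator_unit_interval_L2 supported_indicator_unit_interval] .
      show "\<exists>N. \<forall>n\<ge>N. \<exists>F c. norm_L2 (\<lambda>x. indicator {0..1} x - shift_comb S\<phi> F c (2 ^ n * x)) < e" if "0 < e" for e
        by (rule mra_translates_dense[OF mono dil dense sub rV indicator_unit_interval_L2 that])
    qed (rule AE_fourier_integral_unit_interval_nonzero)
    have "(\<lambda>n. \<Sum>k = - int n..int n. half_samples S\<psi> k) \<longlonglongrightarrow> 2 * Q 1"
      using half_poisson_sums[OF poisson_S\<psi>, of 1] by (simp add: bi_sums_def Q_eq)
    from series_at_origin_zero[OF qm L2conv r1 this] show ?thesis by simp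
  qed
  then have Q_minus_1: "Q (- 1) = - 1" using Q_diff[of 1] by (simp add: minus_equation_iff)

  \<comment> \<open>The formula for \<open>Q\<close> and its exceptional set\<close>
  obtain K L where K: "0 < K" "K \<le> L"
    and ae: "AE w in lebesgue. K \<le> (cmod (D w))\<^sup>2 \<and> (cmod (D w))\<^sup>2 \<le> L \<and>
       q' w * D w = cis (- (w / 2)) * of_real (G (w / 2 + pi)) * cnj (p (w + 2 * pi))"
    by (rule AE_wavelet_formula)
  \<comment> \<open>The denominator in terms of \<open>E\<close> is defined by the statement at
    every point; it agrees with \<open>D\<close>, built from \<open>G\<close>, wherever the brackets
    are finite.\<close>
  define D' where "D' w = cnj (P (- cis (- (w / 2)))) * E (w + 2 * pi) + cnj (P (cis (- (w / 2)))) * E w" for w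
  define ok where "ok w \<longleftrightarrow> K \<le> (cmod (D' w))\<^sup>2 \<and> (cmod (D' w))\<^sup>2 \<le> L \<and>
     Q (cis (- (w / 2))) = cis (- (w / 2)) * E (w + 2 * pi) * cnj (P (- cis (- (w / 2)))) / D' w" for w
  have ok: "AE w in lebesgue. ok w"
    using ae AE_good_half
  proof eventually_elim
    case (elim w)
    have "E w = G (w / 2)"
      unfolding E_eq G_def by (rule energy_symbol_eq_bracket) (use elim in \<open>simp add: good_def\<close>)
    have half: "(w + 2 * pi) / 2 = w / 2 + pi" by simp
    have "E (w + 2 * pi) = G (w / 2 + pi)"
      unfolding E_eq G_def
      by (rule energy_symbol_eq_bracket[of S\<phi>_hat "w + 2 * pi", unfolded half]) (use elim in \<open>simp add: good_def\<close>)
    with \<open>E w = G (w / 2)\<close> have D': "D' w = D w"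
      unfolding D'_def D_def pP'[symmetric] pP[symmetric] by simp
    have "D w \<noteq> 0" using elim K by auto
    then have "q' w = cis (- (w / 2)) * of_real (G (w / 2 + pi)) * cnj (p (w + 2 * pi)) / D w"
      using elim by (simp add: eq_divide_eq)
    then show ?case
      using elim \<open>E (w + 2 * pi) = G (w / 2 + pi)\<close> unfolding ok_def D' by (simp add: pP' qQ)
  qed
  \<comment> \<open>The exact failure set is taken, not a larger null set, so that continuity points
    can be shown to lie outside it.\<close>
  define N where "N = {w. \<not> ok w}"
  have N: "N \<in> null_sets lebesgue"
  proof -
    obtain N0 where "N0 \<in> null_sets lebesgue" "{w \<in> space lebesgue. \<not> ok w} \<subseteq> N0"
      using ok unfolding eventually_ae_filter by blast
    then show ?thesis
      unfolding N_def negligible_iff_null_sets[symmetric] by (auto intro: negligible_subset)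
  qed
  \<comment> \<open>Points where everything holds accumulate at \<open>w\<close>, and all conditions
    are closed: the lower bound \<open>K\<close> survives the limit and keeps the denominator away
    from 0.\<close>
  have cont: "ok w" if c: "isCont E w" "isCont E (w + 2 * pi)" "isCont (\<lambda>v. P (cis (- (v / 2)))) w"
     "isCont (\<lambda>v. P (cis (- (v / 2)))) (w + 2 * pi)" "isCont (\<lambda>v. Q (cis (- (v / 2)))) w" for w
  proof -
    obtain x where x: "\<And>n::nat. ok (x n)" "x \<longlonglongrightarrow> w" using AE_imp_sequence[OF ok] by blast
    have x': "(\<lambda>n. x n + 2 * pi) \<longlonglongrightarrow> w + 2 * pi" by (intro tendsto_intros x)
    have 1: "(\<lambda>n. E (x n)) \<longlonglongrightarrow> E w" by (rule isCont_tendsto_compose[OF c(1) x(2)])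
    have 2: "(\<lambda>n. E (x n + 2 * pi)) \<longlonglongrightarrow> E (w + 2 * pi)" by (rule isCont_tendsto_compose[OF c(2) x'])
    have 3: "(\<lambda>n. p (x n)) \<longlonglongrightarrow> p w" unfolding pP by (rule isCont_tendsto_compose[OF c(3) x(2)])
    have 4: "(\<lambda>n. p (x n + 2 * pi)) \<longlonglongrightarrow> p (w + 2 * pi)" unfolding pP by (rule isCont_tendsto_compose[OF c(4) x'])
    have 5: "(\<lambda>n. q' (x n)) \<longlonglongrightarrow> q' w" unfolding qQ by (rule isCont_tendsto_compose[OF c(5) x(2)])
    have D'p: "D' w = cnj (p (w + 2 * pi)) * E (w + 2 * pi) + cnj (p w) * E w" for w
      unfolding D'_def pP'[symmetric] pP[symmetric] ..
    have D: "(\<lambda>n. D' (x n)) \<longlonglongrightarrow> D' w"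
      unfolding D'p by (intro tendsto_intros tendsto_cnj 1 2 3 4)
    have D2: "(\<lambda>n. (cmod (D' (x n)))\<^sup>2) \<longlonglongrightarrow> (cmod (D' w))\<^sup>2" by (intro tendsto_intros D)
    have b1: "K \<le> (cmod (D' w))\<^sup>2"
      by (rule LIMSEQ_le_const[OF D2]) (use x(1) in \<open>auto simp: ok_def\<close>)
    have b2: "(cmod (D' w))\<^sup>2 \<le> L"
      by (rule LIMSEQ_le_const2[OF D2]) (use x(1) in \<open>auto simp: ok_def\<close>)
    have nz: "D' w \<noteq> 0" using b1 K by auto
    have "(\<lambda>n. cis (- (x n / 2)) * E (x n + 2 * pi) * cnj (p (x n + 2 * pi)) / D' (x n)) \<longlonglongrightarrow>
       cis (- (w / 2)) * E (w + 2 * pi) * cnj (p (w + 2 * pi)) / D' w"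
      by (intro tendsto_intros tendsto_cnj 2 4 D nz x(2)) auto
    moreover have "q' (x n) = cis (- (x n / 2)) * E (x n + 2 * pi) * cnj (p (x n + 2 * pi)) / D' (x n)" for n
      using x(1)[of n] by (simp add: ok_def qQ pP')
    ultimately have "q' w = cis (- (w / 2)) * E (w + 2 * pi) * cnj (p (w + 2 * pi)) / D' w"
      using 5 LIMSEQ_unique by simp
    then show ?thesis using b1 b2 unfolding ok_def by (simp add: qQ pP')
  qed
  show ?thesis
  proof (intro conjI)
    show "\<forall>z. cmod z = 1 \<longrightarrow> P (- z) + P z = 1 \<and> Q z / z - Q (- z) / z = 1"
      using symbols by (simp add: add.commute)
    show "Q (- 1) = - 1" by (rule Q_minus_1)
    show "\<exists>A B N. 0 < A \<and> A \<le> B \<and>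
            N \<in> null_sets lebesgue \<and>
            (\<forall>w\<in>N. \<not> (isCont E w \<and> isCont E (w + 2 * pi) \<and>
                       isCont (\<lambda>v. P (cis (- (v / 2)))) w \<and>
                       isCont (\<lambda>v. P (cis (- (v / 2)))) (w + 2 * pi) \<and>
                       isCont (\<lambda>v. Q (cis (- (v / 2)))) w)) \<and>
            (\<forall>w. w \<notin> N \<longrightarrow> (let z = cis (- (w / 2));
                                  D = cnj (P (- z)) * E (w + 2 * pi) + cnj (P z) * E w
                              in A \<le> (cmod D)\<^sup>2 \<and> (cmod D)\<^sup>2 \<le> B \<and>
                                 Q z = z * E (w + 2 * pi) * cnj (P (- z)) / D))"
    proof (intro exI conjI)
      show "\<forall>w\<in>N. \<not> (isCont E w \<and> isCont E (w + 2 * pi) \<and>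
                       isCont (\<lambda>v. P (cis (- (v / 2)))) w \<and>
                       isCont (\<lambda>v. P (cis (- (v / 2)))) (w + 2 * pi) \<and>
                       isCont (\<lambda>v. Q (cis (- (v / 2)))) w)"
        unfolding N_def using cont by blast
      show "\<forall>w. w \<notin> N \<longrightarrow> (let z = cis (- (w / 2));
                                  D = cnj (P (- z)) * E (w + 2 * pi) + cnj (P z) * E w
                              in K \<le> (cmod D)\<^sup>2 \<and> (cmod D)\<^sup>2 \<le> L \<and>
                                 Q z = z * E (w + 2 * pi) * cnj (P (- z)) / D)"
        unfolding N_def Let_def by (simp add: ok_def D'_def)
    qed (rule K N)+
  qed
qed

end
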